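(* Let $u\in L^3(\mathbb{T}^d\times(0,T))$ be a weak solution to the incompressible Euler equations on $\mathbb{T}^d\times(0,T)$ with pressure $q$ and Duchon--Robert distribution $D$. For $\ell>0$ let the subscript $\ell$ denote mollification in the space variable at scale $\ell$, and set $$E^\ell=\frac{|u-u_\ell|^2}{2},\qquad Q^\ell=\Big(\frac{|u-u_\ell|^2}{2}+(q-q_\ell)\Big)(u-u_\ell),\qquad R^\ell=u_\ell\otimes u_\ell-(u\otimes u)_\ell,$$ $$C^\ell=(u-u_\ell)\cdot\operatorname{div}R^\ell+(u-u_\ell)\otimes(u-u_\ell):\nabla u_\ell .$$ Then, for all $\ell>0$, $$-D=(\partial_t+u_\ell\cdot\nabla)E^\ell+\operatorname{div}Q^\ell+C^\ell\qquad\text{in the sense of distributions on }\mathbb{T}^d\times(0,T).$$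
   Context: Euler equations on $\mathbb{T}^d\times(0,T)$: $\partial_t u+\operatorname{div}(u\otimes u)+\nabla q=0$, $\operatorname{div}u=0$. Weak solutions are understood in the sense of distributions (testing with divergence-free vector fields); the pressure $q$ is the unique zero-spatial-mean solution of $-\Delta q=\operatorname{div}\operatorname{div}(u\otimes u)$. Duchon--Robert distribution: $D$ is the distribution on $\mathbb{T}^d\times(0,T)$ defined by $$\partial_t\frac{|u|^2}{2}+\operatorname{div}\Big(\Big(\frac{|u|^2}{2}+q\Big)u\Big)=-D .$$ Space mollification: $f_\ell=f*_x\rho_\ell$ with $\rho_\ell(x)=\ell^{-d}\rho(x/\ell)$ and $\rho$ a standard (smooth, non-negative, even, compactly supported, integral one) Friedrichs mollifier on $\mathbb{R}^d$; $f$ is regarded as periodic. $A:B=\sum_{i,j}A_{ij}B_{ij}$. Since $u_\ell$ is divergence-free, $u_\ell\cdot\nabla E^\ell$ is understood as $\operatorname{div}(u_\ell E^\ell)$. *)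

theory Defs
  imports "HOL-Analysis.Analysis"
begin

text \<open>
  The torus is \<open>T^d = R^d / Z^d\<close>, with \<open>d = CARD('d)\<close>. A function on \<open>T^d \<times> (0,T)\<close> is a function of
  \<open>(x, t)\<close> that is \<open>Z^d\<close>-periodic in \<open>x\<close> for \<open>t \<in> (0,T)\<close>; its values at other times are irrelevant.
  Integrals over the torus are taken over the closed unit cube, whose boundary is a null set.
\<close>

definition periodic_in_space :: "real \<Rightarrow> ((real^'d) \<times> real \<Rightarrow> 'b) \<Rightarrow> bool" where
  "periodic_in_space T f \<longleftrightarrow>
     (\<forall>x k. \<forall>t\<in>{0<..<T}. (\<forall>i. k $ i \<in> \<int>) \<longrightarrow> f (x + k, t) = f (x, t))"

definition unit_cell :: "(real^'d) set" where
  "unit_cell = cbox 0 1"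

definition cylinder :: "real \<Rightarrow> ((real^'d) \<times> real) set" where
  "cylinder T = unit_cell \<times> {0<..<T}"

definition Lp_torus ::
  "real \<Rightarrow> real \<Rightarrow> ((real^'d) \<times> real \<Rightarrow> 'b::euclidean_space) \<Rightarrow> bool" where
  "Lp_torus p T f \<longleftrightarrow>
     periodic_in_space T f \<and>
     set_borel_measurable lebesgue (cylinder T) f \<and>
     set_integrable lebesgue (cylinder T) (\<lambda>z. norm (f z) powr p)"

primrec C_k :: "nat \<Rightarrow> ('a::euclidean_space \<Rightarrow> 'b::real_normed_vector) \<Rightarrow> bool" where
  "C_k 0 f \<longleftrightarrow> continuous_on UNIV f"
| "C_k (Suc k) f \<longleftrightarrow>
     (\<forall>x. f differentiable (at x)) \<and> (\<forall>v. C_k k (\<lambda>x. frechet_derivative f (at x) v))"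

definition C_infinity :: "('a::euclidean_space \<Rightarrow> 'b::real_normed_vector) \<Rightarrow> bool" where
  "C_infinity f \<longleftrightarrow> (\<forall>k. C_k k f)"

text \<open>
  Test functions on \<open>T^d \<times> (0,T)\<close> are extended by zero to all times. Since the torus is compact,
  compact support only concerns the time variable.
\<close>

definition test_function ::
  "real \<Rightarrow> ((real^'d) \<times> real \<Rightarrow> 'b::real_normed_vector) \<Rightarrow> bool" where
  "test_function T \<phi> \<longleftrightarrow>
     C_infinity \<phi> \<and> periodic_in_space T \<phi> \<and>
     (\<exists>a b. 0 < a \<and> b < T \<and> (\<forall>x t. t \<notin> {a..b} \<longrightarrow> \<phi> (x, t) = 0))"

definition pd_time ::
  "((real^'d) \<times> real \<Rightarrow> 'b::real_normed_vector) \<Rightarrow> (real^'d) \<times> real \<Rightarrow> 'b" where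
  "pd_time f = (\<lambda>(x, t). vector_derivative (\<lambda>s. f (x, s)) (at t))"

definition pd_space ::
  "'d \<Rightarrow> ((real^'d) \<times> real \<Rightarrow> 'b::real_normed_vector) \<Rightarrow> (real^'d) \<times> real \<Rightarrow> 'b" where
  "pd_space i f = (\<lambda>(x, t). vector_derivative (\<lambda>s. f (x + s *\<^sub>R axis i 1, t)) (at 0))"

text \<open>
  Conventions: \<open>(\<nabla>v)\<^sub>i\<^sub>j = \<partial>\<^sub>i v\<^sub>j\<close> and \<open>(div A)\<^sub>j = \<Sum>\<^sub>i \<partial>\<^sub>i A\<^sub>i\<^sub>j\<close>. The double contraction
  \<open>A : B\<close> is the inner product of matrices, \<open>A \<bullet> B\<close>.
\<close>

definition gradient :: "((real^'d) \<times> real \<Rightarrow> real^'d) \<Rightarrow> (real^'d) \<times> real \<Rightarrow> real^'d^'d" where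
  "gradient v z = (\<chi> i. pd_space i v z)"

definition divergence ::
  "((real^'d) \<times> real \<Rightarrow> 'b::real_normed_vector^'d) \<Rightarrow> (real^'d) \<times> real \<Rightarrow> 'b" where
  "divergence F z = (\<Sum>i\<in>UNIV. pd_space i F z $ i)"

definition tensor :: "real^'d \<Rightarrow> real^'d \<Rightarrow> real^'d^'d" where
  "tensor v w = (\<chi> i j. v $ i * w $ j)"

text \<open>
  Distributions on \<open>T^d \<times> (0,T)\<close> are represented as functionals on scalar test functions; only their
  values at \<open>\<phi>\<close> with \<open>test_function T \<phi>\<close> are meaningful.
\<close>

type_synonym 'd distribution = "((real^'d) \<times> real \<Rightarrow> real) \<Rightarrow> real"

definition regular_dist :: "real \<Rightarrow> ((real^'d) \<times> real \<Rightarrow> real) \<Rightarrow> 'd distribution" where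
  "regular_dist T f \<phi> = (LINT z:cylinder T|lebesgue. f z * \<phi> z)"

definition dist_time :: "'d::finite distribution \<Rightarrow> 'd distribution" where
  "dist_time \<Lambda> \<phi> = - \<Lambda> (pd_time \<phi>)"

definition dist_space :: "'d::finite \<Rightarrow> 'd distribution \<Rightarrow> 'd distribution" where
  "dist_space i \<Lambda> \<phi> = - \<Lambda> (pd_space i \<phi>)"

definition dist_div :: "real \<Rightarrow> ((real^'d) \<times> real \<Rightarrow> real^'d) \<Rightarrow> 'd distribution" where
  "dist_div T F \<phi> = (\<Sum>i\<in>UNIV. dist_space i (regular_dist T (\<lambda>z. F z $ i)) \<phi>)"

definition weak_euler_solution :: "real \<Rightarrow> ((real^'d) \<times> real \<Rightarrow> real^'d) \<Rightarrow> bool" where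
  "weak_euler_solution T u \<longleftrightarrow>
     (\<forall>\<phi>. test_function T \<phi> \<longrightarrow> dist_div T u \<phi> = 0) \<and>
     (\<forall>\<psi> :: (real^'d) \<times> real \<Rightarrow> real^'d. test_function T \<psi> \<and> (\<forall>z. divergence \<psi> z = 0) \<longrightarrow>
        (LINT z:cylinder T|lebesgue.
           u z \<bullet> pd_time \<psi> z + tensor (u z) (u z) \<bullet> gradient \<psi> z) = 0)"

text \<open>
  For \<open>u \<in> L^3\<close> the solution class of the pressure equation is \<open>L^{3/2}\<close>, as given by
  Calderon-Zygmund theory; this is what gives a meaning to the product \<open>q u\<close>.
\<close>

definition euler_pressure ::
  "real \<Rightarrow> ((real^'d) \<times> real \<Rightarrow> real^'d) \<Rightarrow> ((real^'d) \<times> real \<Rightarrow> real) \<Rightarrow> bool" where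
  "euler_pressure T u q \<longleftrightarrow>
     Lp_torus (3/2) T q \<and>
     (AE t in lebesgue. t \<in> {0<..<T} \<longrightarrow> (LINT x:unit_cell|lebesgue. q (x, t)) = 0) \<and>
     (\<forall>\<phi>. test_function T \<phi> \<longrightarrow>
        - (\<Sum>i\<in>UNIV. dist_space i (dist_space i (regular_dist T q)) \<phi>) =
        (\<Sum>i\<in>UNIV. \<Sum>j\<in>UNIV.
           dist_space i (dist_space j (regular_dist T (\<lambda>z. tensor (u z) (u z) $ i $ j))) \<phi>))"

definition duchon_robert ::
  "real \<Rightarrow> ((real^'d) \<times> real \<Rightarrow> real^'d) \<Rightarrow> ((real^'d) \<times> real \<Rightarrow> real) \<Rightarrow> 'd distribution" where
  "duchon_robert T u q \<phi> =
     - (dist_time (regular_dist T (\<lambda>z. (norm (u z))\<^sup>2 / 2)) \<phi> +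
        dist_div T (\<lambda>z. ((norm (u z))\<^sup>2 / 2 + q z) *\<^sub>R u z) \<phi>)"

definition friedrichs_mollifier :: "(real^'d \<Rightarrow> real) \<Rightarrow> bool" where
  "friedrichs_mollifier \<rho> \<longleftrightarrow>
     C_infinity \<rho> \<and> (\<forall>x. 0 \<le> \<rho> x) \<and> (\<forall>x. \<rho> (- x) = \<rho> x) \<and>
     compact (closure {x. \<rho> x \<noteq> 0}) \<and> (LINT x|lebesgue. \<rho> x) = 1"

definition mollify ::
  "(real^'d \<Rightarrow> real) \<Rightarrow> real \<Rightarrow> ((real^'d) \<times> real \<Rightarrow> 'b::euclidean_space) \<Rightarrow> (real^'d) \<times> real \<Rightarrow> 'b" where
  "mollify \<rho> l f = (\<lambda>(x, t).
     LINT y|lebesgue. (\<rho> ((1 / l) *\<^sub>R y) / l ^ CARD('d)) *\<^sub>R f (x - y, t))"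

definition E_moll ::
  "(real^'d \<Rightarrow> real) \<Rightarrow> real \<Rightarrow> ((real^'d) \<times> real \<Rightarrow> real^'d) \<Rightarrow> (real^'d) \<times> real \<Rightarrow> real" where
  "E_moll \<rho> l u z = (norm (u z - mollify \<rho> l u z))\<^sup>2 / 2"

definition Q_moll ::
  "(real^'d \<Rightarrow> real) \<Rightarrow> real \<Rightarrow> ((real^'d) \<times> real \<Rightarrow> real^'d) \<Rightarrow> ((real^'d) \<times> real \<Rightarrow> real) \<Rightarrow>
     (real^'d) \<times> real \<Rightarrow> real^'d" where
  "Q_moll \<rho> l u q z =
     ((norm (u z - mollify \<rho> l u z))\<^sup>2 / 2 + (q z - mollify \<rho> l q z)) *\<^sub>R (u z - mollify \<rho> l u z)"

definition R_moll ::
  "(real^'d \<Rightarrow> real) \<Rightarrow> real \<Rightarrow> ((real^'d) \<times> real \<Rightarrow> real^'d) \<Rightarrow> (real^'d) \<times> real \<Rightarrow> real^'d^'d" where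
  "R_moll \<rho> l u z =
     tensor (mollify \<rho> l u z) (mollify \<rho> l u z) - mollify \<rho> l (\<lambda>w. tensor (u w) (u w)) z"

text \<open>
  The derivatives in \<open>C_moll\<close> are classical: for almost every \<open>t\<close> the fields \<open>u\<^sub>l(\<cdot>, t)\<close> and
  \<open>R\<^sup>l(\<cdot>, t)\<close> are smooth in \<open>x\<close>.
\<close>

definition C_moll ::
  "(real^'d \<Rightarrow> real) \<Rightarrow> real \<Rightarrow> ((real^'d) \<times> real \<Rightarrow> real^'d) \<Rightarrow> (real^'d) \<times> real \<Rightarrow> real" where
  "C_moll \<rho> l u z =
     (u z - mollify \<rho> l u z) \<bullet> divergence (R_moll \<rho> l u) z +
     tensor (u z - mollify \<rho> l u z) (u z - mollify \<rho> l u z) \<bullet> gradient (mollify \<rho> l u) z"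

end

theory Submission
  imports Defs
begin

text \<open>
  Expand \<open>\<bar>u - u\<^sub>l\<bar>\<^sup>2 / 2 = \<bar>u\<bar>\<^sup>2 / 2 - u \<bullet> u\<^sub>l + \<bar>u\<^sub>l\<bar>\<^sup>2 / 2\<close>: the first term together with its flux gives \<open>-D\<close>, so the
  point is to compute \<open>\<partial>\<^sub>t (u \<bullet> u\<^sub>l)\<close> and \<open>\<partial>\<^sub>t \<bar>u\<^sub>l\<bar>\<^sup>2\<close>. For fixed \<open>x\<close> the mollified momentum equation shows that
  \<open>u\<^sub>l (x, \<cdot>)\<close> has an integrable weak derivative, so the one-dimensional product rule applies to
  \<open>u\<^sub>\<delta> \<bullet> u\<^sub>l\<close> for any two scales; the product \<open>u \<bullet> u\<^sub>l\<close> is reached as \<open>\<delta> \<rightarrow> 0\<close>, where \<open>u\<^sub>\<delta>\<close> is only paired with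
  functions that are smooth in space, so the mollification can be moved onto the latter. What remains is a
  pointwise identity in \<open>t\<close> that uses only \<open>div u = 0\<close>.

  The weak formulation involves divergence-free test fields only. To test with \<open>K (z - x) \<eta> (t) e\<^sub>j\<close>, note that
  \<open>\<Delta>a e\<^sub>j - \<nabla> \<partial>\<^sub>j a\<close> is divergence free, while gradients are handled by the pressure equation; hence the momentum
  functional vanishes on Laplacians, so as a function of \<open>z\<close> it is harmonic and periodic, that is, constant.
\<close>

section \<open>Calculus of smooth functions\<close>

text \<open>The obstacle is regularity in time. The velocity has a usable time derivative only after
  it is smeared out in space, and the cubic products that then occur, velocity against momentum
  flux, are exactly borderline for \<open>u\<close> in L^3 and \<open>q\<close> in L^(3/2). Hence
  the limit in the second scale needs a majorant independent of that scale: its mollifier is always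
  transferred to the factor that is continuous in space, and every estimate counts powers of one
  slice norm, at most the third.

  Two kinds of null sets have to be controlled. Mollified fields are differentiated classically
  along whole lines of a slice, so representatives must be exchanged slice by slice. And
  incompressibility of almost every slice has to come from countably many kernels and points, before
  test functions that depend on time are inserted.

  The theory of weak derivatives in one variable rests on Fubini's theorem alone; its smooth cutoffs
  come from \<open>\<rho>\<close> itself, restricted to a line.\<close>

lemma frechet_derivative_worksI:
  "f differentiable (at x) \<Longrightarrow> (f has_derivative frechet_derivative f (at x)) (at x)"
  using frechet_derivative_works by blast

lemma has_derivative_imp_eq:
  assumes "(f has_derivative f') (at x)"
  shows "frechet_derivative f (at x) = f'" "f differentiable (at x)"
  using frechet_derivative_at[OF assms] differentiableI[OF assms] by simp_all

lemma C_k_SucD: "C_k (Suc k) f \<Longrightarrow> C_k k f"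
proof (induction k arbitrary: f)
  case 0
  then show ?case
    by (auto intro!: continuous_at_imp_continuous_on differentiable_imp_continuous_within)
next
  case (Suc k)
  then show ?case by (metis C_k.simps(2))
qed

text \<open>Smoothness may be checked near each point with a different comparison function. This is
  what a periodized kernel needs: it is a fixed finite sum only locally.\<close>

lemma C_k_local:
  assumes "\<And>x. \<exists>U g. open U \<and> x \<in> U \<and> C_k k g \<and> (\<forall>y\<in>U. f y = g y)"
  shows "C_k k f"
  using assms
proof (induction k arbitrary: f)
  case 0
  show ?case
  proof (simp, rule continuous_at_imp_continuous_on, rule ballI)
    fix x
    obtain U g where U: "open U" "x \<in> U" "C_k 0 g" "\<forall>y\<in>U. f y = g y" using 0 by blast
    then have "continuous (at x) g" by (simp add: continuous_on_eq_continuous_at)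
    moreover have "eventually (\<lambda>y. f y = g y) (nhds x)"
      using U by (auto simp: eventually_nhds)
    ultimately show "isCont f x" using isCont_cong by blast
  qed
next
  case (Suc k)
  \<comment> \<open>Agreement on an open set gives equal derivatives on all of it, so the same
    neighbourhood serves for the derivative in the induction.\<close>
  have *: "\<exists>U g. open U \<and> x \<in> U \<and> C_k (Suc k) g \<and>
      (\<forall>y\<in>U. f differentiable (at y) \<and> frechet_derivative f (at y) = frechet_derivative g (at y))" for x
  proof -
    obtain U g where U: "open U" "x \<in> U" "C_k (Suc k) g" "\<forall>y\<in>U. f y = g y"
      using Suc.prems by blast
    have "f differentiable (at y) \<and> frechet_derivative f (at y) = frechet_derivative g (at y)"
      if "y \<in> U" for y
    proof -
      have "(g has_derivative frechet_derivative g (at y)) (at y)"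
        using U(3) by (simp add: frechet_derivative_worksI)
      then have "(f has_derivative frechet_derivative g (at y)) (at y)"
        by (rule has_derivative_transform_within_open[OF _ U(1) that]) (use U in auto)
      then show ?thesis by (simp add: has_derivative_imp_eq)
    qed
    with U show ?thesis by blast
  qed
  show ?case
  proof (simp, intro conjI allI)
    show "f differentiable (at x)" for x using * by blast
    show "C_k k (\<lambda>x. frechet_derivative f (at x) v)" for v
    proof (rule Suc.IH)
      fix x
      obtain U g where U: "open U" "x \<in> U" "C_k (Suc k) g"
        and eq: "\<forall>y\<in>U. f differentiable (at y) \<and> frechet_derivative f (at y) = frechet_derivative g (at y)"
        using *[of x] by (elim exE conjE)
      have "C_k k (\<lambda>x. frechet_derivative g (at x) v)" using U(3) by simp
      moreover have "\<forall>y\<in>U. frechet_derivative f (at y) v = frechet_derivative g (at y) v"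
        using eq by (auto dest: bspec)
      ultimately show "\<exists>U g. open U \<and> x \<in> U \<and> C_k k g \<and> (\<forall>y\<in>U. frechet_derivative f (at y) v = g y)"
        using U(1,2) by (intro exI conjI)
    qed
  qed
qed

lemma C_k_const: "C_k k (\<lambda>x. c)"
  by (induction k arbitrary: c) (auto simp: frechet_derivative_const)

lemma C_k_linear_comp:
  assumes "bounded_linear L" "C_k k f"
  shows "C_k k (\<lambda>x. L (f x))"
  using assms(2)
proof (induction k arbitrary: f)
  case 0
  then show ?case
    using bounded_linear.continuous_on[OF assms(1)] by auto
next
  case (Suc k)
  have "((\<lambda>x. L (f x)) has_derivative (\<lambda>v. L (frechet_derivative f (at x) v))) (at x)" for x
    using Suc.prems by (intro bounded_linear.has_derivative[OF assms(1)])
      (simp add: frechet_derivative_worksI)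
  then have "frechet_derivative (\<lambda>x. L (f x)) (at x) = (\<lambda>v. L (frechet_derivative f (at x) v))"
    "(\<lambda>x. L (f x)) differentiable (at x)" for x
    by (simp add: has_derivative_imp_eq(1), blast intro: differentiableI)
  with Suc show ?case by simp
qed

lemma C_k_add:
  assumes "C_k k p" "C_k k r"
  shows "C_k k (\<lambda>x. p x + r x)"
  using assms
proof (induction k arbitrary: p r)
  case 0
  then show ?case by (auto intro: continuous_intros)
next
  case (Suc k)
  have "((\<lambda>x. p x + r x) has_derivative
    (\<lambda>v. frechet_derivative p (at x) v + frechet_derivative r (at x) v)) (at x)" for x
    using Suc.prems by (intro has_derivative_add) (simp_all add: frechet_derivative_worksI)
  then have "frechet_derivative (\<lambda>x. p x + r x) (at x) =
     (\<lambda>v. frechet_derivative p (at x) v + frechet_derivative r (at x) v)"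
    "(\<lambda>x. p x + r x) differentiable (at x)" for x
    by (simp add: has_derivative_imp_eq(1), blast intro: differentiableI)
  with Suc show ?case by simp
qed

lemma C_k_bilinear:
  assumes "bounded_bilinear B" "C_k k f" "C_k k g"
  shows "C_k k (\<lambda>x. B (f x) (g x))"
  using assms(2,3)
proof (induction k arbitrary: f g)
  case 0
  then show ?case
    using bounded_bilinear.continuous_on[OF assms(1)] by auto
next
  case (Suc k)
  have "((\<lambda>x. B (f x) (g x)) has_derivative
    (\<lambda>v. B (f x) (frechet_derivative g (at x) v) + B (frechet_derivative f (at x) v) (g x))) (at x)" for x
    using Suc.prems by (intro bounded_bilinear.FDERIV[OF assms(1)])
      (simp_all add: frechet_derivative_worksI)
  then have *: "frechet_derivative (\<lambda>x. B (f x) (g x)) (at x) =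
     (\<lambda>v. B (f x) (frechet_derivative g (at x) v) + B (frechet_derivative f (at x) v) (g x))"
    "(\<lambda>x. B (f x) (g x)) differentiable (at x)" for x
    by (simp add: has_derivative_imp_eq(1), blast intro: differentiableI)
  \<comment> \<open>The product rule leaves one factor undifferentiated, so the induction hypothesis
    is also applied to \<open>f\<close> and \<open>g\<close> themselves, one order lower.\<close>
  have "C_k k f" "C_k k g" using Suc.prems C_k_SucD by blast+
  then show ?case using Suc.prems * by (auto intro!: C_k_add Suc.IH)
qed

lemma C_k_affine:
  assumes "bounded_linear A" "C_k k f"
  shows "C_k k (\<lambda>x. f (A x + b))"
  using assms(2)
proof (induction k arbitrary: f)
  case 0
  have "continuous_on UNIV (\<lambda>x. A x + b)"
    by (intro continuous_intros linear_continuous_on assms)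
  with 0 show ?case
    using continuous_on_compose2[of UNIV f UNIV "\<lambda>x. A x + b"] by auto
next
  case (Suc k)
  have "((\<lambda>x. A x + b) has_derivative (\<lambda>v. A v)) (at x)" for x
    using assms(1) by (auto intro!: derivative_eq_intros bounded_linear_imp_has_derivative)
  moreover have "(f has_derivative frechet_derivative f (at (A x + b))) (at (A x + b))" for x
    using Suc.prems by (simp add: frechet_derivative_worksI)
  ultimately have "((\<lambda>x. f (A x + b)) has_derivative
    (\<lambda>v. frechet_derivative f (at (A x + b)) (A v))) (at x)" for x
    by (rule has_derivative_compose)
  then have "frechet_derivative (\<lambda>x. f (A x + b)) (at x) = (\<lambda>v. frechet_derivative f (at (A x + b)) (A v))"
    "(\<lambda>x. f (A x + b)) differentiable (at x)" for x
    by (simp add: has_derivative_imp_eq(1), blast intro: differentiableI)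
  moreover have "C_k k (\<lambda>x. frechet_derivative f (at (A x + b)) (A v))" for v
    using Suc.IH[of "\<lambda>x. frechet_derivative f (at x) (A v)"] Suc.prems by simp
  ultimately show ?case by simp
qed

abbreviation dd :: "'a::euclidean_space \<Rightarrow> ('a \<Rightarrow> 'b::real_normed_vector) \<Rightarrow> 'a \<Rightarrow> 'b" where
  "dd v f \<equiv> (\<lambda>x. frechet_derivative f (at x) v)"

lemma C_infinity_const [simp]: "C_infinity (\<lambda>x. c)"
  by (simp add: C_infinity_def C_k_const)

lemma C_infinity_add: "C_infinity f \<Longrightarrow> C_infinity g \<Longrightarrow> C_infinity (\<lambda>x. f x + g x)"
  by (simp add: C_infinity_def C_k_add)

lemma C_infinity_linear_comp: "bounded_linear L \<Longrightarrow> C_infinity f \<Longrightarrow> C_infinity (\<lambda>x. L (f x))"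
  by (simp add: C_infinity_def C_k_linear_comp)

lemma C_infinity_minus: "C_infinity f \<Longrightarrow> C_infinity (\<lambda>x. - f x)"
  using C_infinity_linear_comp[OF bounded_linear_minus[OF bounded_linear_ident]] by blast

lemma C_infinity_diff: "C_infinity f \<Longrightarrow> C_infinity g \<Longrightarrow> C_infinity (\<lambda>x. f x - g x)"
  using C_infinity_add[OF _ C_infinity_minus, of f g] by simp

lemma C_infinity_scaleR:
  "C_infinity f \<Longrightarrow> C_infinity g \<Longrightarrow> C_infinity (\<lambda>x. f x *\<^sub>R g x)"
  by (simp add: C_infinity_def C_k_bilinear[OF bounded_bilinear_scaleR])

lemma C_infinity_mult:
  fixes f g :: "'a::euclidean_space \<Rightarrow> real"
  shows "C_infinity f \<Longrightarrow> C_infinity g \<Longrightarrow> C_infinity (\<lambda>x. f x * g x)"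
  by (simp add: C_infinity_def C_k_bilinear[OF bounded_bilinear_mult])

lemma C_infinity_sum:
  "(\<And>i. i \<in> I \<Longrightarrow> C_infinity (f i)) \<Longrightarrow> C_infinity (\<lambda>x. \<Sum>i\<in>I. f i x)"
  by (induction I rule: infinite_finite_induct) (auto intro: C_infinity_add)

lemma C_infinity_affine: "C_infinity f \<Longrightarrow> bounded_linear A \<Longrightarrow> C_infinity (\<lambda>x. f (A x + b))"
  by (simp add: C_infinity_def C_k_affine)

lemma C_infinity_local:
  assumes "\<And>x. \<exists>U g. open U \<and> x \<in> U \<and> C_infinity g \<and> (\<forall>y\<in>U. f y = g y)"
  shows "C_infinity f"
  unfolding C_infinity_def
proof
  fix k show "C_k k f" by (rule C_k_local) (metis assms C_infinity_def)
qed

lemma C_infinity_dd: "C_infinity f \<Longrightarrow> C_infinity (dd v f)"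
  unfolding C_infinity_def by (metis C_k.simps(2))

lemma C_infinity_differentiable: "C_infinity f \<Longrightarrow> f differentiable (at x)"
  unfolding C_infinity_def by (metis C_k.simps(2))

lemma C_infinity_has_derivative:
  "C_infinity f \<Longrightarrow> (f has_derivative frechet_derivative f (at x)) (at x)"
  using C_infinity_differentiable frechet_derivative_works by blast

lemma C_infinity_continuous: "C_infinity f \<Longrightarrow> continuous_on S f"
  unfolding C_infinity_def by (metis C_k.simps(1) continuous_on_subset subset_UNIV)

lemma C_infinity_measurable [measurable_dest]: "C_infinity f \<Longrightarrow> f \<in> borel_measurable borel"
  by (intro borel_measurable_continuous_onI C_infinity_continuous)

lemma C_infinity_line_derivative:
  assumes "C_infinity f"
  shows "((\<lambda>s. f (x + s *\<^sub>R v)) has_vector_derivative dd v f (x + s *\<^sub>R v)) (at s)"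
proof -
  have "((\<lambda>s. x + s *\<^sub>R v) has_derivative (\<lambda>h. h *\<^sub>R v)) (at s)"
    by (auto intro!: derivative_eq_intros)
  from has_derivative_compose[OF this C_infinity_has_derivative[OF assms]]
  have "((\<lambda>s. f (x + s *\<^sub>R v)) has_derivative (\<lambda>h. frechet_derivative f (at (x + s *\<^sub>R v)) (h *\<^sub>R v))) (at s)" .
  then show ?thesis
    unfolding has_vector_derivative_def
    using linear_frechet_derivative[OF C_infinity_differentiable[OF assms]]
    by (simp add: linear_cmul)
qed

lemma dd_affine:
  assumes "C_infinity f" "bounded_linear A"
  shows "dd v (\<lambda>x. f (A x + b)) x = dd (A v) f (A x + b)"
proof -
  have "((\<lambda>x. A x + b) has_derivative (\<lambda>v. A v)) (at x)"
    using assms(2) by (auto intro!: derivative_eq_intros bounded_linear_imp_has_derivative)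
  from has_derivative_imp_eq(1)[OF has_derivative_compose[OF this C_infinity_has_derivative[OF assms(1)]]]
  show ?thesis by simp
qed

lemma dd_linear_comp:
  assumes "bounded_linear L" "C_infinity f"
  shows "dd v (\<lambda>x. L (f x)) x = L (dd v f x)"
  using has_derivative_imp_eq(1)[OF bounded_linear.has_derivative[OF assms(1) C_infinity_has_derivative[OF assms(2)]]]
  by simp

text \<open>Used to turn primitives, of a bump and of a test function with mean zero, back into
  smooth functions.\<close>

lemma C_infinity_antiderivative:
  fixes f :: "real \<Rightarrow> real"
  assumes "\<And>x. (f has_real_derivative f' x) (at x)" "C_infinity f'"
  shows "C_infinity f"
proof -
  have "(f has_derivative (\<lambda>v. f' x * v)) (at x)" for x
    using assms(1) by (simp add: has_field_derivative_def)
  then have *: "frechet_derivative f (at x) = (\<lambda>v. f' x * v)" "f differentiable (at x)" for x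
    by (simp add: has_derivative_imp_eq(1), blast intro: differentiableI)
  have "C_k (Suc k) f" for k
    using * assms(2) C_infinity_linear_comp[OF bounded_linear_mult_left assms(2)]
    by (simp add: C_infinity_def)
  then show ?thesis unfolding C_infinity_def using C_k_SucD by blast
qed

lemma C_infinity_line_real:
  assumes "C_infinity (f :: 'a::euclidean_space \<Rightarrow> real)"
  shows "((\<lambda>s. f (x + s *\<^sub>R v)) has_real_derivative dd v f (x + s *\<^sub>R v)) (at s)"
  using C_infinity_line_derivative[OF assms]
  by (simp add: has_real_derivative_iff_has_vector_derivative)

section \<open>Symmetry of mixed second derivatives\<close>

text \<open>The mean value theorem twice: for the difference of \<open>f\<close> along two parallel
  segments in direction \<open>v\<close>, then for \<open>dd v f\<close> in direction
  \<open>w\<close>.\<close>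

lemma second_difference:
  fixes f :: "'a::euclidean_space \<Rightarrow> real"
  assumes f: "C_infinity f" and h: "h > 0"
  shows "\<exists>\<xi> \<eta>. 0 < \<xi> \<and> \<xi> < h \<and> 0 < \<eta> \<and> \<eta> < h \<and>
    f (x + h *\<^sub>R v + h *\<^sub>R w) - f (x + h *\<^sub>R v) - f (x + h *\<^sub>R w) + f x
      = h * h * dd w (dd v f) (x + \<xi> *\<^sub>R v + \<eta> *\<^sub>R w)"
proof -
  let ?p = "\<lambda>s. f ((x + h *\<^sub>R w) + s *\<^sub>R v) - f (x + s *\<^sub>R v)"
  have "DERIV ?p s :> dd v f ((x + h *\<^sub>R w) + s *\<^sub>R v) - dd v f (x + s *\<^sub>R v)" for s
    by (intro DERIV_diff C_infinity_line_real f)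
  from MVT2[OF h this] obtain \<xi> where xi: "0 < \<xi>" "\<xi> < h"
    "?p h - ?p 0 = h * (dd v f ((x + h *\<^sub>R w) + \<xi> *\<^sub>R v) - dd v f (x + \<xi> *\<^sub>R v))"
    by auto
  have "DERIV (\<lambda>s. dd v f ((x + \<xi> *\<^sub>R v) + s *\<^sub>R w)) s :>
     dd w (dd v f) ((x + \<xi> *\<^sub>R v) + s *\<^sub>R w)" for s
    by (intro C_infinity_line_real C_infinity_dd f)
  from MVT2[OF h this] obtain \<eta> where eta: "0 < \<eta>" "\<eta> < h"
    "dd v f ((x + \<xi> *\<^sub>R v) + h *\<^sub>R w) - dd v f ((x + \<xi> *\<^sub>R v) + 0 *\<^sub>R w)
      = h * dd w (dd v f) ((x + \<xi> *\<^sub>R v) + \<eta> *\<^sub>R w)"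
    by auto
  show ?thesis
    using xi eta by (intro exI[of _ \<xi>] exI[of _ \<eta>]) (simp add: algebra_simps)
qed

text \<open>The second difference is symmetric in \<open>v\<close> and \<open>w\<close>. Written
  once with each order of differentiation, at points tending to \<open>x\<close>, it forces the two
  mixed derivatives to agree in the limit.\<close>

lemma dd_commute:
  fixes f :: "'a::euclidean_space \<Rightarrow> real"
  assumes f: "C_infinity f"
  shows "dd v (dd w f) x = dd w (dd v f) x"
proof -
  define r :: "nat \<Rightarrow> real" where "r n = 1 / real (Suc n)" for n
  have r: "r n > 0" for n by (simp add: r_def)
  have r0: "r \<longlonglongrightarrow> 0" unfolding r_def by (rule LIMSEQ_Suc[OF lim_1_over_n])
  have key: "\<exists>y. y \<longlonglongrightarrow> x \<and> (\<forall>n. f (x + r n *\<^sub>R v + r n *\<^sub>R w) - f (x + r n *\<^sub>R v) - f (x + r n *\<^sub>R w) + f x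
      = r n * r n * dd w (dd v f) (y n))" for v w
  proof -
    let ?P = "\<lambda>n \<xi> \<eta>. 0 < \<xi> \<and> \<xi> < r n \<and> 0 < \<eta> \<and> \<eta> < r n \<and>
       f (x + r n *\<^sub>R v + r n *\<^sub>R w) - f (x + r n *\<^sub>R v) - f (x + r n *\<^sub>R w) + f x
        = r n * r n * dd w (dd v f) (x + \<xi> *\<^sub>R v + \<eta> *\<^sub>R w)"
    have "\<forall>n. \<exists>\<xi> \<eta>. ?P n \<xi> \<eta>"
      by (intro allI second_difference f r)
    then obtain a where "\<forall>n. \<exists>\<eta>. ?P n (a n) \<eta>"
      by (rule choice[THEN exE])
    then obtain b where ab: "\<forall>n. ?P n (a n) (b n)"
      by (rule choice[THEN exE])
    have lim0: "c \<longlonglongrightarrow> 0" if "\<And>n. 0 < c n \<and> c n < r n" for c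
      by (rule real_tendsto_sandwich[where f="\<lambda>_. 0" and h=r])
        (simp_all add: r0 that less_imp_le)
    have "a \<longlonglongrightarrow> 0" "b \<longlonglongrightarrow> 0"
      by (rule lim0; simp add: ab)+
    then have "(\<lambda>n. x + a n *\<^sub>R v + b n *\<^sub>R w) \<longlonglongrightarrow> x + 0 *\<^sub>R v + 0 *\<^sub>R w"
      by (intro tendsto_intros)
    with ab show ?thesis by (intro exI[of _ "\<lambda>n. x + a n *\<^sub>R v + b n *\<^sub>R w"]) auto
  qed
  obtain y where y: "y \<longlonglongrightarrow> x" "\<And>n. f (x + r n *\<^sub>R v + r n *\<^sub>R w) - f (x + r n *\<^sub>R v) - f (x + r n *\<^sub>R w) + f x
      = r n * r n * dd w (dd v f) (y n)" using key by blast
  obtain z where z: "z \<longlonglongrightarrow> x" "\<And>n. f (x + r n *\<^sub>R w + r n *\<^sub>R v) - f (x + r n *\<^sub>R w) - f (x + r n *\<^sub>R v) + f x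
      = r n * r n * dd v (dd w f) (z n)" using key by blast
  have "dd w (dd v f) (y n) = dd v (dd w f) (z n)" for n
  proof -
    have "x + r n *\<^sub>R w + r n *\<^sub>R v = x + r n *\<^sub>R v + r n *\<^sub>R w" by simp
    then have "r n * r n * dd w (dd v f) (y n) = r n * r n * dd v (dd w f) (z n)"
      using y(2)[of n] z(2)[of n] by (simp only:)
    with r[of n] show ?thesis by simp
  qed
  moreover have "(\<lambda>n. dd w (dd v f) (y n)) \<longlonglongrightarrow> dd w (dd v f) x"
    by (rule continuous_on_tendsto_compose[OF C_infinity_continuous[where S=UNIV, OF C_infinity_dd[OF C_infinity_dd[OF f]]] y(1)]) auto
  moreover have "(\<lambda>n. dd v (dd w f) (z n)) \<longlonglongrightarrow> dd v (dd w f) x"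
    by (rule continuous_on_tendsto_compose[OF C_infinity_continuous[where S=UNIV, OF C_infinity_dd[OF C_infinity_dd[OF f]]] z(1)]) auto
  ultimately show ?thesis by (simp add: LIMSEQ_unique)
qed

section \<open>The torus as a quotient by the integer lattice\<close>

definition lattice :: "(real^'d) set" where
  "lattice = {k. \<forall>i. k $ i \<in> \<int>}"

definition lattice_periodic :: "(real^'d \<Rightarrow> 'b) \<Rightarrow> bool" where
  "lattice_periodic f \<longleftrightarrow> (\<forall>x. \<forall>k\<in>lattice. f (x + k) = f x)"

definition floor_vec :: "real^'d \<Rightarrow> real^'d" where
  "floor_vec x = (\<chi> i. of_int \<lfloor>x $ i\<rfloor>)"

definition frac_vec :: "real^'d \<Rightarrow> real^'d" where
  "frac_vec x = x - floor_vec x"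

text \<open>An exact fundamental domain: every point has precisely one lattice translate in it,
  whereas the translates of the closed \<open>unit_cell\<close> overlap along their faces.\<close>

definition half_open_cell :: "(real^'d) set" where
  "half_open_cell = {x. floor_vec x = 0}"

text \<open>The torus measure is encoded as a probability measure on the whole space, so periodic
  functions are integrated without restricting them and products with other measures stay
  Borel.\<close>

definition cell_measure :: "(real^'d) measure" where
  "cell_measure = density lborel (indicator unit_cell)"

lemma lattice_add: "a \<in> lattice \<Longrightarrow> b \<in> lattice \<Longrightarrow> a + b \<in> lattice"
  and lattice_uminus: "a \<in> lattice \<Longrightarrow> - a \<in> lattice"
  and lattice_0 [simp]: "0 \<in> lattice"
  and floor_vec_lattice [simp]: "floor_vec x \<in> lattice"
  by (auto simp: lattice_def floor_vec_def)

lemma floor_vec_add: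
  assumes "k \<in> lattice"
  shows "floor_vec (x + k) = floor_vec x + k"
proof -
  have "of_int \<lfloor>x $ i + k $ i\<rfloor> = of_int \<lfloor>x $ i\<rfloor> + k $ i" for i
  proof -
    have "k $ i \<in> \<int>" using assms by (auto simp: lattice_def)
    then obtain m where "k $ i = of_int m" by (auto elim: Ints_cases)
    then show ?thesis by simp
  qed
  then show ?thesis by (simp add: floor_vec_def vec_eq_iff)
qed

lemma floor_vec_eq_iff: "k \<in> lattice \<Longrightarrow> floor_vec x = k \<longleftrightarrow> floor_vec (x - k) = 0"
  using floor_vec_add[of "-k" x] by (simp add: lattice_uminus)

lemma frac_vec_add [simp]: "k \<in> lattice \<Longrightarrow> frac_vec (x + k) = frac_vec x"
  by (simp add: frac_vec_def floor_vec_add)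

lemma floor_vec_eq_0_iff: "floor_vec x = 0 \<longleftrightarrow> (\<forall>i. 0 \<le> x $ i \<and> x $ i < 1)"
  by (auto simp: floor_vec_def vec_eq_iff floor_eq_iff)

lemma frac_vec_id: "floor_vec x = 0 \<Longrightarrow> frac_vec x = x"
  by (simp add: frac_vec_def)

lemma floor_frac_vec [simp]: "floor_vec (frac_vec x) = 0"
  using floor_vec_eq_iff[of "floor_vec x" x] by (simp add: frac_vec_def)

lemma lattice_periodicD: "lattice_periodic f \<Longrightarrow> k \<in> lattice \<Longrightarrow> f (x + k) = f x"
  by (simp add: lattice_periodic_def)

lemma lattice_periodic_frac: "lattice_periodic f \<Longrightarrow> f (frac_vec x) = f x"
  using lattice_periodicD[of f "- floor_vec x" x]
  by (simp add: frac_vec_def lattice_uminus)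

lemma measurable_cart [measurable (raw)]:
  fixes f :: "'a \<Rightarrow> real^'d"
  assumes "\<And>i. (\<lambda>x. f x $ i) \<in> borel_measurable M"
  shows "f \<in> borel_measurable M"
  using assms by (subst borel_measurable_euclidean_space) (auto simp: Basis_vec_def inner_axis)

lemma measurable_floor_vec [measurable]: "floor_vec \<in> borel_measurable borel"
  unfolding floor_vec_def by (rule measurable_cart) simp

lemma half_open_cell_sets [measurable]: "(half_open_cell :: (real^'d) set) \<in> sets borel"
proof -
  have "(half_open_cell :: (real^'d) set) = floor_vec -` {0}" by (auto simp: half_open_cell_def)
  then show ?thesis using measurable_sets_borel[OF measurable_floor_vec, of "{0 :: real^'d}"] by simp
qed

lemma measurable_frac_vec [measurable]: "frac_vec \<in> borel_measurable borel"
  unfolding frac_vec_def by measurable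

lemma sets_cell_measure [measurable_cong]: "sets cell_measure = sets borel"
  by (simp add: cell_measure_def)

lemma space_cell_measure [simp]: "space cell_measure = UNIV"
  by (simp add: cell_measure_def)

lemma unit_cell_sets [measurable]: "unit_cell \<in> sets borel"
  by (simp add: unit_cell_def)

lemma floor_vec_in_unit_cell: "floor_vec x = 0 \<Longrightarrow> x \<in> unit_cell"
  unfolding floor_vec_eq_0_iff unit_cell_def
  by (auto simp: mem_box_cart less_imp_le)

lemma AE_unit_cell_iff: "AE x in lborel. x \<in> unit_cell \<longleftrightarrow> floor_vec x = 0"
proof -
  have "negligible (\<Union>i\<in>UNIV. {x::real^'d. x $ i = 1})"
  proof (rule negligible_Union)
    show "finite (range (\<lambda>i. {x::real^'d. x $ i = 1}))" by simp
    show "negligible t" if "t \<in> range (\<lambda>i. {x::real^'d. x $ i = 1})" for t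
      using that by (auto simp: cart_eq_inner_axis axis_in_Basis_iff intro!: negligible_standard_hyperplane)
  qed
  then have "AE x in lebesgue. x \<notin> (\<Union>i. {x::real^'d. x $ i = 1})"
    unfolding negligible_iff_null_sets by (rule AE_not_in)
  then have "AE x in lborel. x \<notin> (\<Union>i. {x::real^'d. x $ i = 1})"
    by (simp add: AE_completion_iff)
  then show ?thesis
  proof eventually_elim
    case (elim x)
    then show ?case
      by (auto simp: floor_vec_eq_0_iff unit_cell_def mem_box_cart less_le)
  qed
qed

lemma cell_measure_eq: "cell_measure = density lborel (indicator half_open_cell)"
  unfolding cell_measure_def
proof (rule density_cong)
  show "AE x in lborel. indicator unit_cell x = (indicator half_open_cell x :: ennreal)"
    using AE_unit_cell_iff by eventually_elim (simp add: indicator_def half_open_cell_def)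
qed measurable

lemma emeasure_unit_cell: "emeasure lborel (unit_cell :: (real^'d) set) = 1"
proof -
  have "emeasure lborel (unit_cell :: (real^'d) set) = (\<Prod>b\<in>Basis. (1 - 0 :: real^'d) \<bullet> b)"
    unfolding unit_cell_def
    by (subst emeasure_lborel_cbox_eq) (auto simp: Basis_vec_def inner_axis)
  also have "\<dots> = 1" by (subst prod.neutral) (auto simp: Basis_vec_def inner_axis)
  finally show ?thesis by simp
qed

lemma prob_space_cell: "emeasure cell_measure UNIV = 1"
  by (simp add: cell_measure_def emeasure_density emeasure_unit_cell)

interpretation cell: finite_measure "cell_measure :: (real^'d) measure"
  by standard (simp add: prob_space_cell)

lemma measure_cell [simp]: "measure cell_measure UNIV = 1"
  by (simp add: measure_def prob_space_cell)

lemma norm_floor_vec_eq_0: "floor_vec x = 0 \<Longrightarrow> norm (x :: real^'d) \<le> real CARD('d)"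
proof -
  assume "floor_vec x = 0"
  then have "\<And>i. \<bar>x $ i\<bar> \<le> 1" by (simp add: floor_vec_eq_0_iff less_imp_le)
  then have "(\<Sum>i\<in>UNIV. \<bar>x $ i\<bar>) \<le> real CARD('d) * 1" by (intro sum_bounded_above) auto
  with norm_le_l1_cart[of x] show ?thesis by simp
qed

lemma finite_lattice_ball: "finite {n \<in> lattice. norm (n :: real^'d) \<le> M}"
proof (rule finite_subset)
  let ?A = "of_int ` {- \<lceil>M\<rceil> .. \<lceil>M\<rceil>} :: real set"
  have "finite ?A" by simp
  then show "finite ((\<lambda>f. \<chi> i. f i) ` (PiE (UNIV :: 'd set) (\<lambda>_. ?A)))"
    by (intro finite_imageI finite_PiE) auto
  show "{n \<in> lattice. norm n \<le> M} \<subseteq> (\<lambda>f. \<chi> i. f i) ` (PiE (UNIV :: 'd set) (\<lambda>_. ?A))"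
  proof
    fix n :: "real^'d" assume n: "n \<in> {n \<in> lattice. norm n \<le> M}"
    have "n $ i \<in> ?A" for i
    proof -
      from n obtain m where m: "n $ i = of_int m" by (auto simp: lattice_def elim: Ints_cases)
      have "\<bar>n $ i\<bar> \<le> M" using n component_le_norm_cart[of n i] by simp
      with m have "m \<le> \<lceil>M\<rceil>" "- \<lceil>M\<rceil> \<le> m"
        by linarith+
      with m show ?thesis by auto
    qed
    then have "(\<lambda>i. n $ i) \<in> PiE UNIV (\<lambda>_. ?A)" "n = (\<chi> i. n $ i)" by auto
    then show "n \<in> (\<lambda>f. \<chi> i. f i) ` (PiE (UNIV :: 'd set) (\<lambda>_. ?A))"
      by (intro image_eqI[where x="\<lambda>i. n $ i"])
  qed
qed

section \<open>Periodization and translation invariance\<close>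

text \<open>Only the nonzero terms are indexed: for bounded support this set is finite, while
  \<open>sum\<close> over the whole infinite lattice would be 0 by convention.\<close>

definition periodize :: "(real^'d \<Rightarrow> real) \<Rightarrow> real^'d \<Rightarrow> real" where
  "periodize \<kappa> x = (\<Sum>n\<in>{n \<in> lattice. \<kappa> (x + n) \<noteq> 0}. \<kappa> (x + n))"

lemma periodize_eq_sum:
  assumes "finite S" "S \<subseteq> lattice" "\<And>n. n \<in> lattice \<Longrightarrow> \<kappa> (x + n) \<noteq> 0 \<Longrightarrow> n \<in> S"
  shows "periodize \<kappa> x = (\<Sum>n\<in>S. \<kappa> (x + n))"
  unfolding periodize_def using assms by (intro sum.mono_neutral_left) auto

lemma periodic_periodize: "lattice_periodic (periodize \<kappa>)"
  unfolding lattice_periodic_def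
proof (intro allI ballI)
  fix x k :: "real^'a" assume k: "k \<in> lattice"
  show "periodize \<kappa> (x + k) = periodize \<kappa> x"
    unfolding periodize_def
    by (rule sum.reindex_bij_witness[where i="\<lambda>n. n - k" and j="\<lambda>n. n + k"])
      (use k lattice_add[of _ k] lattice_add[of _ "-k"] lattice_uminus[of k] in \<open>auto simp: ac_simps\<close>)
qed

lemma periodize_reflect: "periodize (\<lambda>y. \<kappa> (x - y)) y = periodize \<kappa> (x - y)"
  unfolding periodize_def
  by (rule sum.reindex_bij_witness[where i="\<lambda>n. - n" and j="\<lambda>n. - n"])
    (auto simp: lattice_uminus algebra_simps)

text \<open>Folding the space onto the torus: cut along the translates of the half-open cell, shift
  every piece back and add up. The formulation by image measures passes to Bochner integrals of
  periodic functions without a separate integrability argument.\<close>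

lemma distr_frac_vec_density:
  fixes \<kappa> :: "real^'d \<Rightarrow> real"
  assumes [measurable]: "\<kappa> \<in> borel_measurable borel" and pos: "\<And>x. 0 \<le> \<kappa> x"
    and supp: "\<And>x. \<kappa> x \<noteq> 0 \<Longrightarrow> norm x \<le> R"
    and [measurable]: "periodize \<kappa> \<in> borel_measurable borel"
  shows "distr (density lborel \<kappa>) borel frac_vec = distr (density cell_measure (periodize \<kappa>)) borel frac_vec"
proof (rule measure_eqI)
  fix A :: "(real^'d) set" assume "A \<in> sets (distr (density lborel \<kappa>) borel frac_vec)"
  then have A [measurable]: "A \<in> sets borel" by simp
  define g :: "real^'d \<Rightarrow> ennreal" where "g x = indicator A (frac_vec x)" for x
  have g_meas [measurable]: "g \<in> borel_measurable borel" unfolding g_def by measurable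
  have g_per: "g (x + n) = g x" if "n \<in> lattice" for x n using that by (simp add: g_def)
  \<comment> \<open>If \<open>\<kappa> (x + n) \<noteq> 0\<close> with \<open>x\<close> in the
    half-open cell, then the norm of \<open>n\<close> is at most \<open>R\<close> plus that of
    \<open>x\<close>, and the latter is at most the dimension.\<close>
  define S where "S = {n \<in> lattice :: (real^'d) set. norm n \<le> R + real CARD('d)}"
  have S: "finite S" "S \<subseteq> lattice" by (auto simp: S_def finite_lattice_ball)
  let ?c = "indicator half_open_cell :: _ \<Rightarrow> ennreal"
  have inS: "n \<in> S" if "n \<in> lattice" "\<kappa> (x + n) \<noteq> 0" "floor_vec x = 0" for x n
  proof -
    have "norm n \<le> norm (x + n) + norm x" by (metis add_diff_cancel_left' norm_triangle_ineq4)
    then show ?thesis using supp[OF that(2)] norm_floor_vec_eq_0[OF that(3)] that(1)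
      by (simp add: S_def)
  qed
  have "(\<integral>\<^sup>+ y. \<kappa> y * g y \<partial>lborel) = (\<integral>\<^sup>+ y. (\<Sum>n\<in>S. \<kappa> y * g y * ?c (y - n)) \<partial>lborel)"
  proof (rule nn_integral_cong)
    fix y :: "real^'d"
    show "\<kappa> y * g y = (\<Sum>n\<in>S. \<kappa> y * g y * ?c (y - n))"
    proof (cases "\<kappa> y = 0")
      case False
      have *: "floor_vec y \<in> S"
        using inS[of "floor_vec y" "frac_vec y"] False floor_frac_vec[of y]
        by (simp add: frac_vec_def del: floor_frac_vec)
      \<comment> \<open>Exactly one translate of the half-open cell contains \<open>y\<close>, the
        one based at \<open>floor_vec y\<close>.\<close>
      have "(\<Sum>n\<in>S. \<kappa> y * g y * ?c (y - n)) = (\<Sum>n\<in>S. if n = floor_vec y then \<kappa> y * g y else 0)"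
      proof (rule sum.cong, rule refl)
        fix n assume "n \<in> S"
        then have "floor_vec y = n \<longleftrightarrow> floor_vec (y - n) = 0"
          using S(2) by (intro floor_vec_eq_iff) auto
        then show "\<kappa> y * g y * ?c (y - n) = (if n = floor_vec y then \<kappa> y * g y else 0)"
          by (auto simp: indicator_def half_open_cell_def)
      qed
      then show ?thesis using * S(1) by simp
    qed simp
  qed
  also have "\<dots> = (\<Sum>n\<in>S. \<integral>\<^sup>+ y. \<kappa> y * g y * ?c (y - n) \<partial>lborel)"
    by (rule nn_integral_sum) measurable
  also have "\<dots> = (\<Sum>n\<in>S. \<integral>\<^sup>+ y. \<kappa> (y + n) * g y * ?c y \<partial>lborel)"
  proof (rule sum.cong, rule refl)
    fix n assume n: "n \<in> S"
    have "(\<integral>\<^sup>+ y. \<kappa> y * g y * ?c (y - n) \<partial>lborel)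
       = (\<integral>\<^sup>+ y. \<kappa> y * g y * ?c (y - n) \<partial>distr lborel borel ((+) n))"
      by (simp add: lborel_distr_plus)
    also have "\<dots> = (\<integral>\<^sup>+ y. \<kappa> (n + y) * g (n + y) * ?c (n + y - n) \<partial>lborel)"
      by (subst nn_integral_distr) auto
    also have "\<dots> = (\<integral>\<^sup>+ y. \<kappa> (y + n) * g y * ?c y \<partial>lborel)"
      using n S(2) g_per by (intro nn_integral_cong) (auto simp: add.commute[of n])
    finally show "(\<integral>\<^sup>+ y. \<kappa> y * g y * ?c (y - n) \<partial>lborel) = (\<integral>\<^sup>+ y. \<kappa> (y + n) * g y * ?c y \<partial>lborel)" .
  qed
  also have "\<dots> = (\<integral>\<^sup>+ y. (\<Sum>n\<in>S. \<kappa> (y + n) * g y * ?c y) \<partial>lborel)"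
    by (rule nn_integral_sum[symmetric]) measurable
  also have "\<dots> = (\<integral>\<^sup>+ y. ?c y * (periodize \<kappa> y * g y) \<partial>lborel)"
  proof (rule nn_integral_cong)
    fix y :: "real^'d"
    show "(\<Sum>n\<in>S. \<kappa> (y + n) * g y * ?c y) = ?c y * (periodize \<kappa> y * g y)"
    proof (cases "y \<in> half_open_cell")
      case True
      then have "periodize \<kappa> y = (\<Sum>n\<in>S. \<kappa> (y + n))"
        using S inS by (intro periodize_eq_sum) (auto simp: half_open_cell_def)
      then have "ennreal (periodize \<kappa> y) = (\<Sum>n\<in>S. ennreal (\<kappa> (y + n)))"
        by (simp add: sum_ennreal pos)
      then show ?thesis using True by (simp add: sum_distrib_right)
    qed simp
  qed
  also have "\<dots> = (\<integral>\<^sup>+ y. periodize \<kappa> y * g y \<partial>cell_measure)"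
    unfolding cell_measure_eq by (subst nn_integral_density) auto
  finally have *: "(\<integral>\<^sup>+ y. \<kappa> y * g y \<partial>lborel) = (\<integral>\<^sup>+ y. periodize \<kappa> y * g y \<partial>cell_measure)" .
  have ind: "g y = indicator (frac_vec -` A) y" for y by (simp add: g_def indicator_def half_open_cell_def)
  show "emeasure (distr (density lborel \<kappa>) borel frac_vec) A
     = emeasure (distr (density cell_measure (periodize \<kappa>)) borel frac_vec) A"
    using * measurable_sets_borel[OF measurable_frac_vec A] unfolding ind
    by (simp add: emeasure_distr emeasure_density)
qed simp

lemma periodize_nonneg: "(\<And>x. 0 \<le> \<kappa> x) \<Longrightarrow> 0 \<le> periodize \<kappa> x"
  unfolding periodize_def by (rule sum_nonneg) simp

lemma integral_fold:
  fixes \<kappa> :: "real^'d \<Rightarrow> real" and f :: "real^'d \<Rightarrow> 'b::euclidean_space"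
  assumes \<kappa>[measurable]: "\<kappa> \<in> borel_measurable borel" and pos: "\<And>x. 0 \<le> \<kappa> x"
    and supp: "\<And>x. \<kappa> x \<noteq> 0 \<Longrightarrow> norm x \<le> R"
    and p[measurable]: "periodize \<kappa> \<in> borel_measurable borel"
    and f[measurable]: "f \<in> borel_measurable borel" and per: "lattice_periodic f"
  shows "(LINT y|lborel. \<kappa> y *\<^sub>R f y) = (LINT y|cell_measure. periodize \<kappa> y *\<^sub>R f y)"
proof -
  have "(LINT y|lborel. \<kappa> y *\<^sub>R f y) = (LINT y|density lborel \<kappa>. f (frac_vec y))"
    using pos by (subst integral_density) (auto simp: lattice_periodic_frac[OF per])
  also have "\<dots> = (LINT y|distr (density lborel \<kappa>) borel frac_vec. f y)"
    by (subst integral_distr) auto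
  also have "\<dots> = (LINT y|distr (density cell_measure (periodize \<kappa>)) borel frac_vec. f y)"
    by (simp add: distr_frac_vec_density[OF \<kappa> pos supp p])
  also have "\<dots> = (LINT y|density cell_measure (periodize \<kappa>). f (frac_vec y))"
    by (subst integral_distr) auto
  also have "\<dots> = (LINT y|cell_measure. periodize \<kappa> y *\<^sub>R f y)"
    by (subst integral_density) (auto simp: lattice_periodic_frac[OF per] intro: periodize_nonneg pos)
  finally show ?thesis .
qed

text \<open>Periodizing the indicator of a shifted half-open cell gives the constant 1, since each
  point has one translate in it. So a shifted cell and the original one fold to the same
  measure.\<close>

lemma distr_cell_shift:
  "distr cell_measure borel (\<lambda>y. frac_vec (y + a)) = distr (cell_measure :: (real^'d) measure) borel frac_vec"
proof -
  define \<kappa> :: "real^'d \<Rightarrow> real" where "\<kappa> x = indicator half_open_cell (x - a)" for x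
  have \<kappa>[measurable]: "\<kappa> \<in> borel_measurable borel" unfolding \<kappa>_def by measurable
  have "periodize \<kappa> x = 1" for x
  proof -
    have k: "\<kappa> (x + n) = (if n = - floor_vec (x - a) then 1 else 0)" if "n \<in> lattice" for n
    proof -
      have "floor_vec (x + n - a) = floor_vec ((x - a) + n)" by (simp add: algebra_simps)
      then have "floor_vec (x + n - a) = floor_vec (x - a) + n"
        unfolding floor_vec_add[OF that] .
      then show ?thesis by (auto simp: \<kappa>_def indicator_def half_open_cell_def eq_neg_iff_add_eq_0 add.commute)
    qed
    have "periodize \<kappa> x = (\<Sum>n\<in>{- floor_vec (x - a)}. \<kappa> (x + n))"
      using k by (intro periodize_eq_sum) (auto simp: lattice_uminus split: if_splits)
    then show ?thesis using k[of "- floor_vec (x - a)"] by (simp add: lattice_uminus)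
  qed
  then have p: "periodize \<kappa> = (\<lambda>x. 1)" by auto
  have supp: "norm x \<le> real CARD('d) + norm a" if "\<kappa> x \<noteq> 0" for x
  proof -
    have "floor_vec (x - a) = 0" using that by (auto simp: \<kappa>_def indicator_def half_open_cell_def split: if_splits)
    then show ?thesis using norm_floor_vec_eq_0[of "x - a"] norm_triangle_sub[of x a] by linarith
  qed
  have "distr cell_measure borel (\<lambda>y. frac_vec (y + a)) = distr (density lborel \<kappa>) borel frac_vec"
  proof (rule measure_eqI)
    fix A :: "(real^'d) set" assume "A \<in> sets (distr cell_measure borel (\<lambda>y. frac_vec (y + a)))"
    then have A [measurable]: "A \<in> sets borel" by simp
    have "emeasure (distr (density lborel \<kappa>) borel frac_vec) A
      = (\<integral>\<^sup>+ y. \<kappa> y * (indicator A (frac_vec y) :: ennreal) \<partial>lborel)"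
      by (simp add: nn_integral_indicator[symmetric] nn_integral_distr nn_integral_density
        ennreal_mult' ennreal_indicator del: nn_integral_indicator)
    also have "\<dots> = (\<integral>\<^sup>+ y. \<kappa> y * (indicator A (frac_vec y) :: ennreal) \<partial>distr lborel borel ((+) a))"
      by (simp add: lborel_distr_plus)
    also have "\<dots> = (\<integral>\<^sup>+ y. \<kappa> (a + y) * (indicator A (frac_vec (a + y)) :: ennreal) \<partial>lborel)"
      by (subst nn_integral_distr) auto
    also have "\<dots> = (\<integral>\<^sup>+ y. indicator half_open_cell y * (indicator A (frac_vec (y + a)) :: ennreal) \<partial>lborel)"
      by (intro nn_integral_cong) (auto simp: \<kappa>_def add.commute indicator_def half_open_cell_def)
    also have "\<dots> = emeasure (distr cell_measure borel (\<lambda>y. frac_vec (y + a))) A"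
      unfolding cell_measure_eq
      by (simp add: nn_integral_indicator[symmetric] nn_integral_distr nn_integral_density del: nn_integral_indicator)
    finally show "emeasure (distr cell_measure borel (\<lambda>y. frac_vec (y + a))) A
      = emeasure (distr (density lborel \<kappa>) borel frac_vec) A" by simp
  qed simp
  also have "\<dots> = distr (density cell_measure (periodize \<kappa>)) borel frac_vec"
    by (rule distr_frac_vec_density[OF \<kappa> _ supp]) (auto simp: \<kappa>_def p)
  finally show ?thesis by (simp add: p density_1)
qed

lemma cell_shift:
  fixes f :: "real^'d \<Rightarrow> 'b::euclidean_space"
  assumes [measurable]: "f \<in> borel_measurable borel" and per: "lattice_periodic f"
  shows integral_cell_shift: "(LINT y|cell_measure. f (y + a)) = (LINT y|cell_measure. f y)"
    and integrable_cell_shift: "integrable cell_measure (\<lambda>y. f (y + a)) \<longleftrightarrow> integrable cell_measure f"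
proof -
  have f: "f y = f (frac_vec y)" for y by (simp add: lattice_periodic_frac[OF per])
  have "(LINT y|cell_measure. f (y + a)) = (LINT y|distr cell_measure borel (\<lambda>y. frac_vec (y + a)). f y)"
    by (subst integral_distr) (auto simp: f[symmetric])
  also have "\<dots> = (LINT y|cell_measure. f (frac_vec y))"
    unfolding distr_cell_shift by (subst integral_distr) auto
  finally show "(LINT y|cell_measure. f (y + a)) = (LINT y|cell_measure. f y)" by (simp add: f[symmetric])
  have "integrable cell_measure (\<lambda>y. f (y + a)) \<longleftrightarrow> integrable (distr cell_measure borel (\<lambda>y. frac_vec (y + a))) f"
    by (subst integrable_distr_eq) (auto simp: f[symmetric])
  also have "\<dots> \<longleftrightarrow> integrable cell_measure (\<lambda>y. f (frac_vec y))"
    unfolding distr_cell_shift by (subst integrable_distr_eq) auto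
  finally show "integrable cell_measure (\<lambda>y. f (y + a)) \<longleftrightarrow> integrable cell_measure f" by (simp add: f[symmetric])
qed

section \<open>Convolution with smooth periodic kernels\<close>

text \<open>The bound on the derivative is uniform in the parameter, so by the mean value inequality
  it also dominates all difference quotients.\<close>

lemma has_real_derivative_integral:
  fixes f f' :: "real \<Rightarrow> 'a \<Rightarrow> real"
  assumes deriv: "\<And>s y. y \<in> space M \<Longrightarrow> ((\<lambda>s. f s y) has_real_derivative f' s y) (at s)"
    and bound: "\<And>s y. y \<in> space M \<Longrightarrow> \<bar>f' s y\<bar> \<le> g y" and g: "integrable M g"
    and int: "\<And>s. integrable M (f s)" and meas: "f' s0 \<in> borel_measurable M"
  shows "((\<lambda>s. LINT y|M. f s y) has_real_derivative (LINT y|M. f' s0 y)) (at s0)"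
  unfolding DERIV_def tendsto_at_iff_sequentially
proof (intro allI impI)
  fix X :: "nat \<Rightarrow> real" assume X: "\<forall>i. X i \<in> UNIV - {0}" "X \<longlonglongrightarrow> 0"
  have lip: "\<bar>f (s + h) y - f s y\<bar> \<le> g y * \<bar>h\<bar>" if "y \<in> space M" for s h y
    using field_differentiable_bound[of UNIV "\<lambda>s. f s y" "\<lambda>s. f' s y" "g y" "s + h" s]
      deriv bound that by auto
  have "(\<lambda>n. LINT y|M. (f (s0 + X n) y - f s0 y) / X n) \<longlonglongrightarrow> (LINT y|M. f' s0 y)"
  proof (rule integral_dominated_convergence[where w=g])
    show "(\<lambda>y. (f (s0 + X n) y - f s0 y) / X n) \<in> borel_measurable M" for n
      using int by (auto intro!: borel_measurable_divide borel_measurable_diff dest: borel_measurable_integrable)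
    show "AE y in M. (\<lambda>n. (f (s0 + X n) y - f s0 y) / X n) \<longlonglongrightarrow> f' s0 y"
    proof (rule AE_I2)
      fix y assume "y \<in> space M"
      from deriv[OF this, of s0] have "((\<lambda>h. (f (s0 + h) y - f s0 y) / h) \<longlongrightarrow> f' s0 y) (at 0)"
        by (simp add: DERIV_def)
      then show "(\<lambda>n. (f (s0 + X n) y - f s0 y) / X n) \<longlonglongrightarrow> f' s0 y"
        using X unfolding tendsto_at_iff_sequentially comp_def by blast
    qed
    show "AE y in M. norm ((f (s0 + X n) y - f s0 y) / X n) \<le> g y" for n
    proof (rule AE_I2)
      fix y assume "y \<in> space M"
      from lip[OF this, of s0 "X n"] show "norm ((f (s0 + X n) y - f s0 y) / X n) \<le> g y"
        using X(1) by (auto simp: abs_divide divide_le_eq)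
    qed
  qed (use g meas in auto)
  then show "((\<lambda>h. ((LINT y|M. f (s0 + h) y) - (LINT y|M. f s0 y)) / h) \<circ> X) \<longlonglongrightarrow> (LINT y|M. f' s0 y)"
    using int by (simp add: comp_def)
qed

lemma periodic_continuous_bounded:
  fixes f :: "real^'d \<Rightarrow> real"
  assumes "continuous_on UNIV f" "lattice_periodic f"
  obtains B where "0 \<le> B" "\<And>x. \<bar>f x\<bar> \<le> B"
proof -
  have "compact (unit_cell :: (real^'d) set)" by (simp add: unit_cell_def compact_cbox)
  then have "bounded (f ` unit_cell)"
    using assms(1) by (intro compact_imp_bounded compact_continuous_image) (auto intro: continuous_on_subset)
  then obtain B where "\<And>x. x \<in> unit_cell \<Longrightarrow> \<bar>f x\<bar> \<le> B"
    by (auto simp: bounded_iff)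
  then have "\<bar>f x\<bar> \<le> \<bar>B\<bar>" for x
    using floor_vec_in_unit_cell[OF floor_frac_vec, of x] lattice_periodic_frac[OF assms(2), of x]
    by (metis abs_ge_self order_trans)
  then show ?thesis by (intro that[of "\<bar>B\<bar>"]) auto
qed

definition smooth_periodic :: "(real^'d \<Rightarrow> real) \<Rightarrow> bool" where
  "smooth_periodic K \<longleftrightarrow> C_infinity K \<and> lattice_periodic K"

lemma smooth_periodic_C: "smooth_periodic K \<Longrightarrow> C_infinity K"
  and smooth_periodic_periodic: "smooth_periodic K \<Longrightarrow> lattice_periodic K"
  and smooth_periodic_continuous: "smooth_periodic K \<Longrightarrow> continuous_on S K"
  by (auto simp: smooth_periodic_def intro: C_infinity_continuous)

lemma smooth_periodic_measurable [measurable_dest]: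
  "smooth_periodic K \<Longrightarrow> K \<in> borel_measurable borel"
  by (simp add: smooth_periodic_def C_infinity_measurable)

lemma smooth_periodic_dd:
  assumes "smooth_periodic K"
  shows "smooth_periodic (dd v K)"
  unfolding smooth_periodic_def lattice_periodic_def
proof (intro conjI allI ballI)
  show "C_infinity (dd v K)" using assms by (simp add: smooth_periodic_def C_infinity_dd)
  fix x k :: "real^'a" assume "k \<in> lattice"
  then have eq: "(\<lambda>x. K (x + k)) = K" using assms by (simp add: smooth_periodic_def lattice_periodic_def)
  show "dd v K (x + k) = dd v K x"
    using dd_affine[OF smooth_periodic_C[OF assms] bounded_linear_ident, where v=v and x=x and b=k] unfolding eq by simp
qed

lemma smooth_periodic_bounded:
  assumes "smooth_periodic K"
  obtains B where "0 \<le> B" "\<And>x. \<bar>K x\<bar> \<le> B"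
  using periodic_continuous_bounded assms smooth_periodic_continuous smooth_periodic_periodic by blast

definition conv :: "(real^'d \<Rightarrow> real) \<Rightarrow> (real^'d \<Rightarrow> real) \<Rightarrow> real^'d \<Rightarrow> real" where
  "conv K c x = (LINT y|cell_measure. K (x - y) * c y)"

lemma integrable_bounded_mult:
  fixes c F :: "'a \<Rightarrow> real"
  assumes "integrable M c" "F \<in> borel_measurable M" "\<And>x. x \<in> space M \<Longrightarrow> \<bar>F x\<bar> \<le> B"
  shows "integrable M (\<lambda>x. F x * c x)"
proof (rule Bochner_Integration.integrable_bound[where f="\<lambda>x. B * c x"])
  show "AE x in M. norm (F x * c x) \<le> norm (B * c x)"
  proof (rule AE_I2)
    fix x assume "x \<in> space M"
    from assms(3)[OF this] have "\<bar>F x\<bar> * \<bar>c x\<bar> \<le> \<bar>B\<bar> * \<bar>c x\<bar>"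
      by (intro mult_right_mono) auto
    then show "norm (F x * c x) \<le> norm (B * c x)" by (simp add: abs_mult)
  qed
qed (use assms in auto)

lemma conv_integrable:
  assumes K: "smooth_periodic K" and c: "integrable cell_measure c"
  shows "integrable cell_measure (\<lambda>y. K (x - y) * c y)"
proof -
  obtain B where "0 \<le> B" "\<And>x. \<bar>K x\<bar> \<le> B" by (rule smooth_periodic_bounded[OF K]) (rule that)
  moreover have "(\<lambda>y. K (x - y)) \<in> borel_measurable cell_measure"
    using smooth_periodic_measurable[OF K] by measurable
  ultimately show ?thesis by (intro integrable_bounded_mult[OF c]) auto
qed

lemma conv_bound:
  assumes K: "smooth_periodic K" and c: "integrable cell_measure c" and B: "\<And>x. \<bar>K x\<bar> \<le> B"
  shows "\<bar>conv K c x\<bar> \<le> B * (LINT y|cell_measure. \<bar>c y\<bar>)"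
proof -
  have "\<bar>conv K c x\<bar> \<le> (LINT y|cell_measure. \<bar>K (x - y) * c y\<bar>)"
    unfolding conv_def by (rule integral_abs_bound)
  also have "\<dots> \<le> (LINT y|cell_measure. B * \<bar>c y\<bar>)"
    using conv_integrable[OF K c] c B by (intro integral_mono integrable_abs) (auto simp: abs_mult intro: mult_right_mono)
  finally show ?thesis by simp
qed

lemma conv_periodic:
  assumes "lattice_periodic K"
  shows "lattice_periodic (conv K c)"
  unfolding lattice_periodic_def conv_def
proof (intro allI ballI)
  fix x k :: "real^'a" assume "k \<in> lattice"
  then have "K (x + k - y) = K (x - y)" for y
    using lattice_periodicD[OF assms, of k "x - y"] by (simp add: algebra_simps)
  then show "(LINT y|cell_measure. K (x + k - y) * c y) = (LINT y|cell_measure. K (x - y) * c y)"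
    by simp
qed

lemma conv_continuous:
  assumes K: "smooth_periodic K" and c: "integrable cell_measure c"
  shows "continuous_on UNIV (conv K c)"
proof (rule continuous_at_imp_continuous_on, rule ballI, unfold continuous_at_sequentially, intro allI impI)
  fix x :: "real^'a" and X :: "nat \<Rightarrow> real^'a" assume X: "X \<longlonglongrightarrow> x"
  obtain B where B: "0 \<le> B" "\<And>x. \<bar>K x\<bar> \<le> B" by (rule smooth_periodic_bounded[OF K]) (rule that)
  have "(\<lambda>n. conv K c (X n)) \<longlonglongrightarrow> conv K c x"
    unfolding conv_def
  proof (rule integral_dominated_convergence[where w="\<lambda>y. B * \<bar>c y\<bar>"])
    show "AE y in cell_measure. (\<lambda>n. K (X n - y) * c y) \<longlonglongrightarrow> K (x - y) * c y"
    proof (rule AE_I2)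
      fix y
      have "(\<lambda>n. X n - y) \<longlonglongrightarrow> x - y" using X by (intro tendsto_intros)
      then have "(\<lambda>n. K (X n - y)) \<longlonglongrightarrow> K (x - y)"
        by (intro continuous_on_tendsto_compose[OF smooth_periodic_continuous[OF K, of UNIV]]) auto
      then show "(\<lambda>n. K (X n - y) * c y) \<longlonglongrightarrow> K (x - y) * c y" by (intro tendsto_intros)
    qed
  qed (use conv_integrable[OF K c, THEN borel_measurable_integrable] c B in
      \<open>auto simp: abs_mult intro!: AE_I2 mult_right_mono\<close>)
  then show "(conv K c \<circ> X) \<longlonglongrightarrow> conv K c x" by (simp add: comp_def)
qed

lemma conv_line_derivative:
  assumes K: "smooth_periodic K" and c: "integrable cell_measure c"
  shows "((\<lambda>s. conv K c (x + s *\<^sub>R v)) has_real_derivative conv (dd v K) c (x + s *\<^sub>R v)) (at s)"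
  unfolding conv_def
proof -
  obtain B where B: "0 \<le> B" "\<And>x. \<bar>dd v K x\<bar> \<le> B" by (rule smooth_periodic_bounded[OF smooth_periodic_dd[OF K]]) (rule that)
  show "((\<lambda>s. LINT y|cell_measure. K (x + s *\<^sub>R v - y) * c y) has_real_derivative
     (LINT y|cell_measure. dd v K (x + s *\<^sub>R v - y) * c y)) (at s)"
  proof (rule has_real_derivative_integral[where g="\<lambda>y. B * \<bar>c y\<bar>"])
    fix s y
    have "((\<lambda>s. K ((x - y) + s *\<^sub>R v)) has_real_derivative dd v K ((x - y) + s *\<^sub>R v)) (at s)"
      by (intro C_infinity_line_real smooth_periodic_C K)
    then show "((\<lambda>s. K (x + s *\<^sub>R v - y) * c y) has_real_derivative dd v K (x + s *\<^sub>R v - y) * c y) (at s)"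
      by (intro DERIV_cmult_right) (simp add: algebra_simps)
  qed (use conv_integrable[OF smooth_periodic_dd[OF K] c, THEN borel_measurable_integrable] conv_integrable[OF K c] c B in
      \<open>auto simp: abs_mult intro!: mult_right_mono\<close>)
qed

section \<open>Integration by parts for periodic functions\<close>

text \<open>The partial derivatives are a parameter and are taken along coordinate lines only. Each
  product or convolution thereby carries an explicit formula for its gradient, ready for integration
  by parts.\<close>

definition C1_periodic :: "(real^'d \<Rightarrow> real) \<Rightarrow> ('d \<Rightarrow> real^'d \<Rightarrow> real) \<Rightarrow> bool" where
  "C1_periodic f f' \<longleftrightarrow> lattice_periodic f \<and> continuous_on UNIV f \<and>
     (\<forall>i. lattice_periodic (f' i) \<and> continuous_on UNIV (f' i) \<and>
       (\<forall>x s. ((\<lambda>s. f (x + s *\<^sub>R axis i 1)) has_real_derivative f' i (x + s *\<^sub>R axis i 1)) (at s)))"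

lemma C1_periodicD:
  assumes "C1_periodic f f'"
  shows "lattice_periodic f" "continuous_on UNIV f" "lattice_periodic (f' i)" "continuous_on UNIV (f' i)"
    "((\<lambda>s. f (x + s *\<^sub>R axis i 1)) has_real_derivative f' i (x + s *\<^sub>R axis i 1)) (at s)"
  using assms unfolding C1_periodic_def by auto

lemma C1_periodic_smooth: "smooth_periodic K \<Longrightarrow> C1_periodic K (\<lambda>i. dd (axis i 1) K)"
  unfolding C1_periodic_def using smooth_periodic_dd[of K]
  by (auto intro: smooth_periodic_periodic smooth_periodic_continuous C_infinity_line_real smooth_periodic_C)

lemma C1_periodic_conv:
  "smooth_periodic K \<Longrightarrow> integrable cell_measure c \<Longrightarrow> C1_periodic (conv K c) (\<lambda>i. conv (dd (axis i 1) K) c)"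
  unfolding C1_periodic_def using smooth_periodic_dd[of K]
  by (auto intro: conv_periodic conv_continuous conv_line_derivative smooth_periodic_periodic)

lemma C1_periodicI:
  assumes "lattice_periodic f" "continuous_on UNIV f" "\<And>i. lattice_periodic (f' i)" "\<And>i. continuous_on UNIV (f' i)"
    "\<And>i x s. ((\<lambda>s. f (x + s *\<^sub>R axis i 1)) has_real_derivative f' i (x + s *\<^sub>R axis i 1)) (at s)"
  shows "C1_periodic f f'"
  using assms unfolding C1_periodic_def by auto

lemma C1_periodic_add:
  assumes f: "C1_periodic f f'" and g: "C1_periodic g g'"
  shows "C1_periodic (\<lambda>x. f x + g x) (\<lambda>i x. f' i x + g' i x)"
proof (rule C1_periodicI)
  note D = C1_periodicD[OF f] and E = C1_periodicD[OF g]
  show "((\<lambda>s. f (x + s *\<^sub>R axis i 1) + g (x + s *\<^sub>R axis i 1)) has_real_derivative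
      f' i (x + s *\<^sub>R axis i 1) + g' i (x + s *\<^sub>R axis i 1)) (at s)" for i x s
    by (rule DERIV_add[OF D(5) E(5)])
qed (use C1_periodicD[OF f] C1_periodicD[OF g] in \<open>auto simp: lattice_periodic_def intro!: continuous_intros\<close>)

lemma C1_periodic_diff:
  assumes f: "C1_periodic f f'" and g: "C1_periodic g g'"
  shows "C1_periodic (\<lambda>x. f x - g x) (\<lambda>i x. f' i x - g' i x)"
proof (rule C1_periodicI)
  note D = C1_periodicD[OF f] and E = C1_periodicD[OF g]
  show "((\<lambda>s. f (x + s *\<^sub>R axis i 1) - g (x + s *\<^sub>R axis i 1)) has_real_derivative
      f' i (x + s *\<^sub>R axis i 1) - g' i (x + s *\<^sub>R axis i 1)) (at s)" for i x s
    by (rule DERIV_diff[OF D(5) E(5)])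
qed (use C1_periodicD[OF f] C1_periodicD[OF g] in \<open>auto simp: lattice_periodic_def intro!: continuous_intros\<close>)

lemma C1_periodic_mult:
  assumes f: "C1_periodic f f'" and g: "C1_periodic g g'"
  shows "C1_periodic (\<lambda>x. f x * g x) (\<lambda>i x. f' i x * g x + g' i x * f x)"
proof (rule C1_periodicI)
  note D = C1_periodicD[OF f] and E = C1_periodicD[OF g]
  show "((\<lambda>s. f (x + s *\<^sub>R axis i 1) * g (x + s *\<^sub>R axis i 1)) has_real_derivative
      f' i (x + s *\<^sub>R axis i 1) * g (x + s *\<^sub>R axis i 1) + g' i (x + s *\<^sub>R axis i 1) * f (x + s *\<^sub>R axis i 1)) (at s)" for i x s
    by (rule DERIV_mult[OF D(5) E(5)])
qed (use C1_periodicD[OF f] C1_periodicD[OF g] in \<open>auto simp: lattice_periodic_def intro!: continuous_intros\<close>)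

lemma C1_periodic_const: "C1_periodic (\<lambda>x. c) (\<lambda>i x. 0)"
  unfolding C1_periodic_def by (auto simp: lattice_periodic_def)

lemma C1_periodic_sum:
  "finite I \<Longrightarrow> (\<And>j. j \<in> I \<Longrightarrow> C1_periodic (f j) (f' j)) \<Longrightarrow>
    C1_periodic (\<lambda>x. \<Sum>j\<in>I. f j x) (\<lambda>i x. \<Sum>j\<in>I. f' j i x)"
  by (induction I rule: finite_induct) (auto intro: C1_periodic_const C1_periodic_add)

lemma cell_integrable_periodic:
  assumes "continuous_on UNIV f" "lattice_periodic (f :: real^'d \<Rightarrow> real)"
  shows "integrable cell_measure f"
proof -
  obtain B where "0 \<le> B" "\<And>x. \<bar>f x\<bar> \<le> B" by (rule periodic_continuous_bounded[OF assms]) (rule that)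
  then show ?thesis using borel_measurable_continuous_onI[OF assms(1)]
    by (intro cell.integrable_const_bound[where B=B]) (auto simp: measurable_cong_sets[OF sets_cell_measure refl])
qed

text \<open>By translation invariance the integral of the shifted function does not depend on the
  shift; its derivative in the shift is the integral on the left.\<close>

lemma integral_partial_derivative_0:
  assumes "C1_periodic f f'"
  shows "(LINT x|cell_measure. f' i x) = 0"
proof -
  note D = C1_periodicD[OF assms]
  obtain B where B: "0 \<le> B" "\<And>x. \<bar>f' i x\<bar> \<le> B" by (rule periodic_continuous_bounded[OF D(4) D(3)]) (rule that)
  have m: "f \<in> borel_measurable borel" using D by (intro borel_measurable_continuous_onI)
  have m': "f' i \<in> borel_measurable borel" using D by (intro borel_measurable_continuous_onI)
  have "((\<lambda>s. LINT x|cell_measure. f (x + s *\<^sub>R axis i 1)) has_real_derivative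
     (LINT x|cell_measure. f' i (x + 0 *\<^sub>R axis i 1))) (at 0)"
  proof (rule has_real_derivative_integral[where g="\<lambda>_. B"])
    show "integrable cell_measure (\<lambda>x. f (x + s *\<^sub>R axis i 1))" for s
      using integrable_cell_shift[OF m D(1)] cell_integrable_periodic[OF D(2,1)] by blast
  qed (use D(5) B m' in auto)
  moreover have "((\<lambda>s. LINT x|cell_measure. f (x + s *\<^sub>R axis i 1)) has_real_derivative 0) (at 0)"
    unfolding integral_cell_shift[OF m D(1)] by simp
  ultimately show ?thesis using DERIV_unique by auto
qed

lemma integral_by_parts:
  assumes f: "C1_periodic f f'" and g: "C1_periodic g g'"
  shows "(LINT x|cell_measure. f' i x * g x) = - (LINT x|cell_measure. f x * g' i x)"
proof -
  note D = C1_periodicD[OF f] note E = C1_periodicD[OF g]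
  have "integrable cell_measure (\<lambda>x. f' i x * g x)" "integrable cell_measure (\<lambda>x. g' i x * f x)"
    using D E by (auto intro!: cell_integrable_periodic continuous_on_mult simp: lattice_periodic_def)
  then show ?thesis using integral_partial_derivative_0[OF C1_periodic_mult[OF f g], of i]
    by (simp add: mult.commute)
qed

lemma integrable_pair_snd:
  fixes c :: "'b \<Rightarrow> real"
  assumes "finite_measure M1" "sigma_finite_measure M2" "integrable M2 c"
  shows "integrable (M1 \<Otimes>\<^sub>M M2) (\<lambda>(x, y). c y)"
proof -
  interpret M1: finite_measure M1 by fact
  interpret M2: sigma_finite_measure M2 by fact
  interpret pair_sigma_finite M1 M2 ..
  have [measurable]: "c \<in> borel_measurable M2" using assms by auto
  show ?thesis by (rule Fubini_integrable) (use assms in auto)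
qed

text \<open>Fubini moves the kernel from the merely integrable factor \<open>c\<close> to the
  continuous factor \<open>F\<close>. All later removals of a mollifier rest on this.\<close>

lemma integral_conv_mult:
  assumes K: "smooth_periodic K" and c: "integrable cell_measure c"
    and F: "continuous_on UNIV F" "lattice_periodic F"
  shows "(LINT x|cell_measure. conv K c x * F x)
       = (LINT y|cell_measure. c y * (LINT x|cell_measure. K (x - y) * F x))"
proof -
  obtain B where B: "0 \<le> B" "\<And>x. \<bar>K x\<bar> \<le> B" by (rule smooth_periodic_bounded[OF K]) (rule that)
  obtain C where C: "0 \<le> C" "\<And>x. \<bar>F x\<bar> \<le> C" by (rule periodic_continuous_bounded[OF F]) (rule that)
  have [measurable]: "K \<in> borel_measurable borel" "F \<in> borel_measurable borel" "c \<in> borel_measurable cell_measure"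
    using K F c by (auto intro: borel_measurable_continuous_onI smooth_periodic_measurable)
  then have [measurable]: "c \<in> borel_measurable borel" by (simp cong: measurable_cong_sets)
  interpret pair_sigma_finite "cell_measure :: (real^'a) measure" "cell_measure :: (real^'a) measure" ..
  have "integrable (cell_measure \<Otimes>\<^sub>M cell_measure) (\<lambda>(x, y). (K (x - y) * F x) * (c y))"
  proof (rule Bochner_Integration.integrable_bound)
    show "integrable (cell_measure \<Otimes>\<^sub>M cell_measure) (\<lambda>(x :: real^'a, y). (B * C) * c y)"
      by (intro integrable_pair_snd integrable_mult_right c cell.finite_measure_axioms cell.sigma_finite_measure_axioms)
    show "AE z in cell_measure \<Otimes>\<^sub>M cell_measure. norm (case z of (x, y) \<Rightarrow> K (x - y) * F x * c y) \<le> norm (case z of (x, y) \<Rightarrow> B * C * c y)"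
      using B C by (intro AE_I2) (auto simp: abs_mult intro!: mult_right_mono mult_mono)
  qed measurable
  from Fubini_integral[OF this]
  have "(LINT y|cell_measure. LINT x|cell_measure. K (x - y) * F x * c y)
    = (LINT x|cell_measure. LINT y|cell_measure. K (x - y) * F x * c y)" .
  moreover have "(LINT y|cell_measure. K (x - y) * F x * c y) = conv K c x * F x" for x
    unfolding conv_def by (subst integral_mult_left_zero[symmetric]) (simp add: ac_simps)
  ultimately show ?thesis by (simp add: mult.commute)
qed

section \<open>Mollification on the torus\<close>

definition scaled :: "(real^'d \<Rightarrow> real) \<Rightarrow> real \<Rightarrow> real^'d \<Rightarrow> real" where
  "scaled \<rho> l y = \<rho> ((1 / l) *\<^sub>R y) / l ^ CARD('d)"

definition torus_kernel :: "(real^'d \<Rightarrow> real) \<Rightarrow> real \<Rightarrow> real^'d \<Rightarrow> real" where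
  "torus_kernel \<rho> l = periodize (scaled \<rho> l)"

lemma C_infinity_periodize:
  fixes \<kappa> :: "real^'d \<Rightarrow> real"
  assumes \<kappa>: "C_infinity \<kappa>" and supp: "\<And>x. \<kappa> x \<noteq> 0 \<Longrightarrow> norm x \<le> R"
  shows "C_infinity (periodize \<kappa>)"
proof (rule C_infinity_local)
  fix x :: "real^'d"
  \<comment> \<open>One index set for all points of the unit ball around \<open>x\<close>; the
    summand 1 is the radius of that ball.\<close>
  define S where "S = {n \<in> lattice :: (real^'d) set. norm n \<le> R + norm x + 1}"
  have S: "finite S" "S \<subseteq> lattice" by (auto simp: S_def finite_lattice_ball)
  have "periodize \<kappa> y = (\<Sum>n\<in>S. \<kappa> (y + n))" if "y \<in> ball x 1" for y
  proof (rule periodize_eq_sum[OF S])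
    fix n :: "real^'d" assume n: "n \<in> lattice" "\<kappa> (y + n) \<noteq> 0"
    have "norm (y + n) \<le> R" using n supp by blast
    moreover have "norm n \<le> norm (y + n) + norm y" by (metis add_diff_cancel_left' norm_triangle_ineq4)
    moreover have "norm y \<le> norm x + 1"
      using that norm_triangle_sub[of y x] by (simp add: dist_norm norm_minus_commute)
    ultimately show "n \<in> S" using n by (simp add: S_def)
  qed
  moreover have "C_infinity (\<lambda>y. \<Sum>n\<in>S. \<kappa> (y + n))"
    using C_infinity_affine[OF \<kappa> bounded_linear_ident] by (intro C_infinity_sum)
  ultimately show "\<exists>U g. open U \<and> x \<in> U \<and> C_infinity g \<and> (\<forall>y\<in>U. periodize \<kappa> y = g y)"
    by (intro exI[of _ "ball x 1"] exI[of _ "\<lambda>y. \<Sum>n\<in>S. \<kappa> (y + n)"]) auto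
qed

lemma lborel_integral_affine:
  fixes f :: "real^'d \<Rightarrow> 'b::euclidean_space"
  assumes [measurable]: "f \<in> borel_measurable borel" and "c \<noteq> 0"
  shows "(LINT x|lborel. f x) = \<bar>c\<bar> ^ CARD('d) *\<^sub>R (LINT x|lborel. f (t + c *\<^sub>R x))"
proof -
  have "(LINT x|lborel. f x) = (LINT x|density (distr lborel borel (\<lambda>x. t + c *\<^sub>R x)) (\<lambda>_. \<bar>c\<bar> ^ CARD('d)). f x)"
    by (subst lborel_affine[OF assms(2), of t]) (simp add: ennreal_power)
  also have "\<dots> = (LINT x|distr lborel borel (\<lambda>x. t + c *\<^sub>R x). \<bar>c\<bar> ^ CARD('d) *\<^sub>R f x)"
    by (rule integral_density) auto
  also have "\<dots> = (LINT x|lborel. \<bar>c\<bar> ^ CARD('d) *\<^sub>R f (t + c *\<^sub>R x))"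
    by (rule integral_distr) auto
  finally show ?thesis by simp
qed

lemma lborel_integral_reflect:
  fixes f :: "real^'d \<Rightarrow> 'b::euclidean_space"
  assumes [measurable]: "f \<in> borel_measurable borel"
  shows "(LINT y|lborel. f (x - y)) = (LINT y|lborel. f y)"
  using lborel_integral_affine[OF assms, of "-1" x] by simp

context
  fixes \<rho> :: "real^'d \<Rightarrow> real"
  assumes \<rho>: "friedrichs_mollifier \<rho>"
begin

lemma mollifier_C: "C_infinity \<rho>" and mollifier_nonneg: "0 \<le> \<rho> x" and mollifier_even: "\<rho> (- x) = \<rho> x"
  using \<rho> by (auto simp: friedrichs_mollifier_def)

lemma mollifier_measurable [measurable]: "\<rho> \<in> borel_measurable borel"
  by (rule C_infinity_measurable[OF mollifier_C])

lemma mollifier_integral: "(LINT x|lborel. \<rho> x) = 1"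
  using \<rho> by (simp add: friedrichs_mollifier_def integral_completion)

lemma mollifier_support:
  obtains R where "0 < R" "\<And>x. \<rho> x \<noteq> 0 \<Longrightarrow> norm x \<le> R"
proof -
  have "bounded {x. \<rho> x \<noteq> 0}"
    using \<rho> bounded_subset[OF compact_imp_bounded closure_subset]
    by (auto simp: friedrichs_mollifier_def)
  then obtain R where "0 < R" "\<forall>x\<in>{x. \<rho> x \<noteq> 0}. norm x \<le> R" by (auto simp: bounded_pos)
  then show ?thesis by (intro that) auto
qed

lemma scaled_C: "C_infinity (scaled \<rho> l)"
proof -
  have "bounded_linear (\<lambda>y :: real^'d. (1 / l) *\<^sub>R y)" by (rule bounded_linear_scaleR_right)
  from C_infinity_affine[OF mollifier_C this, of 0] have "C_infinity (\<lambda>y. \<rho> ((1 / l) *\<^sub>R y))" by simp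
  from C_infinity_linear_comp[OF bounded_linear_divide this, of "l ^ CARD('d)"]
  show ?thesis by (simp add: scaled_def[abs_def])
qed

lemma scaled_measurable [measurable]: "scaled \<rho> l \<in> borel_measurable borel"
  by (rule C_infinity_measurable[OF scaled_C])

lemma scaled_nonneg: "0 < l \<Longrightarrow> 0 \<le> scaled \<rho> l x"
  by (simp add: scaled_def mollifier_nonneg)

lemma scaled_support:
  assumes "0 < l"
  obtains R where "\<And>x. scaled \<rho> l x \<noteq> 0 \<Longrightarrow> norm x \<le> R"
proof -
  obtain R where R: "\<And>x. \<rho> x \<noteq> 0 \<Longrightarrow> norm x \<le> R" using mollifier_support by metis
  have "norm x \<le> l * R" if "scaled \<rho> l x \<noteq> 0" for x
    using R[of "(1 / l) *\<^sub>R x"] that assms by (auto simp: scaled_def field_simps)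
  then show ?thesis by (rule that)
qed

lemma scaled_even: "scaled \<rho> l (- x) = scaled \<rho> l x"
  using mollifier_even by (simp add: scaled_def)

lemma torus_kernel_smooth: "0 < l \<Longrightarrow> smooth_periodic (torus_kernel \<rho> l)"
  unfolding smooth_periodic_def torus_kernel_def
  by (metis scaled_support C_infinity_periodize scaled_C periodic_periodize)

lemma torus_kernel_nonneg: "0 < l \<Longrightarrow> 0 \<le> torus_kernel \<rho> l x"
  unfolding torus_kernel_def by (intro periodize_nonneg scaled_nonneg)

lemma torus_kernel_even: "torus_kernel \<rho> l (- x) = torus_kernel \<rho> l x"
  using periodize_reflect[of "scaled \<rho> l" 0 x] scaled_even
  by (simp add: torus_kernel_def)

lemma torus_kernel_even': "torus_kernel \<rho> l (x - y) = torus_kernel \<rho> l (y - x)"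
  using torus_kernel_even[of l "x - y"] by simp

text \<open>Reflect \<open>y\<close> to \<open>x - y\<close>, so that the periodic factor stands at
  \<open>y\<close>, then fold the kernel. This works for all \<open>l > 0\<close>, even when the
  support of the scaled kernel is larger than the cell.\<close>

lemma mollification_eq_torus_integral:
  fixes f :: "real^'d \<Rightarrow> 'b::euclidean_space"
  assumes l: "0 < l" and f [measurable]: "f \<in> borel_measurable borel" and per: "lattice_periodic f"
  shows "(LINT y|lborel. scaled \<rho> l y *\<^sub>R f (x - y)) = (LINT y|cell_measure. torus_kernel \<rho> l (x - y) *\<^sub>R f y)"
proof -
  have "(LINT y|lborel. scaled \<rho> l y *\<^sub>R f (x - y)) = (LINT y|lborel. (\<lambda>y. scaled \<rho> l (x - y) *\<^sub>R f y) (x - y))"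
    by simp
  also have "\<dots> = (LINT y|lborel. scaled \<rho> l (x - y) *\<^sub>R f y)"
    by (rule lborel_integral_reflect) measurable
  also have "\<dots> = (LINT y|cell_measure. periodize (\<lambda>y. scaled \<rho> l (x - y)) y *\<^sub>R f y)"
  proof -
    obtain R where R: "\<And>x. scaled \<rho> l x \<noteq> 0 \<Longrightarrow> norm x \<le> R" using scaled_support[OF l] by metis
    have "norm y \<le> norm x + R" if "scaled \<rho> l (x - y) \<noteq> 0" for y
      using R[OF that] norm_triangle_sub[of y x] by (simp add: norm_minus_commute)
    moreover have "periodize (\<lambda>y. scaled \<rho> l (x - y)) = (\<lambda>y. torus_kernel \<rho> l (x - y))"
      by (rule ext) (simp add: periodize_reflect torus_kernel_def)
    moreover have "(\<lambda>y. torus_kernel \<rho> l (x - y)) \<in> borel_measurable borel"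
      using smooth_periodic_measurable[OF torus_kernel_smooth[OF l]] by measurable
    ultimately show ?thesis
      by (intro integral_fold[where R="norm x + R"] f per)
        (auto intro: scaled_nonneg l)
  qed
  finally show ?thesis by (simp add: periodize_reflect torus_kernel_def)
qed

lemma torus_kernel_integral: "0 < l \<Longrightarrow> (LINT x|cell_measure. torus_kernel \<rho> l (x - y)) = 1"
proof -
  assume l: "0 < l"
  have "(LINT x|cell_measure. torus_kernel \<rho> l (x - y)) = (LINT x|cell_measure. torus_kernel \<rho> l (y - x) *\<^sub>R (1 :: real))"
    by (simp add: torus_kernel_even'[of l _ y])
  also have "\<dots> = (LINT x|lborel. scaled \<rho> l x *\<^sub>R (1 :: real))"
    by (rule mollification_eq_torus_integral[OF l, symmetric]) (auto simp: lattice_periodic_def)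
  also have "\<dots> = l ^ CARD('d) * (LINT x|lborel. scaled \<rho> l (l *\<^sub>R x))"
    using lborel_integral_affine[of "scaled \<rho> l" l 0] l by simp
  also have "\<dots> = 1" using l by (simp add: scaled_def mollifier_integral)
  finally show ?thesis .
qed

lemma torus_kernel_convergence:
  fixes F :: "real^'d \<Rightarrow> real"
  assumes F: "continuous_on UNIV F" "lattice_periodic F"
  shows "(\<lambda>n. LINT x|cell_measure. torus_kernel \<rho> (1 / real (Suc n)) (x - y) * F x) \<longlonglongrightarrow> F y"
proof -
  have Fm [measurable]: "F \<in> borel_measurable borel" using F(1) by (rule borel_measurable_continuous_onI)
  \<comment> \<open>Unfold the kernel to the whole space and rescale by \<open>l\<close>: the scale
    moves from the kernel into the argument of the continuous function.\<close>
  have eq: "(LINT x|cell_measure. torus_kernel \<rho> l (x - y) * F x) = (LINT x|lborel. \<rho> x * F (y - l *\<^sub>R x))"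
    if l: "0 < l" for l
  proof -
    have "(LINT x|cell_measure. torus_kernel \<rho> l (x - y) * F x)
        = (LINT x|cell_measure. torus_kernel \<rho> l (y - x) *\<^sub>R F x)"
      by (simp add: torus_kernel_even'[of l _ y])
    also have "\<dots> = (LINT x|lborel. scaled \<rho> l x *\<^sub>R F (y - x))"
      by (rule mollification_eq_torus_integral[OF l Fm F(2), symmetric])
    also have "\<dots> = l ^ CARD('d) * (LINT x|lborel. scaled \<rho> l (l *\<^sub>R x) * F (y - l *\<^sub>R x))"
      using lborel_integral_affine[of "\<lambda>x. scaled \<rho> l x *\<^sub>R F (y - x)" l 0] l by simp
    also have "\<dots> = (LINT x|lborel. l ^ CARD('d) * (scaled \<rho> l (l *\<^sub>R x) * F (y - l *\<^sub>R x)))"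
      by simp
    also have "\<dots> = (LINT x|lborel. \<rho> x * F (y - l *\<^sub>R x))"
      using l by (intro Bochner_Integration.integral_cong) (auto simp: scaled_def)
    finally show ?thesis .
  qed
  obtain B where B: "0 \<le> B" "\<And>x. \<bar>F x\<bar> \<le> B" by (rule periodic_continuous_bounded[OF F]) (rule that)
  have "(\<lambda>n. LINT x|lborel. \<rho> x * F (y - (1 / real (Suc n)) *\<^sub>R x)) \<longlonglongrightarrow> (LINT x|lborel. \<rho> x * F y)"
  proof (rule integral_dominated_convergence[where w="\<lambda>x. \<rho> x * B"])
    \<comment> \<open>A non-integrable function has integral 0 by convention, so the value 1 already
      implies integrability.\<close>
    have "integrable lborel \<rho>"
      using mollifier_integral not_integrable_integral_eq by fastforce
    then show "integrable lborel (\<lambda>x. \<rho> x * B)" by simp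
    show "AE x in lborel. (\<lambda>n. \<rho> x * F (y - (1 / real (Suc n)) *\<^sub>R x)) \<longlonglongrightarrow> \<rho> x * F y"
    proof (rule AE_I2)
      fix x
      have "(\<lambda>n. y - (1 / real (Suc n)) *\<^sub>R x) \<longlonglongrightarrow> y - 0 *\<^sub>R x"
        by (intro tendsto_intros LIMSEQ_Suc[OF lim_1_over_n])
      then have "(\<lambda>n. F (y - (1 / real (Suc n)) *\<^sub>R x)) \<longlonglongrightarrow> F (y - 0 *\<^sub>R x)"
        by (intro continuous_on_tendsto_compose[OF F(1)]) auto
      then show "(\<lambda>n. \<rho> x * F (y - (1 / real (Suc n)) *\<^sub>R x)) \<longlonglongrightarrow> \<rho> x * F y"
        by (intro tendsto_intros) simp
    qed
  qed (use B mollifier_nonneg in \<open>auto simp: abs_mult intro!: mult_left_mono\<close>)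
  then show ?thesis by (simp add: eq mollifier_integral)
qed

text \<open>The kernel is a probability density, so averaging against it preserves a bound,
  uniformly in \<open>l\<close>.\<close>

lemma torus_kernel_integral_bound:
  fixes F :: "real^'d \<Rightarrow> real"
  assumes l: "0 < l" and F: "continuous_on UNIV F" "lattice_periodic F" and B: "\<And>x. \<bar>F x\<bar> \<le> B"
  shows "\<bar>LINT x|cell_measure. torus_kernel \<rho> l (x - y) * F x\<bar> \<le> B"
proof -
  note K = torus_kernel_smooth[OF l]
  have cK: "continuous_on UNIV (\<lambda>x. torus_kernel \<rho> l (x - y))"
    by (rule continuous_on_compose2[OF smooth_periodic_continuous[OF K, of UNIV]]) (auto intro!: continuous_intros)
  have pK: "lattice_periodic (\<lambda>x. torus_kernel \<rho> l (x - y))"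
    unfolding lattice_periodic_def
  proof (intro allI ballI)
    fix x k :: "real^'d" assume "k \<in> lattice"
    then show "torus_kernel \<rho> l (x + k - y) = torus_kernel \<rho> l (x - y)"
      using lattice_periodicD[OF smooth_periodic_periodic[OF K], of k "x - y"] by (simp add: algebra_simps)
  qed
  have i1: "integrable cell_measure (\<lambda>x. torus_kernel \<rho> l (x - y) * F x)"
    using F cK pK by (intro cell_integrable_periodic continuous_on_mult) (auto simp: lattice_periodic_def)
  have i2: "integrable cell_measure (\<lambda>x. torus_kernel \<rho> l (x - y))"
    using cK pK by (rule cell_integrable_periodic)
  have "\<bar>LINT x|cell_measure. torus_kernel \<rho> l (x - y) * F x\<bar> \<le> (LINT x|cell_measure. \<bar>torus_kernel \<rho> l (x - y) * F x\<bar>)"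
    by (rule integral_abs_bound)
  also have "\<dots> \<le> (LINT x|cell_measure. torus_kernel \<rho> l (x - y) * B)"
    using i1 i2 torus_kernel_nonneg[OF l] B
    by (intro integral_mono integrable_abs integrable_mult_left) (auto simp: abs_mult intro!: mult_left_mono)
  also have "\<dots> = B" using torus_kernel_integral[OF l] by simp
  finally show ?thesis .
qed

text \<open>With the kernel moved to \<open>F\<close>, the averages converge pointwise and
  boundedly, so dominated convergence applies with the majorant \<open>\<bar>c y\<bar> * B\<close>.
  Convergence of the mollified \<open>c\<close> itself never enters.\<close>

lemma conv_approximation:
  assumes c: "integrable cell_measure c" and F: "continuous_on UNIV F" "lattice_periodic F"
  shows "(\<lambda>n. LINT x|cell_measure. conv (torus_kernel \<rho> (1 / real (Suc n))) c x * F x)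
     \<longlonglongrightarrow> (LINT x|cell_measure. c x * F x)"
proof -
  obtain B where B: "0 \<le> B" "\<And>x. \<bar>F x\<bar> \<le> B" by (rule periodic_continuous_bounded[OF F]) (rule that)
  have [measurable]: "F \<in> borel_measurable borel" using F(1) by (rule borel_measurable_continuous_onI)
  have [measurable]: "torus_kernel \<rho> (1 / real (Suc n)) \<in> borel_measurable borel" for n
    by (intro smooth_periodic_measurable torus_kernel_smooth) simp
  have [measurable]: "c \<in> borel_measurable borel" using c by (simp cong: measurable_cong_sets)
  have "(\<lambda>n. LINT y|cell_measure. c y * (LINT x|cell_measure. torus_kernel \<rho> (1 / real (Suc n)) (x - y) * F x))
     \<longlonglongrightarrow> (LINT y|cell_measure. c y * F y)"
  proof (rule integral_dominated_convergence[where w="\<lambda>y. \<bar>c y\<bar> * B"])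
    show "AE y in cell_measure. (\<lambda>n. c y * (LINT x|cell_measure. torus_kernel \<rho> (1 / real (Suc n)) (x - y) * F x))
       \<longlonglongrightarrow> c y * F y"
      by (intro AE_I2 tendsto_mult tendsto_const torus_kernel_convergence F)
    show "AE y in cell_measure. norm (c y * (LINT x|cell_measure. torus_kernel \<rho> (1 / real (Suc n)) (x - y) * F x)) \<le> \<bar>c y\<bar> * B" for n
    proof (rule AE_I2)
      fix y
      show "norm (c y * (LINT x|cell_measure. torus_kernel \<rho> (1 / real (Suc n)) (x - y) * F x)) \<le> \<bar>c y\<bar> * B"
        unfolding real_norm_def abs_mult
        by (rule mult_left_mono[OF torus_kernel_integral_bound[OF _ F B(2)]]) auto
    qed
    show "(\<lambda>y. c y * (LINT x|cell_measure. torus_kernel \<rho> (1 / real (Suc n)) (x - y) * F x)) \<in> borel_measurable cell_measure" for n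
      by measurable
  qed (use c in auto)
  then show ?thesis
    by (simp add: integral_conv_mult[OF torus_kernel_smooth c F])
qed

text \<open>The same transfer gives a bound independent of the scale \<open>l\<close>; it becomes
  the majorant when the limit is taken under the time integral.\<close>

lemma conv_pairing_bound:
  assumes l: "0 < l" and c: "integrable cell_measure c" and F: "continuous_on UNIV F" "lattice_periodic F"
    and B: "\<And>x. \<bar>F x\<bar> \<le> B"
  shows "\<bar>LINT x|cell_measure. conv (torus_kernel \<rho> l) c x * F x\<bar> \<le> B * (LINT x|cell_measure. \<bar>c x\<bar>)"
proof -
  note K = torus_kernel_smooth[OF l]
  have [measurable]: "F \<in> borel_measurable borel" using F(1) by (rule borel_measurable_continuous_onI)
  have [measurable]: "torus_kernel \<rho> l \<in> borel_measurable borel" by (rule smooth_periodic_measurable[OF K])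
  have "\<bar>LINT x|cell_measure. conv (torus_kernel \<rho> l) c x * F x\<bar>
     \<le> (LINT y|cell_measure. \<bar>c y * (LINT x|cell_measure. torus_kernel \<rho> l (x - y) * F x)\<bar>)"
    unfolding integral_conv_mult[OF K c F] by (rule integral_abs_bound)
  also have "\<dots> \<le> (LINT y|cell_measure. \<bar>c y\<bar> * B)"
  proof (rule integral_mono)
    show "integrable cell_measure (\<lambda>y. \<bar>c y * (LINT x|cell_measure. torus_kernel \<rho> l (x - y) * F x)\<bar>)"
      using integrable_bounded_mult[OF c, of "\<lambda>y. LINT x|cell_measure. torus_kernel \<rho> l (x - y) * F x" B]
        torus_kernel_integral_bound[OF l F B]
      by (simp add: mult.commute)
    show "\<bar>c y * (LINT x|cell_measure. torus_kernel \<rho> l (x - y) * F x)\<bar> \<le> \<bar>c y\<bar> * B" for y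
      unfolding abs_mult by (rule mult_left_mono[OF torus_kernel_integral_bound[OF l F B]]) auto
  qed (use c in auto)
  finally show ?thesis by (simp add: mult.commute)
qed

end

declare mollifier_measurable [measurable del]

section \<open>Weak derivatives in time\<close>

definition time_measure :: "real \<Rightarrow> real measure" where
  "time_measure T = density lborel (indicator {0<..<T})"

definition time_test :: "real \<Rightarrow> (real \<Rightarrow> real) \<Rightarrow> bool" where
  "time_test T \<eta> \<longleftrightarrow> C_infinity \<eta> \<and> (\<exists>a b. 0 < a \<and> b < T \<and> (\<forall>t. t \<notin> {a..b} \<longrightarrow> \<eta> t = 0))"

lemma sets_time_measure [measurable_cong]: "sets (time_measure T) = sets borel"
  by (simp add: time_measure_def)

lemma space_time_measure [simp]: "space (time_measure T) = UNIV"
  by (simp add: time_measure_def)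

interpretation time: finite_measure "time_measure T" for T
proof
  have "emeasure (time_measure T) (space (time_measure T)) = emeasure lborel {0<..<T}"
    by (simp add: time_measure_def emeasure_density)
  also have "\<dots> < \<infinity>" by (rule emeasure_lborel_box_finite[of 0 T, unfolded box_real])
  finally show "emeasure (time_measure T) (space (time_measure T)) \<noteq> \<infinity>" by simp
qed

lemma time_measurable_iff: "f \<in> borel_measurable (time_measure T) \<longleftrightarrow> f \<in> borel_measurable borel"
  using measurable_cong_sets[OF sets_time_measure refl, of T borel] by blast

lemma time_measure_eq: "time_measure T = density lborel (\<lambda>t. ennreal (indicator {0<..<T} t))"
  by (simp add: time_measure_def ennreal_indicator)

lemma integral_time_measure:
  fixes f :: "real \<Rightarrow> real"
  assumes [measurable]: "f \<in> borel_measurable borel"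
  shows "(LINT t|time_measure T. f t) = (LINT t|lborel. indicator {0<..<T} t * f t)"
  unfolding time_measure_eq by (subst integral_density) auto

lemma integrable_time_measure:
  fixes f :: "real \<Rightarrow> real"
  assumes [measurable]: "f \<in> borel_measurable borel"
  shows "integrable (time_measure T) f \<longleftrightarrow> integrable lborel (\<lambda>t. indicator {0<..<T} t * f t)"
  unfolding time_measure_eq by (subst integrable_density) auto

lemma AE_time_measure: "(AE t in time_measure T. P t) \<longleftrightarrow> (AE t in lborel. t \<in> {0<..<T} \<longrightarrow> P t)"
  unfolding time_measure_def by (subst AE_density) (auto simp: indicator_def)

lemma time_test_C: "time_test T \<eta> \<Longrightarrow> C_infinity \<eta>"
  by (simp add: time_test_def)

lemma time_test_measurable: "time_test T \<eta> \<Longrightarrow> \<eta> \<in> borel_measurable borel"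
  by (intro C_infinity_measurable time_test_C)

lemma C_infinity_deriv1:
  fixes \<eta> :: "real \<Rightarrow> real"
  assumes "C_infinity \<eta>"
  shows "(\<eta> has_real_derivative dd 1 \<eta> t) (at t)"
  using C_infinity_line_real[OF assms, of 0 1 t] by simp

lemma dd_eqI:
  fixes \<eta> :: "real \<Rightarrow> real"
  assumes "(\<eta> has_real_derivative D) (at t)"
  shows "dd 1 \<eta> t = D"
  using has_derivative_imp_eq(1)[of \<eta> "(*) D" t] assms by (simp add: has_field_derivative_def)

lemma dd_vanish:
  assumes "\<forall>t. t \<notin> {a..b::real} \<longrightarrow> \<eta> t = (0::real)" and "t \<notin> {a..b}"
  shows "dd 1 \<eta> t = 0"
proof (rule dd_eqI)
  have "open (- {a..b})" by (simp add: open_Compl)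
  have "((\<lambda>_. 0 :: real) has_real_derivative 0) (at t)" by simp
  then show "(\<eta> has_real_derivative 0) (at t)"
    by (rule has_field_derivative_transform_within_open[OF _ \<open>open (- {a..b})\<close>]) (use assms in auto)
qed

lemma time_test_dd: "time_test T \<eta> \<Longrightarrow> time_test T (dd 1 \<eta>)"
  unfolding time_test_def using dd_vanish C_infinity_dd by blast

lemma time_test_bounded:
  assumes "time_test T \<eta>"
  obtains B where "0 \<le> B" "\<And>t. \<bar>\<eta> t\<bar> \<le> B"
proof -
  obtain a b where ab: "\<forall>t. t \<notin> {a..b} \<longrightarrow> \<eta> t = 0" using assms by (auto simp: time_test_def)
  have "bounded (\<eta> ` {a..b})"
    by (intro compact_imp_bounded compact_continuous_image C_infinity_continuous time_test_C[OF assms]) simp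
  then obtain B where B: "0 < B" "\<forall>x\<in>\<eta> ` {a..b}. norm x \<le> B" unfolding bounded_pos by blast
  have "\<bar>\<eta> t\<bar> \<le> B" for t using ab B by (cases "t \<in> {a..b}") auto
  with B(1) show ?thesis by (intro that[of B]) auto
qed

lemma integrable_mult_time_test:
  assumes "time_test T \<eta>" "integrable (time_measure T') g"
  shows "integrable (time_measure T') (\<lambda>t. g t * \<eta> t)"
proof -
  obtain B where "0 \<le> B" "\<And>t. \<bar>\<eta> t\<bar> \<le> B" by (rule time_test_bounded[OF assms(1)]) (rule that)
  then show ?thesis
    using integrable_bounded_mult[OF assms(2), of \<eta> B] time_test_measurable[OF assms(1)]
    by (simp add: time_measurable_iff mult.commute)
qed

lemma antiderivative_exists:
  fixes f :: "real \<Rightarrow> real"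
  assumes "continuous_on UNIV f"
  obtains F where "\<And>x. (F has_real_derivative f x) (at x)"
proof -
  have "\<exists>F. \<forall>x. -\<infinity> < ereal x \<longrightarrow> ereal x < \<infinity> \<longrightarrow> (F has_vector_derivative f x) (at x)"
    using assms by (intro einterval_antiderivative) (auto simp: continuous_on_eq_continuous_at)
  then show ?thesis
    using that by (auto simp: has_real_derivative_iff_has_vector_derivative)
qed

lemma deriv_zero_on_constant:
  fixes F :: "real \<Rightarrow> real"
  assumes "\<And>x. (F has_real_derivative f x) (at x)" "\<And>x. a \<le> x \<Longrightarrow> x \<le> b \<Longrightarrow> f x = 0" "a \<le> b"
  shows "F a = F b"
proof (cases "a = b")
  case False
  then have "a < b" using assms(3) by simp
  from MVT2[OF this, of F f] assms obtain z where "a < z" "z < b" "F b - F a = (b - a) * f z" by blast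
  then show ?thesis using assms(2)[of z] by simp
qed simp

section \<open>Smooth cutoffs and the fundamental lemma\<close>

context
  fixes \<rho> :: "real^'d \<Rightarrow> real"
  assumes \<rho>: "friedrichs_mollifier \<rho>"
begin

text \<open>Restricted to a line through a point where it does not vanish, \<open>\<rho>\<close> is
  a nonnegative nonzero bump of one variable. Its primitive, rescaled in argument and value, is the
  step.\<close>

lemma smooth_step_exists:
  obtains S :: "real \<Rightarrow> real" where "C_infinity S" "\<And>t. 0 \<le> S t" "\<And>t. S t \<le> 1"
    "\<And>t. t \<le> 0 \<Longrightarrow> S t = 0" "\<And>t. 1 \<le> t \<Longrightarrow> S t = 1"
proof -
  obtain R where R: "0 < R" "\<And>x. \<rho> x \<noteq> 0 \<Longrightarrow> norm x \<le> R" by (rule mollifier_support[OF \<rho>]) (rule that)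
  have "\<exists>x0. \<rho> x0 \<noteq> 0"
  proof (rule ccontr)
    assume "\<nexists>x0. \<rho> x0 \<noteq> 0"
    then show False using mollifier_integral[OF \<rho>] by simp
  qed
  then obtain x0 where x0: "\<rho> x0 \<noteq> 0" by blast
  define e where "e = (axis undefined 1 :: real^'d)"
  \<comment> \<open>For a parameter beyond \<open>M\<close> in absolute value, the line has left the
    ball of radius \<open>R\<close> that contains the support of \<open>\<rho>\<close>.\<close>
  define M where "M = R + norm x0"
  have M: "0 < M" using R(1) by (simp add: M_def add_pos_nonneg)
  define \<sigma> where "\<sigma> s = \<rho> (s *\<^sub>R e + x0)" for s
  have \<sigma>C: "C_infinity \<sigma>"
    unfolding \<sigma>_def by (intro C_infinity_affine mollifier_C[OF \<rho>] bounded_linear_scaleR_left)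
  have \<sigma>0: "\<sigma> s = 0" if "\<bar>s\<bar> > M" for s
  proof (rule ccontr)
    assume "\<sigma> s \<noteq> 0"
    then have "norm (s *\<^sub>R e + x0) \<le> R" using R(2) by (simp add: \<sigma>_def)
    moreover have "norm (s *\<^sub>R e) \<le> norm (s *\<^sub>R e + x0) + norm x0"
      by (metis add_diff_cancel_right' norm_triangle_ineq4)
    ultimately show False using that by (simp add: M_def e_def)
  qed
  have pos: "0 \<le> \<sigma> s" for s by (simp add: \<sigma>_def mollifier_nonneg[OF \<rho>])
  obtain F where F: "\<And>x. (F has_real_derivative \<sigma> x) (at x)"
    by (rule antiderivative_exists[OF C_infinity_continuous[OF \<sigma>C]]) (rule that)
  have mono: "F x \<le> F y" if "x \<le> y" for x y
    using DERIV_nonneg_imp_nondecreasing[OF that, of F] F pos by blast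
  \<comment> \<open>The bump is known to vanish only strictly beyond \<open>M\<close>; the margin 1
    makes it vanish on the closed half-lines ending at \<open>a\<close> and starting at
    \<open>b\<close>.\<close>
  define a where "a = - M - 1"
  define b where "b = M + 1"
  have left: "F t = F a" if "t \<le> a" for t
    by (rule deriv_zero_on_constant[OF F _ that]) (use \<sigma>0 M in \<open>auto simp: a_def\<close>)
  have right: "F t = F b" if "b \<le> t" for t
    by (rule deriv_zero_on_constant[OF F _ that, symmetric]) (use \<sigma>0 M in \<open>auto simp: b_def\<close>)
  have ab: "a < b" using M by (simp add: a_def b_def)
  \<comment> \<open>Otherwise the monotone \<open>F\<close> would be constant, and its derivative at
    0, which is \<open>\<rho> x0\<close>, would vanish.\<close>
  have "F a \<noteq> F b"
  proof
    assume eq: "F a = F b"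
    have const: "F x = F a" for x
    proof (cases "a \<le> x \<and> x \<le> b")
      case True
      then show ?thesis using mono[of a x] mono[of x b] eq by linarith
    next
      case False
      then show ?thesis using left[of x] right[of x] eq by linarith
    qed
    then have "F = (\<lambda>_. F a)" by auto
    then have "(F has_real_derivative 0) (at 0)"
      using DERIV_const[of "F a" "at 0"] by simp
    then have "\<sigma> 0 = 0" using F[of 0] DERIV_unique by blast
    then show False using x0 by (simp add: \<sigma>_def)
  qed
  then have c: "F b - F a > 0" using mono[of a b] ab by linarith
  have "C_infinity F" by (rule C_infinity_antiderivative[OF F \<sigma>C])
  then have "C_infinity (\<lambda>t. F ((b - a) * t + a) - F a)"
    by (intro C_infinity_diff C_infinity_const C_infinity_affine bounded_linear_mult_right)
  then have smooth: "C_infinity (\<lambda>t. (F ((b - a) * t + a) - F a) / (F b - F a))"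
    by (rule C_infinity_linear_comp[OF bounded_linear_divide])
  have range: "F a \<le> F t \<and> F t \<le> F b" for t
  proof -
    consider "t \<le> a" | "a \<le> t" "t \<le> b" | "b \<le> t" by linarith
    then show ?thesis
    proof cases
      case 1
      from left[OF this] mono[OF less_imp_le[OF ab]] show ?thesis by linarith
    next
      case 2
      from mono[OF this(1)] mono[OF this(2)] show ?thesis by blast
    next
      case 3
      from right[OF this] mono[OF less_imp_le[OF ab]] show ?thesis by linarith
    qed
  qed
  have zero: "(F ((b - a) * t + a) - F a) / (F b - F a) = 0" if "t \<le> 0" for t
  proof -
    have "(b - a) * t \<le> 0" using that ab by (intro mult_nonneg_nonpos) auto
    then have "(b - a) * t + a \<le> a" by simp
    from left[OF this] show ?thesis by simp
  qed
  have one: "(F ((b - a) * t + a) - F a) / (F b - F a) = 1" if "1 \<le> t" for t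
  proof -
    have "(b - a) * 1 \<le> (b - a) * t" using that ab by (intro mult_left_mono) auto
    then have "b \<le> (b - a) * t + a" by simp
    from right[OF this] c show ?thesis by simp
  qed
  have ge: "0 \<le> (F ((b - a) * t + a) - F a) / (F b - F a)" for t
    using c range[of "(b - a) * t + a"] by (intro divide_nonneg_pos) auto
  have le: "(F ((b - a) * t + a) - F a) / (F b - F a) \<le> 1" for t
    using c range[of "(b - a) * t + a"] by (subst divide_le_eq_1_pos) auto
  show ?thesis by (rule that[OF smooth ge le zero one])
qed

text \<open>A step at \<open>a\<close> and a reflected step at \<open>b\<close>, both steepened by
  the factor \<open>n\<close>, are multiplied. Since the step is 0 at 0, the limit at both endpoints
  is 0, which gives the open interval.\<close>

lemma bump_sequence_exists:
  assumes "0 < a" "a < b" "b < T"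
  obtains \<eta> where "\<And>n. time_test T (\<eta> n)" "\<And>n t. 0 \<le> \<eta> n t" "\<And>n t. \<eta> n t \<le> 1"
    "\<And>t. (\<lambda>n. \<eta> n t) \<longlonglongrightarrow> indicator {a<..<b} t"
proof -
  obtain S :: "real \<Rightarrow> real" where S: "C_infinity S" "\<And>t. 0 \<le> S t" "\<And>t. S t \<le> 1"
    "\<And>t. t \<le> 0 \<Longrightarrow> S t = 0" "\<And>t. 1 \<le> t \<Longrightarrow> S t = 1"
    by (rule smooth_step_exists) (rule that)
  define \<eta> where "\<eta> n t = S (real n * t + - real n * a) * S (- real n * t + real n * b)" for n t
  have lim1: "(\<lambda>n. S (real n * x)) \<longlonglongrightarrow> indicator {0<..} x" for x
  proof (cases "x > 0")
    case True
    then obtain N where N: "1 < real N * x" using reals_Archimedean3 by blast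
    have "S (real n * x) = 1" if "n \<ge> N" for n
    proof (rule S(5))
      have "real N * x \<le> real n * x" using that True by (intro mult_right_mono) auto
      with N show "1 \<le> real n * x" by linarith
    qed
    then have "eventually (\<lambda>n. S (real n * x) = 1) sequentially"
      by (auto simp: eventually_sequentially)
    then show ?thesis using True by (simp add: tendsto_eventually)
  next
    case False
    then have "S (real n * x) = 0" for n by (intro S(4)) (simp add: mult_nonneg_nonpos)
    then show ?thesis using False by simp
  qed
  have "time_test T (\<eta> n)" for n
    unfolding time_test_def
  proof
    show "C_infinity (\<eta> n)"
      unfolding \<eta>_def by (intro C_infinity_mult C_infinity_affine S(1) bounded_linear_mult_right)
    have "\<eta> n t = 0" if "t \<notin> {a..b}" for t
    proof -
      have "t \<le> a \<or> b \<le> t" using that by auto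
      then show ?thesis
      proof
        assume "t \<le> a"
        then have "real n * t \<le> real n * a" by (intro mult_left_mono) auto
        then show ?thesis using S(4)[of "real n * t + - real n * a"] by (simp add: \<eta>_def)
      next
        assume "b \<le> t"
        then have "real n * b \<le> real n * t" by (intro mult_left_mono) auto
        then show ?thesis using S(4)[of "- real n * t + real n * b"] by (simp add: \<eta>_def)
      qed
    qed
    then show "\<exists>a b. 0 < a \<and> b < T \<and> (\<forall>t. t \<notin> {a..b} \<longrightarrow> \<eta> n t = 0)"
      using assms by blast
  qed
  moreover have "0 \<le> \<eta> n t" for n t by (simp add: \<eta>_def S)
  moreover have "\<eta> n t \<le> 1" for n t using S by (simp add: \<eta>_def mult_le_one)
  moreover have "(\<lambda>n. \<eta> n t) \<longlonglongrightarrow> indicator {a<..<b} t" for t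
  proof -
    have "(\<lambda>n. S (real n * (t - a)) * S (real n * (b - t))) \<longlonglongrightarrow> indicator {0<..} (t - a) * indicator {0<..} (b - t)"
      by (intro tendsto_mult lim1)
    moreover have "indicator {0<..} (t - a) * indicator {0<..} (b - t) = (indicator {a<..<b} t :: real)"
      by (auto simp: indicator_def)
    ultimately show ?thesis by (simp add: \<eta>_def algebra_simps)
  qed
  ultimately show ?thesis by (rule that)
qed

text \<open>Bumps tend boundedly to indicators of intervals, so \<open>g\<close> has integral 0 over
  each interval inside \<open>{0<..<T}\<close>; Lebesgue differentiation then gives
  \<open>g = 0\<close> almost everywhere.\<close>

lemma fundamental_lemma:
  assumes g: "integrable (time_measure T) g"
    and zero: "\<And>\<eta>. time_test T \<eta> \<Longrightarrow> (LINT t|time_measure T. g t * \<eta> t) = 0"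
  shows "AE t in time_measure T. g t = 0"
proof -
  have [measurable]: "g \<in> borel_measurable borel" using g by (simp add: time_measurable_iff[symmetric])
  define G where "G t = indicator {0<..<T} t * g t" for t
  have G: "integrable lborel G" using g unfolding G_def[abs_def] by (simp add: integrable_time_measure)
  have int0: "integral {a..b} G = 0" if ab: "0 < a" "a < b" "b < T" for a b
  proof -
    obtain \<eta> where \<eta>: "\<And>n. time_test T (\<eta> n)" "\<And>n t. 0 \<le> \<eta> n t" "\<And>n t. \<eta> n t \<le> 1"
      "\<And>t. (\<lambda>n. \<eta> n t) \<longlonglongrightarrow> indicator {a<..<b} t"
      by (rule bump_sequence_exists[OF ab]) (rule that)
    have "(\<lambda>n. LINT t|time_measure T. g t * \<eta> n t) \<longlonglongrightarrow> (LINT t|time_measure T. g t * indicator {a<..<b} t)"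
    proof (rule integral_dominated_convergence[where w="\<lambda>t. \<bar>g t\<bar>"])
      show "(\<lambda>t. g t * \<eta> n t) \<in> borel_measurable (time_measure T)" for n
        using integrable_mult_time_test[OF \<eta>(1) g] by simp
      show "AE t in time_measure T. norm (g t * \<eta> n t) \<le> \<bar>g t\<bar>" for n
        using \<eta>(2,3)[of n] by (auto simp: abs_mult mult_left_le intro!: AE_I2)
    qed (use g \<eta>(4) in \<open>auto intro!: AE_I2 tendsto_mult\<close>)
    then have "(LINT t|time_measure T. g t * indicator {a<..<b} t) = 0"
      using zero[OF \<eta>(1)] by (simp add: LIMSEQ_const_iff)
    then have "(LINT t:{a<..<b}|lborel. G t) = 0"
      by (simp add: integral_time_measure G_def set_lebesgue_integral_def ac_simps)
    moreover have "set_integrable lborel {a<..<b} G"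
      unfolding set_integrable_def using G by (intro integrable_mult_indicator) auto
    ultimately have "integral {a<..<b} G = 0"
      by (simp add: set_borel_integral_eq_integral)
    then show ?thesis by (simp add: integral_open_interval_real)
  qed
  \<comment> \<open>Off a negligible set the averages over \<open>[x, x + h]\<close> tend to
    \<open>G x\<close>, while all of them vanish for small \<open>h\<close>.\<close>
  have "G integrable_on cbox a b" for a b
    using integrable_on_lborel[OF G] by (rule integrable_on_subcbox) simp
  then obtain N where N: "negligible N"
    "\<And>x e. \<lbrakk>x \<notin> N; 0 < e\<rbrakk> \<Longrightarrow> \<exists>d>0. \<forall>h. 0 < h \<and> h < d \<longrightarrow>
       norm (integral (cbox x (x + h *\<^sub>R One)) G /\<^sub>R h ^ DIM(real) - G x) < e"
    by (rule integrable_ccontinuous_explicit) (rule that)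
  have "g x = 0" if x: "x \<notin> N" "x \<in> {0<..<T}" for x
  proof (rule ccontr)
    assume "g x \<noteq> 0"
    then have "0 < \<bar>G x\<bar>" using x by (simp add: G_def)
    from N(2)[OF x(1) this] obtain d where d: "d > 0"
      "\<And>h. 0 < h \<and> h < d \<Longrightarrow> norm (integral (cbox x (x + h *\<^sub>R One)) G /\<^sub>R h ^ DIM(real) - G x) < \<bar>G x\<bar>"
      by blast
    \<comment> \<open>Half of the smaller length keeps \<open>h\<close> strictly below
      \<open>d\<close> and \<open>x + h\<close> strictly below \<open>T\<close>.\<close>
    define h where "h = min d (T - x) / 2"
    have h: "0 < h" "h < d" "x + h < T" using d(1) x by (auto simp: h_def min_def field_simps)
    then have "integral (cbox x (x + h *\<^sub>R One)) G = 0" using int0[of x "x + h"] x by simp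
    then show False using d(2)[of h] h by simp
  qed
  note gz = this
  have "AE x in lebesgue. x \<notin> N" using N(1) unfolding negligible_iff_null_sets by (rule AE_not_in)
  then have "AE x in lborel. x \<notin> N" by (simp add: AE_completion_iff)
  then show ?thesis unfolding AE_time_measure by eventually_elim (use gz in blast)
qed

end

text \<open>Subtracting from a test function a multiple of a fixed one with nonzero mean leaves mean
  zero, so the remainder is the derivative of a test function. Thus \<open>k\<close> acts on all
  test functions like a constant.\<close>

lemma du_bois_reymond:
  fixes \<rho> :: "real^'d \<Rightarrow> real"
  assumes \<rho>: "friedrichs_mollifier \<rho>" and T: "0 < T" and k: "integrable (time_measure T) k"
    and zero: "\<And>\<eta>. time_test T \<eta> \<Longrightarrow> (LINT t|time_measure T. k t * dd 1 \<eta> t) = 0"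
  shows "\<exists>c. AE t in time_measure T. k t = c"
proof -
  have int1: "(LINT t|time_measure T. 1 * \<eta> t) = F b - F a"
    if \<eta>: "C_infinity \<eta>" "\<And>t. t \<notin> {a..b} \<Longrightarrow> \<eta> t = 0" and ab: "0 < a" "a \<le> b" "b < T"
      and F: "\<And>t. (F has_real_derivative \<eta> t) (at t)" for \<eta> F a b
  proof -
    have [measurable]: "\<eta> \<in> borel_measurable borel" by (rule C_infinity_measurable[OF \<eta>(1)])
    have "(LINT t|time_measure T. 1 * \<eta> t) = (LINT t|lborel. indicator {a..b} t *\<^sub>R \<eta> t)"
      by (subst integral_time_measure) (use \<eta>(2) ab in \<open>auto intro!: Bochner_Integration.integral_cong simp: indicator_def\<close>)
    also have "\<dots> = F b - F a"
      by (rule integral_FTC_Icc[OF ab(2)])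
        (use F in \<open>auto intro: C_infinity_continuous \<eta>(1) simp: has_real_derivative_iff_has_vector_derivative[symmetric] has_field_derivative_at_within\<close>)
    finally show ?thesis .
  qed
  obtain \<eta>1 where \<eta>1: "\<And>n. time_test T (\<eta>1 n)" "\<And>n t. 0 \<le> \<eta>1 n t" "\<And>n t. \<eta>1 n t \<le> 1"
    "\<And>t. (\<lambda>n. \<eta>1 n t) \<longlonglongrightarrow> indicator {T/3<..<2*T/3} t"
    by (rule bump_sequence_exists[OF \<rho>, of "T/3" "2*T/3" T]) (use T in \<open>auto intro: that\<close>)
  have int_test: "integrable (time_measure T) \<eta>" if "time_test T \<eta>" for \<eta>
    using integrable_mult_time_test[OF that, of T "\<lambda>_. 1"] by simp
  \<comment> \<open>The bumps tend to the indicator of the middle third, whose integral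
    \<open>T/3\<close> is positive, so not all of their means vanish.\<close>
  have "\<exists>n. (LINT t|time_measure T. \<eta>1 n t) \<noteq> 0"
  proof (rule ccontr)
    assume "\<nexists>n. (LINT t|time_measure T. \<eta>1 n t) \<noteq> 0"
    then have z: "(LINT t|time_measure T. \<eta>1 n t) = 0" for n by blast
    have "(\<lambda>n. LINT t|time_measure T. \<eta>1 n t) \<longlonglongrightarrow> (LINT t|time_measure T. indicator {T/3<..<2*T/3} t)"
    proof (rule integral_dominated_convergence[where w="\<lambda>_. 1"])
      show "\<eta>1 n \<in> borel_measurable (time_measure T)" for n
        using time_test_measurable[OF \<eta>1(1)] by (simp add: time_measurable_iff)
    qed (use \<eta>1 in auto)
    then have "(LINT t|time_measure T. indicator {T/3<..<2*T/3} t) = (0 :: real)"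
      by (simp add: z LIMSEQ_const_iff)
    moreover have "(LINT t|time_measure T. indicator {T/3<..<2*T/3} t) = (LINT t|lborel. indicator {T/3<..<2*T/3} t :: real)"
    proof -
      have "(LINT t|time_measure T. indicator {T/3<..<2*T/3} t) = (LINT t|lborel. indicator {0<..<T} t * (indicator {T/3<..<2*T/3} t :: real))"
        by (rule integral_time_measure) simp
      also have "(\<lambda>t. indicator {0<..<T} t * (indicator {T/3<..<2*T/3} t :: real)) = indicator {T/3<..<2*T/3}"
        using T by (auto simp: indicator_def fun_eq_iff)
      finally show ?thesis .
    qed
    moreover have "(LINT t|lborel. indicator {T/3<..<2*T/3} t :: real) = T/3"
      using T by simp
    ultimately show False using T by simp
  qed
  then obtain n where n: "(LINT t|time_measure T. \<eta>1 n t) \<noteq> 0" by blast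
  define m where "m = (LINT t|time_measure T. \<eta>1 n t)"
  define \<eta>0 where "\<eta>0 = \<eta>1 n"
  have \<eta>0: "time_test T \<eta>0" "(LINT t|time_measure T. \<eta>0 t) = m" "m \<noteq> 0"
    using \<eta>1(1) n by (simp_all add: \<eta>0_def m_def)
  define c where "c = (LINT t|time_measure T. k t * \<eta>0 t) / m"
  have "AE t in time_measure T. k t - c = 0"
  proof (rule fundamental_lemma[OF \<rho>])
    show "integrable (time_measure T) (\<lambda>t. k t - c)" using k by simp
    fix \<eta> assume \<eta>: "time_test T \<eta>"
    define e where "e = (LINT t|time_measure T. \<eta> t)"
    \<comment> \<open>The coefficient makes the mean of \<open>\<theta>\<close> zero, which is the
      condition for its primitive to return to its initial value after the support.\<close>
    define \<theta> where "\<theta> t = \<eta> t + (- e / m) * \<eta>0 t" for t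
    have \<theta>C: "C_infinity \<theta>" unfolding \<theta>_def
      by (intro C_infinity_add time_test_C[OF \<eta>] C_infinity_mult C_infinity_const time_test_C[OF \<eta>0(1)])
    obtain a1 b1 a2 b2 where s: "0 < a1" "b1 < T" "\<And>t. t \<notin> {a1..b1} \<Longrightarrow> \<eta> t = 0"
      "0 < a2" "b2 < T" "\<And>t. t \<notin> {a2..b2} \<Longrightarrow> \<eta>0 t = 0"
      using \<eta> \<eta>0(1) unfolding time_test_def by metis
    \<comment> \<open>Including \<open>T/2\<close> in both bounds ensures \<open>a \<le> b\<close>
      even when the given support intervals are empty.\<close>
    define a where "a = min (min a1 a2) (T/2)"
    define b where "b = max (max b1 b2) (T/2)"
    have ab: "0 < a" "a \<le> b" "b < T" using s T by (auto simp: a_def b_def)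
    have \<theta>0: "\<theta> t = 0" if "t \<notin> {a..b}" for t
    proof -
      have "t \<notin> {a1..b1}" "t \<notin> {a2..b2}" using that by (auto simp: a_def b_def)
      then show ?thesis by (simp add: \<theta>_def s)
    qed
    obtain F where F: "\<And>x. (F has_real_derivative \<theta> x) (at x)"
      by (rule antiderivative_exists[OF C_infinity_continuous[OF \<theta>C]]) (rule that)
    have "F b - F a = (LINT t|time_measure T. 1 * \<theta> t)"
      by (rule int1[OF \<theta>C \<theta>0 ab F, symmetric])
    also have "\<dots> = e + (- e / m) * m"
      unfolding \<theta>_def using int_test[OF \<eta>] int_test[OF \<eta>0(1)] by (simp add: e_def \<eta>0(2))
    finally have Fab: "F b = F a" using \<eta>0(3) by simp
    define \<zeta> where "\<zeta> t = F t - F a" for t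
    have D: "(\<zeta> has_real_derivative \<theta> t) (at t)" for t
      unfolding \<zeta>_def using F[of t] by (auto intro!: derivative_eq_intros)
    have "time_test T \<zeta>"
      unfolding time_test_def
    proof
      show "C_infinity \<zeta>" by (rule C_infinity_antiderivative[OF D \<theta>C])
      have "\<zeta> t = 0" if t: "t \<notin> {a..b}" for t
      proof (cases "t < a")
        case True
        \<comment> \<open>The support condition is silent at the endpoint itself; the value there
          follows by continuity.\<close>
        have "\<theta> a = 0"
        proof -
          have "continuous (at a) \<theta>" using C_infinity_continuous[OF \<theta>C, of UNIV] by (simp add: continuous_on_eq_continuous_at)
          moreover have "(\<lambda>n. a - 1 / real (Suc n)) \<longlonglongrightarrow> a - 0"
            by (intro tendsto_intros LIMSEQ_Suc[OF lim_1_over_n])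
          ultimately have "(\<lambda>n. \<theta> (a - 1 / real (Suc n))) \<longlonglongrightarrow> \<theta> a"
            by (intro isCont_tendsto_compose[where g=\<theta>]) auto
          moreover have "\<theta> (a - 1 / real (Suc n)) = 0" for n by (rule \<theta>0) auto
          ultimately show ?thesis by (simp add: LIMSEQ_const_iff)
        qed
        then have "\<theta> x = 0" if "x \<le> a" for x using \<theta>0[of x] that by (cases "x = a") auto
        then have "F t = F a" using True by (intro deriv_zero_on_constant[OF F]) auto
        then show ?thesis by (simp add: \<zeta>_def)
      next
        case False
        then have "b < t" using t by auto
        have "\<theta> b = 0"
        proof -
          have "continuous (at b) \<theta>" using C_infinity_continuous[OF \<theta>C, of UNIV] by (simp add: continuous_on_eq_continuous_at)
          moreover have "(\<lambda>n. b + 1 / real (Suc n)) \<longlonglongrightarrow> b + 0"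
            by (intro tendsto_intros LIMSEQ_Suc[OF lim_1_over_n])
          ultimately have "(\<lambda>n. \<theta> (b + 1 / real (Suc n))) \<longlonglongrightarrow> \<theta> b"
            by (intro isCont_tendsto_compose[where g=\<theta>]) auto
          moreover have "\<theta> (b + 1 / real (Suc n)) = 0" for n by (rule \<theta>0) auto
          ultimately show ?thesis by (simp add: LIMSEQ_const_iff)
        qed
        then have "\<theta> x = 0" if "b \<le> x" for x using \<theta>0[of x] that by (cases "x = b") auto
        then have "F b = F t" using \<open>b < t\<close> by (intro deriv_zero_on_constant[OF F]) auto
        then show ?thesis using Fab by (simp add: \<zeta>_def)
      qed
      then show "\<exists>a b. 0 < a \<and> b < T \<and> (\<forall>t. t \<notin> {a..b} \<longrightarrow> \<zeta> t = 0)" using ab by blast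
    qed
    from zero[OF this] have "(LINT t|time_measure T. k t * \<theta> t) = 0" by (simp add: dd_eqI[OF D])
    moreover have "(LINT t|time_measure T. k t * \<theta> t)
       = (LINT t|time_measure T. k t * \<eta> t) + (- e / m) * (LINT t|time_measure T. k t * \<eta>0 t)"
    proof -
      have "(LINT t|time_measure T. k t * \<theta> t) = (LINT t|time_measure T. k t * \<eta> t + (- e / m) * (k t * \<eta>0 t))"
        by (intro Bochner_Integration.integral_cong) (auto simp: \<theta>_def algebra_simps)
      then show ?thesis
        using integrable_mult_time_test[OF \<eta> k] integrable_mult_time_test[OF \<eta>0(1) k] by simp
    qed
    moreover have "(LINT t|time_measure T. (k t - c) * \<eta> t) = (LINT t|time_measure T. k t * \<eta> t) - c * e"
      using integrable_mult_time_test[OF \<eta> k] int_test[OF \<eta>] by (simp add: left_diff_distrib e_def)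
    ultimately show "(LINT t|time_measure T. (k t - c) * \<eta> t) = 0"
      by (simp add: c_def)
  qed
  then show ?thesis by (auto intro!: exI[of _ c] elim: eventually_mono)
qed

section \<open>The product rule for weak derivatives in one variable\<close>

text \<open>The primitive that starts at time 0. Together with \<open>after\<close> it uses the same
  strict relation \<open>s < t\<close>, so the two are exchanged by Fubini without a diagonal
  term.\<close>

definition before :: "real \<Rightarrow> (real \<Rightarrow> real) \<Rightarrow> real \<Rightarrow> real" where
  "before T A t = (LINT s|time_measure T. indicator {..<t} s * A s)"

definition after :: "real \<Rightarrow> (real \<Rightarrow> real) \<Rightarrow> real \<Rightarrow> real" where
  "after T B s = (LINT t|time_measure T. indicator {s<..} t * B t)"

lemma before_measurable [measurable]:
  assumes A: "A \<in> borel_measurable borel"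
  shows "before T A \<in> borel_measurable borel"
proof -
  have [measurable]: "A \<in> borel_measurable (time_measure T)" using A by (simp add: time_measurable_iff)
  have "before T A = (\<lambda>t. LINT s|time_measure T. (if s < t then 1 else 0) * A s)"
    unfolding before_def by (intro ext Bochner_Integration.integral_cong) (auto simp: indicator_def)
  then show ?thesis by simp
qed

lemma before_bound:
  assumes "integrable (time_measure T) A"
  shows "\<bar>before T A t\<bar> \<le> (LINT s|time_measure T. \<bar>A s\<bar>)"
proof -
  have [measurable]: "A \<in> borel_measurable borel" using assms by (simp add: time_measurable_iff[symmetric])
  have "\<bar>before T A t\<bar> \<le> (LINT s|time_measure T. \<bar>indicator {..<t} s * A s\<bar>)"
    unfolding before_def by (rule integral_abs_bound)
  also have "\<dots> \<le> (LINT s|time_measure T. \<bar>A s\<bar>)"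
    by (intro integral_mono integrable_abs assms integrable_bounded_mult[OF assms, of _ 1]) (auto simp: indicator_def)
  finally show ?thesis .
qed

text \<open>Fubini over the triangle \<open>s < t\<close>. This takes the place of integration by
  parts for functions that are merely integrable.\<close>

lemma before_after_swap:
  assumes A: "integrable (time_measure T) A" and B: "integrable (time_measure T) B"
  shows "(LINT s|time_measure T. A s * after T B s) = (LINT t|time_measure T. before T A t * B t)"
proof -
  have [measurable]: "A \<in> borel_measurable borel" "B \<in> borel_measurable borel"
    using assms by (simp_all add: time_measurable_iff[symmetric])
  interpret pair_sigma_finite "time_measure T" "time_measure T" ..
  have "integrable (time_measure T \<Otimes>\<^sub>M time_measure T) (\<lambda>(s, t). A s * B t)"
    by (rule Fubini_integrable) (use A B in \<open>auto simp: abs_mult\<close>)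
  then have "integrable (time_measure T \<Otimes>\<^sub>M time_measure T) (\<lambda>(s, t). (if s < t then 1 else 0) * (A s * B t))"
    by (rule Bochner_Integration.integrable_bound) auto
  from Fubini_integral[OF this]
  have "(LINT t|time_measure T. LINT s|time_measure T. (if s < t then 1 else 0) * (A s * B t))
    = (LINT s|time_measure T. LINT t|time_measure T. (if s < t then 1 else 0) * (A s * B t))" .
  moreover have "(LINT s|time_measure T. (if s < t then 1 else 0) * (A s * B t)) = before T A t * B t" for t
    unfolding before_def integral_mult_left_zero[symmetric]
    by (intro Bochner_Integration.integral_cong) (auto simp: indicator_def)
  moreover have "(LINT t|time_measure T. (if s < t then 1 else 0) * (A s * B t)) = A s * after T B s" for s
    unfolding after_def integral_mult_right_zero[symmetric]
    by (intro Bochner_Integration.integral_cong) (auto simp: indicator_def)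
  ultimately show ?thesis by simp
qed

lemma after_derivative:
  assumes \<eta>: "time_test T \<eta>" and s: "s \<in> {0<..<T}"
  shows "after T (dd 1 \<eta>) s = - \<eta> s"
proof -
  obtain a b where ab: "0 < a" "b < T" "\<forall>t. t \<notin> {a..b} \<longrightarrow> \<eta> t = 0" using \<eta> by (auto simp: time_test_def)
  define c where "c = max b s"
  have c: "s \<le> c" "c < T" "b \<le> c" using ab s by (auto simp: c_def)
  \<comment> \<open>A time after both \<open>s\<close> and the support of \<open>\<eta>\<close> but
    before \<open>T\<close>: the boundary term of the fundamental theorem vanishes there.\<close>
  define d where "d = (c + T) / 2"
  have d: "s \<le> d" "d < T" "b < d" using c by (auto simp: d_def)
  have [measurable]: "dd 1 \<eta> \<in> borel_measurable borel"
    by (rule time_test_measurable[OF time_test_dd[OF \<eta>]])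
  have "after T (dd 1 \<eta>) s = (LINT t|lborel. indicator {0<..<T} t * (indicator {s<..} t * dd 1 \<eta> t))"
    unfolding after_def by (rule integral_time_measure) measurable
  also have "\<dots> = (LINT t|lborel. indicator {s..d} t *\<^sub>R dd 1 \<eta> t)"
  proof (rule integral_cong_AE)
    have "AE t in lborel. t \<noteq> s" by (rule AE_lborel_singleton)
    then show "AE t in lborel. indicator {0<..<T} t * (indicator {s<..} t * dd 1 \<eta> t) = indicator {s..d} t *\<^sub>R dd 1 \<eta> t"
    proof eventually_elim
      case (elim t)
      then show ?case using dd_vanish[OF ab(3), of t] d s by (auto simp: indicator_def)
    qed
  qed measurable
  also have "\<dots> = \<eta> d - \<eta> s"
    by (rule integral_FTC_Icc[OF d(1)])
      (use C_infinity_deriv1[OF time_test_C[OF \<eta>]] in \<open>auto intro: C_infinity_continuous C_infinity_dd time_test_C[OF \<eta>]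
        simp: has_real_derivative_iff_has_vector_derivative[symmetric] has_field_derivative_at_within\<close>)
  finally show ?thesis using ab(3) d(3) by simp
qed

lemma integral_time_cong:
  fixes f g :: "real \<Rightarrow> real"
  assumes "\<And>t. t \<in> {0<..<T} \<Longrightarrow> t \<noteq> s \<Longrightarrow> f t = g t" "f \<in> borel_measurable borel" "g \<in> borel_measurable borel"
  shows "(LINT t|time_measure T. f t) = (LINT t|time_measure T. g t)"
proof (rule integral_cong_AE)
  have "AE t in lborel. t \<noteq> s" by (rule AE_lborel_singleton)
  then show "AE t in time_measure T. f t = g t"
    unfolding AE_time_measure by eventually_elim (use assms in auto)
qed (use assms in \<open>auto simp: time_measurable_iff\<close>)

lemma integrable_before_mult:
  assumes A: "integrable (time_measure T) A" and B: "integrable (time_measure T) B"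
  shows "integrable (time_measure T) (\<lambda>t. before T A t * B t)"
  using A before_measurable[of A T] before_bound[OF A]
  by (intro integrable_bounded_mult[OF B]) (auto simp: time_measurable_iff[symmetric])

text \<open>Integration by parts on the interval from \<open>s\<close> to \<open>T\<close> for a
  primitive times a test function. After the exchange of integrals, the ranges \<open>r > s\<close>
  and \<open>r < s\<close> give the two terms on the right.\<close>

lemma after_before_derivative:
  assumes G: "integrable (time_measure T) G" and \<eta>: "time_test T \<eta>" and s: "s \<in> {0<..<T}"
  shows "after T (\<lambda>t. before T G t * dd 1 \<eta> t) s = - after T (\<lambda>t. G t * \<eta> t) s - before T G s * \<eta> s"
proof -
  have [measurable]: "G \<in> borel_measurable borel" using G by (simp add: time_measurable_iff[symmetric])
  have [measurable]: "\<eta> \<in> borel_measurable borel" "dd 1 \<eta> \<in> borel_measurable borel"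
    by (rule time_test_measurable[OF \<eta>], rule time_test_measurable[OF time_test_dd[OF \<eta>]])
  let ?B = "\<lambda>t. indicator {s<..} t * dd 1 \<eta> t"
  have iB: "integrable (time_measure T) ?B"
  proof (rule integrable_mult_time_test[OF time_test_dd[OF \<eta>]])
    show "integrable (time_measure T) (indicator {s<..} :: real \<Rightarrow> real)"
      by (rule time.integrable_const_bound[where B=1]) (auto simp: time_measurable_iff)
  qed
  \<comment> \<open>The tail beyond \<open>r\<close> of a function already cut at \<open>s\<close>
    is the tail beyond the later of the two times.\<close>
  have after_max: "after T ?B r = - \<eta> (max r s)" if r: "r \<in> {0<..<T}" for r
  proof -
    have "after T ?B r = after T (dd 1 \<eta>) (max r s)"
      unfolding after_def by (intro Bochner_Integration.integral_cong) (auto simp: indicator_def)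
    also have "\<dots> = - \<eta> (max r s)" using r s by (intro after_derivative \<eta>) (auto simp: max_def)
    finally show ?thesis .
  qed
  have after_meas: "after T ?B \<in> borel_measurable borel"
  proof -
    have [measurable]: "dd 1 \<eta> \<in> borel_measurable (time_measure T)" by (simp add: time_measurable_iff)
    have "after T ?B = (\<lambda>r. LINT t|time_measure T. (if r < t then 1 else 0) * ((if s < t then 1 else 0) * dd 1 \<eta> t))"
      unfolding after_def by (intro ext Bochner_Integration.integral_cong) (auto simp: indicator_def)
    then show ?thesis by simp
  qed
  have "after T (\<lambda>t. before T G t * dd 1 \<eta> t) s = (LINT t|time_measure T. before T G t * ?B t)"
    unfolding after_def by (intro Bochner_Integration.integral_cong) (auto simp: ac_simps)
  also have "\<dots> = (LINT r|time_measure T. G r * after T ?B r)"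
    by (rule before_after_swap[OF G iB, symmetric])
  also have "\<dots> = (LINT r|time_measure T. - (indicator {s<..} r * (G r * \<eta> r)) - (indicator {..<s} r * G r) * \<eta> s)"
  proof (rule integral_time_cong[where s=s])
    fix r assume r: "r \<in> {0<..<T}" "r \<noteq> s"
    show "G r * after T ?B r = - (indicator {s<..} r * (G r * \<eta> r)) - (indicator {..<s} r * G r) * \<eta> s"
      unfolding after_max[OF r(1)] using r(2) by (auto simp: indicator_def max_def)
  next
    show "(\<lambda>r. G r * after T ?B r) \<in> borel_measurable borel" using after_meas by measurable
  qed measurable
  also have "\<dots> = - (LINT r|time_measure T. indicator {s<..} r * (G r * \<eta> r)) - (LINT r|time_measure T. indicator {..<s} r * G r) * \<eta> s"
  proof -
    have "integrable (time_measure T) (\<lambda>r. indicator {s<..} r * (G r * \<eta> r))"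
      by (rule integrable_bounded_mult[OF integrable_mult_time_test[OF \<eta> G], where B=1]) (auto simp: indicator_def time_measurable_iff)
    moreover have "integrable (time_measure T) (\<lambda>r. indicator {..<s} r * G r)"
      by (rule integrable_bounded_mult[OF G, where B=1]) (auto simp: indicator_def time_measurable_iff)
    ultimately show ?thesis by simp
  qed
  finally show ?thesis by (simp add: after_def before_def)
qed

lemma integral_deriv_time_test:
  assumes \<eta>: "time_test T \<eta>" and T: "0 < T"
  shows "(LINT t|time_measure T. dd 1 \<eta> t) = 0"
proof -
  obtain a b where ab: "0 < a" "b < T" "\<forall>t. t \<notin> {a..b} \<longrightarrow> \<eta> t = 0" using \<eta> by (auto simp: time_test_def)
  define s where "s = min (a / 2) (T / 2)"
  have s: "s \<in> {0<..<T}" "s < a" using ab T by (auto simp: s_def)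
  have [measurable]: "dd 1 \<eta> \<in> borel_measurable borel"
    by (rule time_test_measurable[OF time_test_dd[OF \<eta>]])
  have "(LINT t|time_measure T. dd 1 \<eta> t) = after T (dd 1 \<eta>) s"
    unfolding after_def
    by (rule Bochner_Integration.integral_cong) (use dd_vanish[OF ab(3)] s in \<open>auto simp: indicator_def\<close>)
  also have "\<dots> = 0" using after_derivative[OF \<eta> s(1)] ab(3) s by simp
  finally show ?thesis .
qed

definition weak_derivative :: "real \<Rightarrow> (real \<Rightarrow> real) \<Rightarrow> (real \<Rightarrow> real) \<Rightarrow> bool" where
  "weak_derivative T f F \<longleftrightarrow> integrable (time_measure T) f \<and> integrable (time_measure T) F \<and>
     (\<forall>\<eta>. time_test T \<eta> \<longrightarrow>
        (LINT t|time_measure T. f t * dd 1 \<eta> t) = - (LINT t|time_measure T. F t * \<eta> t))"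

lemma integral_before_derivative:
  assumes F: "integrable (time_measure T) F" and \<eta>: "time_test T \<eta>"
  shows "(LINT t|time_measure T. before T F t * dd 1 \<eta> t) = - (LINT t|time_measure T. F t * \<eta> t)"
proof -
  have i: "integrable (time_measure T) (dd 1 \<eta>)"
    using integrable_mult_time_test[OF time_test_dd[OF \<eta>], of T "\<lambda>_. 1"] by simp
  have [measurable]: "F \<in> borel_measurable borel" "\<eta> \<in> borel_measurable borel"
    using F time_test_measurable[OF \<eta>] by (simp_all add: time_measurable_iff[symmetric])
  have m: "after T (dd 1 \<eta>) \<in> borel_measurable borel"
  proof -
    have [measurable]: "dd 1 \<eta> \<in> borel_measurable (time_measure T)" using i by simp
    have "after T (dd 1 \<eta>) = (\<lambda>r. LINT t|time_measure T. (if r < t then 1 else 0) * dd 1 \<eta> t)"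
      unfolding after_def by (intro ext Bochner_Integration.integral_cong) (auto simp: indicator_def)
    then show ?thesis by simp
  qed
  have "(LINT t|time_measure T. before T F t * dd 1 \<eta> t) = (LINT s|time_measure T. F s * after T (dd 1 \<eta>) s)"
    by (rule before_after_swap[OF F i, symmetric])
  also have "\<dots> = (LINT s|time_measure T. - (F s * \<eta> s))"
    by (rule integral_time_cong[where s=0]) (use m after_derivative[OF \<eta>] in auto)
  finally show ?thesis by simp
qed

text \<open>The difference of \<open>f\<close> and the primitive of \<open>F\<close> has weak
  derivative 0, so it is constant by \<open>du_bois_reymond\<close>.\<close>

lemma weak_derivative_representation:
  fixes \<rho> :: "real^'d \<Rightarrow> real"
  assumes \<rho>: "friedrichs_mollifier \<rho>" and T: "0 < T" and f: "weak_derivative T f F"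
  shows "\<exists>c. AE t in time_measure T. f t = c + before T F t"
proof -
  have i: "integrable (time_measure T) f" "integrable (time_measure T) F" using f by (auto simp: weak_derivative_def)
  have ib: "integrable (time_measure T) (before T F)"
    using integrable_before_mult[OF i(2), of "\<lambda>_. 1"] by simp
  have "\<exists>c. AE t in time_measure T. f t - before T F t = c"
  proof (rule du_bois_reymond[OF \<rho> T])
    show "integrable (time_measure T) (\<lambda>t. f t - before T F t)" using i ib by simp
    fix \<eta> assume \<eta>: "time_test T \<eta>"
    note d = time_test_dd[OF \<eta>]
    have "(LINT t|time_measure T. (f t - before T F t) * dd 1 \<eta> t)
      = (LINT t|time_measure T. f t * dd 1 \<eta> t) - (LINT t|time_measure T. before T F t * dd 1 \<eta> t)"
      using integrable_mult_time_test[OF d i(1)] integrable_mult_time_test[OF d ib]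
      by (simp add: left_diff_distrib)
    then show "(LINT t|time_measure T. (f t - before T F t) * dd 1 \<eta> t) = 0"
      using f \<eta> integral_before_derivative[OF i(2) \<eta>] by (simp add: weak_derivative_def)
  qed
  then obtain c where "AE t in time_measure T. f t - before T F t = c" by blast
  then have "AE t in time_measure T. f t = c + before T F t" by eventually_elim auto
  then show ?thesis by blast
qed

text \<open>Exchange the integrals for the primitive of \<open>F\<close>, apply
  \<open>after_before_derivative\<close> to the rest, and exchange back: the product rule for two
  primitives from Fubini alone.\<close>

lemma integral_before_before_derivative:
  assumes F: "integrable (time_measure T) F" and G: "integrable (time_measure T) G" and \<eta>: "time_test T \<eta>"
  shows "(LINT t|time_measure T. before T F t * (before T G t * dd 1 \<eta> t))
    = - (LINT t|time_measure T. before T F t * (G t * \<eta> t)) - (LINT t|time_measure T. before T G t * (F t * \<eta> t))"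
proof -
  note d = time_test_dd[OF \<eta>]
  have id: "integrable (time_measure T) (dd 1 \<eta>)"
    using integrable_mult_time_test[OF d, of T "\<lambda>_. 1"] by simp
  have iG: "integrable (time_measure T) (\<lambda>t. G t * \<eta> t)" and iF: "integrable (time_measure T) (\<lambda>t. F t * \<eta> t)"
    using integrable_mult_time_test[OF \<eta>] F G by auto
  have [measurable]: "F \<in> borel_measurable borel" "G \<in> borel_measurable borel" "\<eta> \<in> borel_measurable borel"
    using F G time_test_measurable[OF \<eta>] by (simp_all add: time_measurable_iff[symmetric])
  have am: "after T B \<in> borel_measurable borel" if "integrable (time_measure T) B" for B
  proof -
    have [measurable]: "B \<in> borel_measurable (time_measure T)" using that by simp
    have "after T B = (\<lambda>r. LINT t|time_measure T. (if r < t then 1 else 0) * B t)"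
      unfolding after_def by (intro ext Bochner_Integration.integral_cong) (auto simp: indicator_def)
    then show ?thesis by simp
  qed
  have ab: "\<bar>after T B s\<bar> \<le> (LINT t|time_measure T. \<bar>B t\<bar>)" if B: "integrable (time_measure T) B" for B s
  proof -
    have [measurable]: "B \<in> borel_measurable borel" using B by (simp add: time_measurable_iff[symmetric])
    have "\<bar>after T B s\<bar> \<le> (LINT t|time_measure T. \<bar>indicator {s<..} t * B t\<bar>)"
      unfolding after_def by (rule integral_abs_bound)
    also have "\<dots> \<le> (LINT t|time_measure T. \<bar>B t\<bar>)"
      by (intro integral_mono integrable_abs B integrable_bounded_mult[OF B, of _ 1]) (auto simp: indicator_def time_measurable_iff)
    finally show ?thesis .
  qed
  have iB: "integrable (time_measure T) (\<lambda>t. before T G t * dd 1 \<eta> t)" by (rule integrable_before_mult[OF G id])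
  have "(LINT t|time_measure T. before T F t * (before T G t * dd 1 \<eta> t))
     = (LINT s|time_measure T. F s * after T (\<lambda>t. before T G t * dd 1 \<eta> t) s)"
    by (rule before_after_swap[OF F iB, symmetric])
  also have "\<dots> = (LINT s|time_measure T. - (F s * after T (\<lambda>t. G t * \<eta> t) s) - before T G s * (F s * \<eta> s))"
  proof (rule integral_time_cong[where s=0])
    fix s assume "s \<in> {0<..<T}"
    note eq = after_before_derivative[OF G \<eta> this]
    show "F s * after T (\<lambda>t. before T G t * dd 1 \<eta> t) s = - (F s * after T (\<lambda>t. G t * \<eta> t) s) - before T G s * (F s * \<eta> s)"
      unfolding eq by (simp add: algebra_simps)
  qed (use am[OF iB] am[OF iG] in measurable)
  also have "\<dots> = - (LINT s|time_measure T. F s * after T (\<lambda>t. G t * \<eta> t) s) - (LINT t|time_measure T. before T G t * (F t * \<eta> t))"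
  proof -
    have "integrable (time_measure T) (\<lambda>s. F s * after T (\<lambda>t. G t * \<eta> t) s)"
      using integrable_bounded_mult[OF F, of "after T (\<lambda>t. G t * \<eta> t)" "LINT t|time_measure T. \<bar>G t * \<eta> t\<bar>"]
        ab[OF iG] am[OF iG]
      by (simp add: mult.commute time_measurable_iff)
    then show ?thesis using integrable_before_mult[OF G iF] by simp
  qed
  also have "(LINT s|time_measure T. F s * after T (\<lambda>t. G t * \<eta> t) s) = (LINT t|time_measure T. before T F t * (G t * \<eta> t))"
    by (rule before_after_swap[OF F iG])
  finally show ?thesis .
qed

text \<open>Write each factor as a constant plus a primitive and expand. Primitives of integrable
  functions are bounded, so all products that arise are integrable although \<open>F\<close> and
  \<open>G\<close> are only in L^1.\<close>

theorem weak_derivative_product: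
  fixes \<rho> :: "real^'d \<Rightarrow> real"
  assumes \<rho>: "friedrichs_mollifier \<rho>" and T: "0 < T"
    and f: "weak_derivative T f F" and g: "weak_derivative T g G" and \<eta>: "time_test T \<eta>"
  shows "(LINT t|time_measure T. f t * g t * dd 1 \<eta> t) = - (LINT t|time_measure T. (F t * g t + f t * G t) * \<eta> t)"
proof -
  have i: "integrable (time_measure T) f" "integrable (time_measure T) F"
    "integrable (time_measure T) g" "integrable (time_measure T) G"
    using f g by (auto simp: weak_derivative_def)
  note d = time_test_dd[OF \<eta>]
  have id: "integrable (time_measure T) (dd 1 \<eta>)"
    using integrable_mult_time_test[OF d, of T "\<lambda>_. 1"] by simp
  have iG: "integrable (time_measure T) (\<lambda>t. G t * \<eta> t)" and iF: "integrable (time_measure T) (\<lambda>t. F t * \<eta> t)"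
    using integrable_mult_time_test[OF \<eta>] i by auto
  have [measurable]: "f \<in> borel_measurable (time_measure T)" "F \<in> borel_measurable (time_measure T)"
    "g \<in> borel_measurable (time_measure T)" "G \<in> borel_measurable (time_measure T)"
    "\<eta> \<in> borel_measurable (time_measure T)" "dd 1 \<eta> \<in> borel_measurable (time_measure T)"
    "before T F \<in> borel_measurable (time_measure T)" "before T G \<in> borel_measurable (time_measure T)"
    using i id time_test_measurable[OF \<eta>] before_measurable[of F T] before_measurable[of G T]
    by (simp_all add: time_measurable_iff)
  obtain c where c: "AE t in time_measure T. f t = c + before T F t"
    using weak_derivative_representation[OF \<rho> T f] by blast
  obtain e where e: "AE t in time_measure T. g t = e + before T G t"
    using weak_derivative_representation[OF \<rho> T g] by blast
  have "(LINT t|time_measure T. f t * g t * dd 1 \<eta> t)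
    = (LINT t|time_measure T. c * e * dd 1 \<eta> t + c * (before T G t * dd 1 \<eta> t) + e * (before T F t * dd 1 \<eta> t)
         + before T F t * (before T G t * dd 1 \<eta> t))"
  proof (rule integral_cong_AE)
    show "AE t in time_measure T. f t * g t * dd 1 \<eta> t = c * e * dd 1 \<eta> t + c * (before T G t * dd 1 \<eta> t)
        + e * (before T F t * dd 1 \<eta> t) + before T F t * (before T G t * dd 1 \<eta> t)"
      using c e by eventually_elim (simp add: algebra_simps)
  qed measurable
  also have "\<dots> = c * e * (LINT t|time_measure T. dd 1 \<eta> t) + c * (LINT t|time_measure T. before T G t * dd 1 \<eta> t)
      + e * (LINT t|time_measure T. before T F t * dd 1 \<eta> t)
      + (LINT t|time_measure T. before T F t * (before T G t * dd 1 \<eta> t))"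
    using id integrable_before_mult[OF i(2) id] integrable_before_mult[OF i(4) id]
      integrable_before_mult[OF i(2) integrable_before_mult[OF i(4) id]] by simp
  also have "\<dots> = - (c * (LINT t|time_measure T. G t * \<eta> t) + e * (LINT t|time_measure T. F t * \<eta> t)
      + (LINT t|time_measure T. before T F t * (G t * \<eta> t)) + (LINT t|time_measure T. before T G t * (F t * \<eta> t)))"
    by (simp add: integral_deriv_time_test[OF \<eta> T] integral_before_derivative[OF i(2) \<eta>]
      integral_before_derivative[OF i(4) \<eta>] integral_before_before_derivative[OF i(2) i(4) \<eta>])
  also have "\<dots> = - (LINT t|time_measure T. c * (G t * \<eta> t) + e * (F t * \<eta> t)
      + before T F t * (G t * \<eta> t) + before T G t * (F t * \<eta> t))"
    using iF iG integrable_before_mult[OF i(2) iG] integrable_before_mult[OF i(4) iF] by simp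
  also have "\<dots> = - (LINT t|time_measure T. (F t * g t + f t * G t) * \<eta> t)"
  proof (rule arg_cong[where f=uminus], rule integral_cong_AE)
    show "AE t in time_measure T. c * (G t * \<eta> t) + e * (F t * \<eta> t)
      + before T F t * (G t * \<eta> t) + before T G t * (F t * \<eta> t) = (F t * g t + f t * G t) * \<eta> t"
      using c e by eventually_elim (simp add: algebra_simps)
  qed measurable
  finally show ?thesis .
qed

section \<open>Space-time integrals\<close>

text \<open>For \<open>r \<le> \<alpha>\<close> the first summand suffices; otherwise a factor
  \<open>r / \<alpha>\<close> above 1 may be inserted. With \<open>\<alpha>\<close> the cubic norm
  of a slice, integration recovers Hoelder's inequality up to the factor 2.\<close>

lemma scaled_power_bounds:
  fixes r \<alpha> :: real
  assumes "0 \<le> r" "1 \<le> \<alpha>"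
  shows "r \<le> \<alpha> + r ^ 3 / \<alpha> ^ 2" "r ^ 2 \<le> \<alpha> ^ 2 + r ^ 3 / \<alpha>"
proof -
  have a: "0 < \<alpha>" using assms by simp
  show "r \<le> \<alpha> + r ^ 3 / \<alpha> ^ 2"
  proof (cases "r \<le> \<alpha>")
    case False
    then have "r * \<alpha> ^ 2 \<le> r * r ^ 2" using assms by (intro mult_left_mono power_mono) auto
    also have "\<dots> = r ^ 3" by (simp add: power2_eq_square power3_eq_cube)
    finally have "r \<le> r ^ 3 / \<alpha> ^ 2" using a by (simp add: pos_le_divide_eq)
    with a show ?thesis by linarith
  next
    case True
    moreover have "0 \<le> r ^ 3 / \<alpha> ^ 2" using assms by simp
    ultimately show ?thesis by linarith
  qed
  show "r ^ 2 \<le> \<alpha> ^ 2 + r ^ 3 / \<alpha>"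
  proof (cases "r \<le> \<alpha>")
    case False
    then have "r ^ 2 * \<alpha> \<le> r ^ 2 * r" using assms by (intro mult_left_mono) auto
    also have "\<dots> = r ^ 3" by (simp add: power2_eq_square power3_eq_cube)
    finally have "r ^ 2 \<le> r ^ 3 / \<alpha>" using a by (simp add: pos_le_divide_eq)
    moreover have "0 \<le> \<alpha> ^ 2" by simp
    ultimately show ?thesis by linarith
  next
    case True
    then have "r ^ 2 \<le> \<alpha> ^ 2" using assms by (intro power_mono) auto
    moreover have "0 \<le> r ^ 3 / \<alpha>" using assms by simp
    ultimately show ?thesis by linarith
  qed
qed

definition cyl_measure :: "real \<Rightarrow> ((real^'d) \<times> real) measure" where
  "cyl_measure T = cell_measure \<Otimes>\<^sub>M time_measure T"

interpretation cell_time: pair_sigma_finite "cell_measure :: (real^'d) measure" "time_measure T" for T ..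

lemma sets_cyl_measure [measurable_cong]: "sets (cyl_measure T) = sets (borel \<Otimes>\<^sub>M borel)"
  unfolding cyl_measure_def by (rule sets_pair_measure_cong) (simp_all add: sets_cell_measure sets_time_measure)

lemma space_cyl_measure [simp]: "space (cyl_measure T) = UNIV"
  by (simp add: cyl_measure_def space_pair_measure)

lemma cyl_measurable_iff:
  "f \<in> borel_measurable (cyl_measure T) \<longleftrightarrow> f \<in> borel_measurable (borel \<Otimes>\<^sub>M borel)"
  using measurable_cong_sets[OF sets_cyl_measure refl, of T borel] by blast

text \<open>Connects the product measure, where Fubini operates, with the integrals over
  \<open>cylinder T\<close> in which distributions are defined.\<close>

lemma cyl_measure_eq: "cyl_measure T = density lborel (indicator (cylinder T))"
proof -
  have "cyl_measure T = density (lborel \<Otimes>\<^sub>M lborel) (\<lambda>(x, y). indicator unit_cell x * indicator {0<..<T} y)"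
    unfolding cyl_measure_def cell_measure_def time_measure_def
    by (rule pair_measure_density)
      (auto simp: lborel.sigma_finite_measure_axioms time.sigma_finite_measure_axioms[unfolded time_measure_def])
  also have "(\<lambda>(x, y). indicator unit_cell x * indicator {0<..<T} y :: ennreal) = indicator (cylinder T)"
    by (auto simp: indicator_def cylinder_def fun_eq_iff)
  finally show ?thesis by (simp add: lborel_prod)
qed

lemma cylinder_sets [measurable]: "(cylinder T :: ((real^'d) \<times> real) set) \<in> sets borel"
proof -
  have "(cylinder T :: ((real^'d) \<times> real) set) \<in> sets (borel \<Otimes>\<^sub>M borel)" unfolding cylinder_def by measurable
  then show ?thesis by (simp only: borel_prod)
qed

lemma cyl_integral_eq:
  fixes f :: "(real^'d) \<times> real \<Rightarrow> real"
  assumes [measurable]: "f \<in> borel_measurable borel"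
  shows "(LINT z:cylinder T|lebesgue. f z) = (LINT z|cyl_measure T. f z)"
proof -
  have "(LINT z:cylinder T|lebesgue. f z) = (LINT z|lborel. indicator (cylinder T) z *\<^sub>R f z)"
    unfolding set_lebesgue_integral_def by (rule integral_completion) measurable
  also have "\<dots> = (LINT z|density lborel (\<lambda>z. ennreal (indicator (cylinder T) z)). f z)"
    by (rule integral_density[symmetric]) auto
  finally show ?thesis by (simp add: cyl_measure_eq ennreal_indicator)
qed

interpretation cyl: finite_measure "cyl_measure T :: ((real^'d) \<times> real) measure" for T
proof
  have "emeasure (cyl_measure T :: ((real^'d) \<times> real) measure) UNIV
     = emeasure (cell_measure :: (real^'d) measure) UNIV * emeasure (time_measure T) UNIV"
    unfolding cyl_measure_def UNIV_Times_UNIV[symmetric]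
    by (rule time.emeasure_pair_measure_Times) auto
  also have "\<dots> \<noteq> \<infinity>"
    using time.emeasure_finite[of T UNIV] by (simp add: prob_space_cell)
  finally show "emeasure (cyl_measure T :: ((real^'d) \<times> real) measure) (space (cyl_measure T)) \<noteq> \<infinity>"
    by simp
qed

lemma cyl_integral_snd:
  fixes f :: "(real^'d) \<times> real \<Rightarrow> real"
  assumes "integrable (cyl_measure T) f"
  shows "(LINT z|cyl_measure T. f z) = (LINT t|time_measure T. LINT x|cell_measure. f (x, t))"
    and "integrable (time_measure T) (\<lambda>t. LINT x|cell_measure. f (x, t))"
  using cell_time.integral_snd[of T "\<lambda>x t. f (x, t)"] cell_time.integrable_snd[of T "\<lambda>x t. f (x, t)"] assms
  by (simp_all add: cyl_measure_def)

lemma cyl_integral_fst: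
  fixes f :: "(real^'d) \<times> real \<Rightarrow> real"
  assumes "integrable (cyl_measure T) f"
  shows "(LINT z|cyl_measure T. f z) = (LINT x|cell_measure. LINT t|time_measure T. f (x, t))"
    and "integrable cell_measure (\<lambda>x. LINT t|time_measure T. f (x, t))"
  using cell_time.integral_fst[of T "\<lambda>x t. f (x, t)"] cell_time.integrable_fst[of T "\<lambda>x t. f (x, t)"] assms
  by (simp_all add: cyl_measure_def)

section \<open>Separated test functions and the Laplacian\<close>

lemma pd_time_eqI:
  assumes "((\<lambda>s. f (x, s)) has_vector_derivative D) (at t)"
  shows "pd_time f (x, t) = D"
  using assms by (simp add: pd_time_def vector_derivative_at)

lemma pd_space_eqI:
  assumes "((\<lambda>s. f (x + s *\<^sub>R axis i 1, t)) has_vector_derivative D) (at 0)"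
  shows "pd_space i f (x, t) = D"
  using assms by (simp add: pd_space_def vector_derivative_at)

lemma product_test_function:
  fixes a :: "real^'d \<Rightarrow> real"
  assumes a: "smooth_periodic a" and \<eta>: "time_test T \<eta>"
  shows "test_function T (\<lambda>(x, t). a x * \<eta> t)"
    and "pd_time (\<lambda>(x, t). a x * \<eta> t) = (\<lambda>(x, t). a x * dd 1 \<eta> t)"
    and "pd_space i (\<lambda>(x, t). a x * \<eta> t) = (\<lambda>(x, t). dd (axis i 1) a x * \<eta> t)"
proof -
  have "C_infinity (\<lambda>z. a (fst z + 0) * \<eta> (snd z + 0))"
    by (intro C_infinity_mult C_infinity_affine smooth_periodic_C[OF a] time_test_C[OF \<eta>] bounded_linear_fst bounded_linear_snd)
  then have "C_infinity (\<lambda>(x, t). a x * \<eta> t)" by (simp add: case_prod_beta')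
  moreover have "periodic_in_space T (\<lambda>(x, t). a x * \<eta> t)"
    using smooth_periodic_periodic[OF a] by (auto simp: periodic_in_space_def lattice_periodic_def lattice_def)
  ultimately show "test_function T (\<lambda>(x, t). a x * \<eta> t)"
    using \<eta> unfolding test_function_def time_test_def by auto
  show "pd_time (\<lambda>(x, t). a x * \<eta> t) = (\<lambda>(x, t). a x * dd 1 \<eta> t)"
  proof (rule ext, clarify)
    fix x t
    show "pd_time (\<lambda>(x, t). a x * \<eta> t) (x, t) = a x * dd 1 \<eta> t"
      using DERIV_cmult[OF C_infinity_deriv1[OF time_test_C[OF \<eta>]], of "a x" t]
      by (intro pd_time_eqI) (simp add: has_real_derivative_iff_has_vector_derivative)
  qed
  show "pd_space i (\<lambda>(x, t). a x * \<eta> t) = (\<lambda>(x, t). dd (axis i 1) a x * \<eta> t)"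
  proof (rule ext, clarify)
    fix x t
    show "pd_space i (\<lambda>(x, t). a x * \<eta> t) (x, t) = dd (axis i 1) a x * \<eta> t"
      using DERIV_cmult_right[OF C_infinity_line_real[OF smooth_periodic_C[OF a], of x "axis i 1" 0], of "\<eta> t"]
      by (intro pd_space_eqI) (simp add: has_real_derivative_iff_has_vector_derivative)
  qed
qed



lemma sum_axis_component [simp]: "(\<Sum>m\<in>UNIV. c m *\<^sub>R axis m (1 :: real)) $ k = c k"
proof -
  have "(\<Sum>m\<in>UNIV. c m *\<^sub>R axis m (1 :: real)) $ k = (\<Sum>m\<in>UNIV. if m = k then c m else 0)"
    by (simp add: axis_def if_distrib cong: if_cong)
  then show ?thesis by simp
qed

lemma vector_product_test_function:
  fixes B :: "'d \<Rightarrow> real^'d \<Rightarrow> real"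
  assumes B: "\<And>m. smooth_periodic (B m)" and \<eta>: "time_test T \<eta>"
  defines "\<psi> \<equiv> \<lambda>(x, t). (\<Sum>m\<in>UNIV. (B m x * \<eta> t) *\<^sub>R axis m 1) :: real^'d"
  shows "test_function T \<psi>"
    and "pd_time \<psi> (x, t) = (\<Sum>m\<in>UNIV. (B m x * dd 1 \<eta> t) *\<^sub>R axis m 1)"
    and "pd_space i \<psi> (x, t) = (\<Sum>m\<in>UNIV. (dd (axis i 1) (B m) x * \<eta> t) *\<^sub>R axis m 1)"
proof -
  have "C_infinity (\<lambda>z. (\<Sum>m\<in>UNIV. (B m (fst z + 0) * \<eta> (snd z + 0)) *\<^sub>R (axis m 1 :: real^'d)))"
    by (intro C_infinity_sum C_infinity_scaleR C_infinity_const C_infinity_mult C_infinity_affine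
        smooth_periodic_C[OF B] time_test_C[OF \<eta>] bounded_linear_fst bounded_linear_snd)
  then have "C_infinity \<psi>" by (simp add: \<psi>_def case_prod_beta')
  moreover have "periodic_in_space T \<psi>"
    using smooth_periodic_periodic[OF B]
    by (auto simp: \<psi>_def periodic_in_space_def lattice_periodic_def lattice_def)
  moreover have "\<exists>a b. 0 < a \<and> b < T \<and> (\<forall>x t. t \<notin> {a..b} \<longrightarrow> \<psi> (x, t) = 0)"
  proof -
    obtain a b where "0 < a" "b < T" "\<forall>t. t \<notin> {a..b} \<longrightarrow> \<eta> t = 0" using \<eta> by (auto simp: time_test_def)
    then show ?thesis by (intro exI conjI) (auto simp: \<psi>_def)
  qed
  ultimately show "test_function T \<psi>" by (simp add: test_function_def)
  show "pd_time \<psi> (x, t) = (\<Sum>m\<in>UNIV. (B m x * dd 1 \<eta> t) *\<^sub>R axis m 1)"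
  proof (rule pd_time_eqI)
    have "((\<lambda>s. B m x * \<eta> s) has_real_derivative B m x * dd 1 \<eta> t) (at t)" for m
      by (intro DERIV_cmult C_infinity_deriv1 time_test_C[OF \<eta>])
    then have "((\<lambda>s. (B m x * \<eta> s) *\<^sub>R axis m 1) has_vector_derivative (B m x * dd 1 \<eta> t) *\<^sub>R axis m (1 :: real)) (at t)" for m
      unfolding has_real_derivative_iff_has_vector_derivative
      by (rule bounded_linear.has_vector_derivative[OF bounded_linear_scaleR_left])
    then show "((\<lambda>s. \<psi> (x, s)) has_vector_derivative (\<Sum>m\<in>UNIV. (B m x * dd 1 \<eta> t) *\<^sub>R axis m 1)) (at t)"
      unfolding \<psi>_def by (auto intro!: has_vector_derivative_sum)
  qed
  show "pd_space i \<psi> (x, t) = (\<Sum>m\<in>UNIV. (dd (axis i 1) (B m) x * \<eta> t) *\<^sub>R axis m 1)"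
  proof (rule pd_space_eqI)
    have "((\<lambda>s. B m (x + s *\<^sub>R axis i 1) * \<eta> t) has_real_derivative dd (axis i 1) (B m) x * \<eta> t) (at 0)" for m
      using DERIV_cmult_right[OF C_infinity_line_real[OF smooth_periodic_C[OF B], where x=x and v="axis i 1" and s=0], where c="\<eta> t"] by simp
    then have "((\<lambda>s. (B m (x + s *\<^sub>R axis i 1) * \<eta> t) *\<^sub>R axis m 1) has_vector_derivative
        (dd (axis i 1) (B m) x * \<eta> t) *\<^sub>R axis m (1 :: real)) (at 0)" for m
      unfolding has_real_derivative_iff_has_vector_derivative
      by (rule bounded_linear.has_vector_derivative[OF bounded_linear_scaleR_left])
    then show "((\<lambda>s. \<psi> (x + s *\<^sub>R axis i 1, t)) has_vector_derivative
        (\<Sum>m\<in>UNIV. (dd (axis i 1) (B m) x * \<eta> t) *\<^sub>R axis m 1)) (at 0)"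
      unfolding \<psi>_def by (auto intro!: has_vector_derivative_sum)
  qed
qed

lemma dd_sum:
  assumes "\<And>i. i \<in> I \<Longrightarrow> C_infinity (f i)"
  shows "dd v (\<lambda>x. \<Sum>i\<in>I. f i x) x = (\<Sum>i\<in>I. dd v (f i) x)"
  using has_derivative_imp_eq(1)[OF has_derivative_sum[of I f, OF C_infinity_has_derivative[OF assms]]]
  by simp

lemma dd_diff:
  assumes "C_infinity f" "C_infinity g"
  shows "dd v (\<lambda>x. f x - g x) x = dd v f x - dd v g x"
  using has_derivative_imp_eq(1)[OF has_derivative_diff[OF assms[THEN C_infinity_has_derivative]]]
  by simp

lemma smooth_periodic_diff: "smooth_periodic f \<Longrightarrow> smooth_periodic g \<Longrightarrow> smooth_periodic (\<lambda>x. f x - g x)"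
  and smooth_periodic_sum: "(\<And>i. i \<in> I \<Longrightarrow> smooth_periodic (F i)) \<Longrightarrow> smooth_periodic (\<lambda>x. \<Sum>i\<in>I. F i x)"
  and smooth_periodic_const: "smooth_periodic (\<lambda>x. c)"
  by (auto simp: smooth_periodic_def lattice_periodic_def C_infinity_diff C_infinity_sum)

abbreviation pd :: "'d \<Rightarrow> (real^'d \<Rightarrow> real) \<Rightarrow> real^'d \<Rightarrow> real" where
  "pd i f \<equiv> dd (axis i 1) f"

definition laplacian :: "(real^'d \<Rightarrow> real) \<Rightarrow> real^'d \<Rightarrow> real" where
  "laplacian f x = (\<Sum>m\<in>UNIV. pd m (pd m f) x)"

lemma smooth_periodic_laplacian: "smooth_periodic f \<Longrightarrow> smooth_periodic (laplacian f)"
  unfolding laplacian_def[abs_def] by (intro smooth_periodic_sum smooth_periodic_dd)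

lemma pd_commute: "smooth_periodic f \<Longrightarrow> pd i (pd j f) = pd j (pd i f)"
  by (rule ext) (rule dd_commute[OF smooth_periodic_C])

lemma pd_laplacian:
  assumes f: "smooth_periodic f"
  shows "pd i (laplacian f) = laplacian (pd i f)"
proof
  fix x
  have "pd i (laplacian f) x = (\<Sum>m\<in>UNIV. pd i (pd m (pd m f)) x)"
    unfolding laplacian_def[abs_def]
    by (rule dd_sum) (intro smooth_periodic_C smooth_periodic_dd f)
  also have "\<dots> = (\<Sum>m\<in>UNIV. pd m (pd m (pd i f)) x)"
  proof (rule sum.cong, rule refl)
    fix m
    have "pd i (pd m f) = pd m (pd i f)" by (rule pd_commute[OF f])
    then show "pd i (pd m (pd m f)) x = pd m (pd m (pd i f)) x"
      using dd_commute[OF smooth_periodic_C[OF smooth_periodic_dd[OF f, of "axis m 1"]], where v="axis i 1" and w="axis m 1" and x=x] by simp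
  qed
  finally show "pd i (laplacian f) x = laplacian (pd i f) x" by (simp add: laplacian_def)
qed


text \<open>Writing \<open>\<bar>q\<bar>\<^sup>3\<^sup>/\<^sup>2\<close> as the cube of \<open>sqrt \<bar>q\<bar>\<close> puts \<open>u\<close> and \<open>q\<close> on the same footing in
  the polynomial estimates below.\<close>
definition admissible ::
  "real \<Rightarrow> ((real^'d) \<times> real \<Rightarrow> real^'d) \<Rightarrow> ((real^'d) \<times> real \<Rightarrow> real) \<Rightarrow> bool" where
  "admissible T u q \<longleftrightarrow> u \<in> borel_measurable (borel \<Otimes>\<^sub>M borel) \<and> q \<in> borel_measurable (borel \<Otimes>\<^sub>M borel) \<and>
     (\<forall>t. lattice_periodic (\<lambda>x. u (x, t)) \<and> lattice_periodic (\<lambda>x. q (x, t)) \<and>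
       integrable cell_measure (\<lambda>x. norm (u (x, t)) ^ 3) \<and> integrable cell_measure (\<lambda>x. sqrt \<bar>q (x, t)\<bar> ^ 3)) \<and>
     integrable (cyl_measure T) (\<lambda>z. norm (u z) ^ 3) \<and> integrable (cyl_measure T) (\<lambda>z. sqrt \<bar>q z\<bar> ^ 3)"

text \<open>Works with a representative whose cubic integrals are finite on every time slice, not
  only on almost every one, so that convolutions of the fields are genuine continuous functions of
  \<open>x\<close> at each time.\<close>

locale euler_fields =
  fixes T :: real and \<rho> :: "real^'d \<Rightarrow> real"
    and u :: "(real^'d) \<times> real \<Rightarrow> real^'d" and q :: "(real^'d) \<times> real \<Rightarrow> real"
  assumes T_pos: "0 < T" and mollifier: "friedrichs_mollifier \<rho>" and admissible: "admissible T u q"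
    and euler: "weak_euler_solution T u"
    and pressure: "\<And>\<phi>. test_function T \<phi> \<Longrightarrow>
        - (\<Sum>i\<in>UNIV. dist_space i (dist_space i (regular_dist T q)) \<phi>) =
        (\<Sum>i\<in>UNIV. \<Sum>j\<in>UNIV.
           dist_space i (dist_space j (regular_dist T (\<lambda>z. tensor (u z) (u z) $ i $ j))) \<phi>)"
begin

lemma u_measurable [measurable]: "u \<in> borel_measurable (borel \<Otimes>\<^sub>M borel)"
  and q_measurable [measurable]: "q \<in> borel_measurable (borel \<Otimes>\<^sub>M borel)"
  using admissible by (auto simp: admissible_def)

lemma u_component_measurable [measurable]: "(\<lambda>z. u z $ i) \<in> borel_measurable (borel \<Otimes>\<^sub>M borel)"
  by (rule measurable_compose[OF u_measurable])
    (intro borel_measurable_continuous_onI continuous_on_component continuous_on_id)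

text \<open>The momentum flux tensor u \<otimes> u + q I.\<close>

definition S :: "'d \<Rightarrow> 'd \<Rightarrow> (real^'d) \<times> real \<Rightarrow> real" where
  "S i j z = u z $ i * u z $ j + (if i = j then q z else 0)"

lemma S_measurable [measurable]: "S i j \<in> borel_measurable (borel \<Otimes>\<^sub>M borel)"
  unfolding S_def[abs_def] by measurable

text \<open>One density that controls both integrability assumptions, on \<open>u\<close> and on
  \<open>q\<close>; every pointwise bound on the fields is expressed through it.\<close>

definition \<Gamma> :: "(real^'d) \<times> real \<Rightarrow> real" where
  "\<Gamma> z = norm (u z) ^ 3 + sqrt \<bar>q z\<bar> ^ 3"

lemma \<Gamma>_nonneg: "0 \<le> \<Gamma> z" by (simp add: \<Gamma>_def)

lemma \<Gamma>_integrable: "integrable (cyl_measure T) \<Gamma>"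
  and \<Gamma>_section_integrable: "integrable cell_measure (\<lambda>x. \<Gamma> (x, t))"
  using admissible unfolding \<Gamma>_def[abs_def] admissible_def by auto

lemma u_le: "\<bar>u z $ i\<bar> \<le> norm (u z)"
  by (rule component_le_norm_cart)

lemma field_bounds:
  assumes "1 \<le> \<alpha>"
  shows "norm (u z) \<le> \<alpha> + \<Gamma> z / \<alpha> ^ 2" "\<bar>u z $ i\<bar> \<le> \<alpha> + \<Gamma> z / \<alpha> ^ 2"
    and "\<bar>u z $ i * u z $ j\<bar> \<le> \<alpha> ^ 2 + \<Gamma> z / \<alpha>"
    and "\<bar>q z\<bar> \<le> \<alpha> ^ 2 + \<Gamma> z / \<alpha>"
    and "\<bar>S i j z\<bar> \<le> 2 * (\<alpha> ^ 2 + \<Gamma> z / \<alpha>)"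
proof -
  have a: "0 < \<alpha>" using assms by simp
  have "norm (u z) ^ 3 / \<alpha> ^ 2 \<le> \<Gamma> z / \<alpha> ^ 2" using a by (intro divide_right_mono) (auto simp: \<Gamma>_def)
  with scaled_power_bounds(1)[of "norm (u z)" \<alpha>] assms
  show N: "norm (u z) \<le> \<alpha> + \<Gamma> z / \<alpha> ^ 2" by simp
  with u_le[of z i] show "\<bar>u z $ i\<bar> \<le> \<alpha> + \<Gamma> z / \<alpha> ^ 2" by linarith
  have "\<bar>u z $ i * u z $ j\<bar> \<le> norm (u z) ^ 2"
    unfolding abs_mult power2_eq_square by (intro mult_mono u_le) auto
  also have "\<dots> \<le> \<alpha> ^ 2 + norm (u z) ^ 3 / \<alpha>" using assms by (intro scaled_power_bounds) auto
  also have "\<dots> \<le> \<alpha> ^ 2 + \<Gamma> z / \<alpha>" using a by (intro add_left_mono divide_right_mono) (auto simp: \<Gamma>_def)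
  finally show uu: "\<bar>u z $ i * u z $ j\<bar> \<le> \<alpha> ^ 2 + \<Gamma> z / \<alpha>" .
  have "\<bar>q z\<bar> = sqrt \<bar>q z\<bar> ^ 2" by simp
  also have "\<dots> \<le> \<alpha> ^ 2 + sqrt \<bar>q z\<bar> ^ 3 / \<alpha>" using assms by (intro scaled_power_bounds) auto
  also have "\<dots> \<le> \<alpha> ^ 2 + \<Gamma> z / \<alpha>" using a by (intro add_left_mono divide_right_mono) (auto simp: \<Gamma>_def)
  finally show q: "\<bar>q z\<bar> \<le> \<alpha> ^ 2 + \<Gamma> z / \<alpha>" .
  have "\<bar>S i j z\<bar> \<le> \<bar>u z $ i * u z $ j\<bar> + \<bar>if i = j then q z else 0\<bar>"
    unfolding S_def by (rule abs_triangle_ineq)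
  also have "\<dots> \<le> \<bar>u z $ i * u z $ j\<bar> + \<bar>q z\<bar>" by simp
  finally have "\<bar>S i j z\<bar> \<le> \<bar>u z $ i * u z $ j\<bar> + \<bar>q z\<bar>" .
  with uu q show "\<bar>S i j z\<bar> \<le> 2 * (\<alpha> ^ 2 + \<Gamma> z / \<alpha>)" by simp
qed

lemma cyl_dominated:
  assumes "f \<in> borel_measurable (borel \<Otimes>\<^sub>M borel)" "\<And>z. \<bar>f z\<bar> \<le> C * (1 + \<Gamma> z)"
  shows "integrable (cyl_measure T) (f :: (real^'d) \<times> real \<Rightarrow> real)"
proof (rule Bochner_Integration.integrable_bound)
  show "integrable (cyl_measure T) (\<lambda>z. C * (1 + \<Gamma> z))" using \<Gamma>_integrable by simp
  show "f \<in> borel_measurable (cyl_measure T)" using assms by (simp add: cyl_measurable_iff)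
  show "AE z in cyl_measure T. norm (f z) \<le> norm (C * (1 + \<Gamma> z))"
  proof (rule AE_I2)
    fix z show "norm (f z) \<le> norm (C * (1 + \<Gamma> z))" using assms(2)[of z] by simp
  qed
qed

lemma section_dominated:
  assumes "f \<in> borel_measurable (borel \<Otimes>\<^sub>M borel)" "\<And>z. \<bar>f z\<bar> \<le> C * (1 + \<Gamma> z)"
  shows "integrable cell_measure (\<lambda>x. f (x, t) :: real)"
proof (rule Bochner_Integration.integrable_bound)
  show "integrable cell_measure (\<lambda>x. C * (1 + \<Gamma> (x, t)))" using \<Gamma>_section_integrable by simp
  have [measurable]: "f \<in> borel_measurable (borel \<Otimes>\<^sub>M borel)" by fact
  show "(\<lambda>x. f (x, t)) \<in> borel_measurable cell_measure" by measurable
  show "AE x in cell_measure. norm (f (x, t)) \<le> norm (C * (1 + \<Gamma> (x, t)))"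
  proof (rule AE_I2)
    fix x show "norm (f (x, t)) \<le> norm (C * (1 + \<Gamma> (x, t)))" using assms(2)[of "(x, t)"] by simp
  qed
qed

lemma field_integrable:
  shows "integrable (cyl_measure T) (\<lambda>z. u z $ i)" "integrable (cyl_measure T) (\<lambda>z. u z $ i * u z $ j)"
    "integrable (cyl_measure T) q" "integrable (cyl_measure T) (S i j)"
  using field_bounds[OF order_refl]
  by (auto intro!: cyl_dominated[of _ 1] cyl_dominated[of "S i j" 2])

lemma section_integrable:
  shows "integrable cell_measure (\<lambda>x. u (x, t) $ i)" "integrable cell_measure (\<lambda>x. u (x, t) $ i * u (x, t) $ j)"
    "integrable cell_measure (\<lambda>x. q (x, t))" "integrable cell_measure (\<lambda>x. S i j (x, t))"
  using field_bounds[OF order_refl]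
    section_dominated[of "\<lambda>z. u z $ i" 1 t] section_dominated[of "\<lambda>z. u z $ i * u z $ j" 1 t]
    section_dominated[of q 1 t] section_dominated[of "S i j" 2 t]
  by auto

end

section \<open>The momentum equation for all test fields\<close>

text \<open>Walk from 0 to \<open>x\<close> one coordinate at a time.\<close>

lemma C1_periodic_zero_gradient:
  assumes f: "C1_periodic f f'" and zero: "\<And>i x. f' i x = 0"
  shows "f x = f 0"
proof -
  have step: "f (w + c *\<^sub>R axis j 1) = f w" for w c j
  proof -
    have "\<forall>s. ((\<lambda>s. f (w + s *\<^sub>R axis j 1)) has_real_derivative 0) (at s)"
      using C1_periodicD(5)[OF f, of w j] by (simp add: zero)
    from DERIV_isconst_all[OF this, of c 0] show ?thesis by simp
  qed
  have "f (0 + (\<Sum>i\<in>I. (x $ i) *\<^sub>R axis i 1)) = f 0" if "finite I" for I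
    using that
  proof (induction I rule: finite_induct)
    case (insert j I)
    then show ?case using step[of "0 + (\<Sum>i\<in>I. (x $ i) *\<^sub>R axis i 1)" "x $ j" j]
      by (simp add: add.commute)
  qed simp
  from this[of UNIV] have "f (\<Sum>i\<in>UNIV. (x $ i) *\<^sub>R axis i 1) = f 0" by simp
  moreover have "(\<Sum>i\<in>UNIV. (x $ i) *\<^sub>R axis i 1) = x"
    unfolding vec_eq_iff by (rule allI) (rule sum_axis_component)
  ultimately show ?thesis by simp
qed

lemma cell_integral_square_zero:
  assumes g: "continuous_on UNIV g" "lattice_periodic g" and zero: "(LINT x|cell_measure. g x * g x) = 0"
  shows "g x = (0 :: real)"
proof -
  have [measurable]: "g \<in> borel_measurable borel" using g(1) by (rule borel_measurable_continuous_onI)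
  have i: "integrable cell_measure (\<lambda>x. g x * g x)"
    using g by (intro cell_integrable_periodic continuous_on_mult) (auto simp: lattice_periodic_def)
  have eq: "cell_measure = density lborel (\<lambda>x. ennreal (indicator unit_cell x))"
    by (simp add: cell_measure_def ennreal_indicator)
  have "(LINT x:unit_cell|lborel. g x * g x) = 0"
    using zero unfolding eq set_lebesgue_integral_def by (subst (asm) integral_density) auto
  moreover have "set_integrable lborel unit_cell (\<lambda>x. g x * g x)"
    using i unfolding eq set_integrable_def by (subst (asm) integrable_density) auto
  ultimately have "integral (cbox 0 1) (\<lambda>x. g x * g x) = 0"
    by (simp add: set_borel_integral_eq_integral unit_cell_def)
  moreover have "box (0 :: real^'a) 1 \<noteq> {}"
    by (auto simp: box_ne_empty Basis_vec_def inner_axis)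
  moreover have "continuous_on (cbox 0 1) (\<lambda>x. g x * g x)"
    using g(1) by (intro continuous_intros) (auto intro: continuous_on_subset)
  ultimately have z: "g x = 0" if "x \<in> unit_cell" for x
    using integral_cbox_eq_0_iff[of 0 1 "\<lambda>x. g x * g x"] that by (auto simp: unit_cell_def)
  show ?thesis
    using z[OF floor_vec_in_unit_cell[OF floor_frac_vec]] lattice_periodic_frac[OF g(2)] by metis
qed

lemma smooth_periodic_reflect:
  assumes K: "smooth_periodic K"
  shows "smooth_periodic (\<lambda>y. K (x - y))" and "dd v (\<lambda>y. K (x - y)) y = - dd v K (x - y)"
proof -
  have bl: "bounded_linear (\<lambda>y :: real^'a. - y)" by (intro bounded_linear_minus bounded_linear_ident)
  have "C_infinity (\<lambda>y. K (- y + x))" by (intro C_infinity_affine[OF smooth_periodic_C[OF K] bl])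
  moreover have "lattice_periodic (\<lambda>y. K (x - y))"
    unfolding lattice_periodic_def
  proof (intro allI ballI)
    fix y k :: "real^'a" assume "k \<in> lattice"
    then show "K (x - (y + k)) = K (x - y)"
      using lattice_periodicD[OF smooth_periodic_periodic[OF K], of "- k" "x - y"] by (simp add: lattice_uminus algebra_simps)
  qed
  ultimately show "smooth_periodic (\<lambda>y. K (x - y))" by (simp add: smooth_periodic_def)
  have "dd v (\<lambda>y. K (- y + x)) y = dd (- v) K (- y + x)"
    by (rule dd_affine[OF smooth_periodic_C[OF K] bl])
  also have "\<dots> = - dd v K (- y + x)"
    using linear_frechet_derivative[OF C_infinity_differentiable[OF smooth_periodic_C[OF K]]] linear_neg by blast
  finally show "dd v (\<lambda>y. K (x - y)) y = - dd v K (x - y)" by simp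
qed

lemma conv_sum:
  assumes "\<And>m. m \<in> I \<Longrightarrow> smooth_periodic (K m)" "integrable cell_measure c"
  shows "conv (\<lambda>x. \<Sum>m\<in>I. K m x) c z = (\<Sum>m\<in>I. conv (K m) c z)"
proof -
  have "(\<Sum>m\<in>I. conv (K m) c z) = (LINT y|cell_measure. (\<Sum>m\<in>I. K m (z - y) * c y))"
    unfolding conv_def using conv_integrable[OF assms(1) assms(2)]
    by (subst Bochner_Integration.integral_sum) auto
  then show ?thesis by (simp add: conv_def sum_distrib_right)
qed

lemma integral_conv:
  assumes K: "smooth_periodic K" and c: "integrable cell_measure c"
  shows "(LINT x|cell_measure. conv K c x) = (LINT x|cell_measure. K x) * (LINT y|cell_measure. c y)"
proof -
  have "(LINT x|cell_measure. conv K c x) = (LINT y|cell_measure. c y * (LINT x|cell_measure. K (x - y)))"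
    using integral_conv_mult[OF K c, of "\<lambda>_. 1"] by (simp add: lattice_periodic_def)
  also have "(\<lambda>y. LINT x|cell_measure. K (x - y)) = (\<lambda>y. LINT x|cell_measure. K x)"
    using integral_cell_shift[OF smooth_periodic_measurable[OF K] smooth_periodic_periodic[OF K], of "- y" for y] by simp
  finally show ?thesis by simp
qed

context euler_fields
begin

definition pairing :: "((real^'d) \<times> real \<Rightarrow> real) \<Rightarrow> (real^'d \<Rightarrow> real) \<Rightarrow> (real \<Rightarrow> real) \<Rightarrow> real" where
  "pairing f b \<theta> = (LINT z|cyl_measure T. f z * (b (fst z) * \<theta> (snd z)))"

lemma pairing_integrable:
  assumes f: "integrable (cyl_measure T) f" and b: "smooth_periodic b" and \<theta>: "time_test T \<theta>"
  shows "integrable (cyl_measure T) (\<lambda>z. f z * (b (fst z) * \<theta> (snd z)))"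
proof -
  obtain B where B: "0 \<le> B" "\<And>x. \<bar>b x\<bar> \<le> B" by (rule smooth_periodic_bounded[OF b]) (rule that)
  obtain C where C: "0 \<le> C" "\<And>x. \<bar>\<theta> x\<bar> \<le> C" by (rule time_test_bounded[OF \<theta>]) (rule that)
  have [measurable]: "b \<in> borel_measurable borel" "\<theta> \<in> borel_measurable borel"
    using smooth_periodic_measurable[OF b] time_test_measurable[OF \<theta>] by auto
  have "integrable (cyl_measure T) (\<lambda>z. (b (fst z) * \<theta> (snd z)) * f z)"
    by (rule integrable_bounded_mult[OF f, where B="B * C"])
      (use B C in \<open>auto simp: abs_mult cyl_measurable_iff intro!: mult_mono\<close>)
  then show ?thesis by (simp add: mult.commute)
qed

lemma pairing_diff:
  assumes "integrable (cyl_measure T) f" "smooth_periodic a" "smooth_periodic b" "time_test T \<theta>"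
  shows "pairing f (\<lambda>x. a x - b x) \<theta> = pairing f a \<theta> - pairing f b \<theta>"
  unfolding pairing_def using assms
  by (simp add: left_diff_distrib right_diff_distrib pairing_integrable)

lemma pairing_sum:
  assumes "integrable (cyl_measure T) f" "\<And>i. i \<in> I \<Longrightarrow> smooth_periodic (a i)" "time_test T \<theta>"
  shows "pairing f (\<lambda>x. \<Sum>i\<in>I. a i x) \<theta> = (\<Sum>i\<in>I. pairing f (a i) \<theta>)"
  unfolding pairing_def using assms
  by (simp add: sum_distrib_left sum_distrib_right pairing_integrable)

lemma regular_dist_product:
  assumes f: "f \<in> borel_measurable (borel \<Otimes>\<^sub>M borel)" and b: "smooth_periodic b" and \<theta>: "time_test T \<theta>"
  shows "regular_dist T f (\<lambda>(x, t). b x * \<theta> t) = pairing f b \<theta>"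
proof -
  have [measurable]: "f \<in> borel_measurable (borel \<Otimes>\<^sub>M borel)" "b \<in> borel_measurable borel" "\<theta> \<in> borel_measurable borel"
    using f smooth_periodic_measurable[OF b] time_test_measurable[OF \<theta>] by auto
  have "(\<lambda>z. f z * (case z of (x, t) \<Rightarrow> b x * \<theta> t)) \<in> borel_measurable (borel \<Otimes>\<^sub>M borel)" by measurable
  then have "(\<lambda>z. f z * (case z of (x, t) \<Rightarrow> b x * \<theta> t)) \<in> borel_measurable borel" by (simp only: borel_prod)
  from cyl_integral_eq[OF this, of T] show ?thesis
    by (simp add: regular_dist_def pairing_def case_prod_beta')
qed

lemma weak_divergence_free:
  assumes b: "smooth_periodic b" and \<theta>: "time_test T \<theta>"
  shows "(\<Sum>m\<in>UNIV. pairing (\<lambda>z. u z $ m) (pd m b) \<theta>) = 0"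
proof -
  have "dist_div T u (\<lambda>(x, t). b x * \<theta> t) = 0"
    using euler product_test_function(1)[OF b \<theta>] by (simp add: weak_euler_solution_def)
  then show ?thesis
    by (simp add: dist_div_def dist_space_def product_test_function(3)[OF b \<theta>]
      regular_dist_product[OF u_component_measurable smooth_periodic_dd[OF b] \<theta>] sum_negf)
qed

lemma weak_pressure:
  assumes b: "smooth_periodic b" and \<theta>: "time_test T \<theta>"
  shows "(\<Sum>i\<in>UNIV. \<Sum>m\<in>UNIV. pairing (\<lambda>z. u z $ i * u z $ m) (pd i (pd m b)) \<theta>) = - pairing q (laplacian b) \<theta>"
proof -
  have *: "dist_space i (dist_space m (regular_dist T f)) (\<lambda>(x, t). b x * \<theta> t) = pairing f (pd m (pd i b)) \<theta>"
    if "f \<in> borel_measurable (borel \<Otimes>\<^sub>M borel)" for f i m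
    by (simp add: dist_space_def product_test_function(3)[OF b \<theta>] product_test_function(3)[OF smooth_periodic_dd[OF b] \<theta>]
      regular_dist_product[OF that smooth_periodic_dd[OF smooth_periodic_dd[OF b]] \<theta>])
  have t: "tensor v w $ i $ m = v $ i * w $ m" for v w :: "real^'d" and i m by (simp add: tensor_def)
  have "- (\<Sum>i\<in>UNIV. pairing q (pd i (pd i b)) \<theta>) = (\<Sum>i\<in>UNIV. \<Sum>m\<in>UNIV. pairing (\<lambda>z. u z $ i * u z $ m) (pd m (pd i b)) \<theta>)"
    using pressure[OF product_test_function(1)[OF b \<theta>]] by (simp add: * t)
  also have "\<dots> = (\<Sum>i\<in>UNIV. \<Sum>m\<in>UNIV. pairing (\<lambda>z. u z $ i * u z $ m) (pd i (pd m b)) \<theta>)"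
  proof (intro sum.cong refl)
    fix i m
    have "pd m (pd i b) = pd i (pd m b)" by (rule pd_commute[OF b])
    then show "pairing (\<lambda>z. u z $ i * u z $ m) (pd m (pd i b)) \<theta> = pairing (\<lambda>z. u z $ i * u z $ m) (pd i (pd m b)) \<theta>" by simp
  qed
  finally show ?thesis
    unfolding laplacian_def[abs_def]
    by (simp add: pairing_sum[OF field_integrable(3) smooth_periodic_dd[OF smooth_periodic_dd[OF b]] \<theta>])
qed

lemma weak_momentum_divergence_free:
  assumes B: "\<And>m. smooth_periodic (B m)" and div: "\<And>x. (\<Sum>m\<in>UNIV. pd m (B m) x) = 0" and \<eta>: "time_test T \<eta>"
  shows "(\<Sum>m\<in>UNIV. pairing (\<lambda>z. u z $ m) (B m) (dd 1 \<eta>))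
     + (\<Sum>m\<in>UNIV. \<Sum>i\<in>UNIV. pairing (\<lambda>z. u z $ i * u z $ m) (pd i (B m)) \<eta>) = 0"
proof -
  define \<psi> :: "(real^'d) \<times> real \<Rightarrow> real^'d" where
    "\<psi> = (\<lambda>(x, t). (\<Sum>m\<in>UNIV. (B m x * \<eta> t) *\<^sub>R axis m 1))"
  have V: "test_function T \<psi>"
    "pd_time \<psi> (x, t) = (\<Sum>m\<in>UNIV. (B m x * dd 1 \<eta> t) *\<^sub>R axis m 1)"
    "pd_space i \<psi> (x, t) = (\<Sum>m\<in>UNIV. (pd i (B m) x * \<eta> t) *\<^sub>R axis m 1)" for x t i
    unfolding \<psi>_def by (rule vector_product_test_function[OF B \<eta>])+
  have VC: "pd_time \<psi> (x, t) $ m = B m x * dd 1 \<eta> t" "pd_space i \<psi> (x, t) $ m = pd i (B m) x * \<eta> t" for x t i m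
    unfolding V by (rule sum_axis_component)+
  note d = time_test_dd[OF \<eta>]
  have "divergence \<psi> z = 0" for z
  proof (cases z)
    case (Pair x t)
    have "divergence \<psi> (x, t) = (\<Sum>i\<in>UNIV. pd i (B i) x * \<eta> t)"
      unfolding divergence_def V(3) by (simp only: sum_axis_component)
    then show ?thesis using div[of x] Pair by (simp add: sum_distrib_right[symmetric])
  qed
  then have "(LINT z:cylinder T|lebesgue. u z \<bullet> pd_time \<psi> z + tensor (u z) (u z) \<bullet> gradient \<psi> z) = 0"
    using euler V(1) by (simp add: weak_euler_solution_def)
  moreover have "u z \<bullet> pd_time \<psi> z + tensor (u z) (u z) \<bullet> gradient \<psi> z
     = (\<Sum>m\<in>UNIV. u z $ m * (B m (fst z) * dd 1 \<eta> (snd z)))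
      + (\<Sum>m\<in>UNIV. \<Sum>i\<in>UNIV. (u z $ i * u z $ m) * (pd i (B m) (fst z) * \<eta> (snd z)))" for z
  proof (cases z)
    case (Pair x t)
    have "tensor (u z) (u z) \<bullet> gradient \<psi> z
      = (\<Sum>i\<in>UNIV. \<Sum>m\<in>UNIV. (u z $ i * u z $ m) * (pd i (B m) (fst z) * \<eta> (snd z)))"
      by (simp add: inner_vec_def tensor_def gradient_def VC Pair)
    also have "\<dots> = (\<Sum>m\<in>UNIV. \<Sum>i\<in>UNIV. (u z $ i * u z $ m) * (pd i (B m) (fst z) * \<eta> (snd z)))"
      by (rule sum.swap)
    finally show ?thesis by (simp add: inner_vec_def VC Pair)
  qed
  ultimately have z: "(LINT z:cylinder T|lebesgue. (\<Sum>m\<in>UNIV. u z $ m * (B m (fst z) * dd 1 \<eta> (snd z)))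
      + (\<Sum>m\<in>UNIV. \<Sum>i\<in>UNIV. (u z $ i * u z $ m) * (pd i (B m) (fst z) * \<eta> (snd z)))) = 0"
    by simp
  have [measurable]: "B m \<in> borel_measurable borel" "pd i (B m) \<in> borel_measurable borel" "\<eta> \<in> borel_measurable borel"
    "dd 1 \<eta> \<in> borel_measurable borel" for i m
    by (auto intro: smooth_periodic_measurable smooth_periodic_dd B time_test_measurable \<eta> d)
  have "(\<lambda>z. (\<Sum>m\<in>UNIV. u z $ m * (B m (fst z) * dd 1 \<eta> (snd z)))
      + (\<Sum>m\<in>UNIV. \<Sum>i\<in>UNIV. (u z $ i * u z $ m) * (pd i (B m) (fst z) * \<eta> (snd z)))) \<in> borel_measurable (borel \<Otimes>\<^sub>M borel)"
    by measurable
  then have m: "(\<lambda>z. (\<Sum>m\<in>UNIV. u z $ m * (B m (fst z) * dd 1 \<eta> (snd z)))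
      + (\<Sum>m\<in>UNIV. \<Sum>i\<in>UNIV. (u z $ i * u z $ m) * (pd i (B m) (fst z) * \<eta> (snd z)))) \<in> borel_measurable borel"
    by (simp only: borel_prod)
  have i1: "integrable (cyl_measure T) (\<lambda>z. u z $ m * (B m (fst z) * dd 1 \<eta> (snd z)))" for m
    by (rule pairing_integrable[OF field_integrable(1) B d])
  have i2: "integrable (cyl_measure T) (\<lambda>z. (u z $ i * u z $ m) * (pd i (B m) (fst z) * \<eta> (snd z)))" for m i
    by (rule pairing_integrable[OF field_integrable(2) smooth_periodic_dd[OF B] \<eta>])
  show ?thesis
    using z unfolding cyl_integral_eq[OF m] pairing_def
    by (subst (asm) Bochner_Integration.integral_add) (auto simp: i1 i2 intro!: integrable_sum)
qed

text \<open>The \<open>j\<close>-th momentum equation with pressure, in weak form, tested with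
  \<open>b x * \<eta> t\<close>. No divergence constraint appears, so its vanishing has to be
  proved.\<close>

definition momentum :: "'d \<Rightarrow> (real^'d \<Rightarrow> real) \<Rightarrow> (real \<Rightarrow> real) \<Rightarrow> real" where
  "momentum j b \<eta> = pairing (\<lambda>z. u z $ j) b (dd 1 \<eta>) + (\<Sum>i\<in>UNIV. pairing (S i j) (pd i b) \<eta>)"

lemma pairing_S:
  assumes b: "\<And>i. smooth_periodic (b i)" and \<eta>: "time_test T \<eta>"
  shows "(\<Sum>i\<in>UNIV. pairing (S i j) (b i) \<eta>)
     = (\<Sum>i\<in>UNIV. pairing (\<lambda>z. u z $ i * u z $ j) (b i) \<eta>) + pairing q (b j) \<eta>"
proof -
  have "pairing (S i j) (b i) \<eta> = pairing (\<lambda>z. u z $ i * u z $ j) (b i) \<eta> + (if i = j then pairing q (b j) \<eta> else 0)" for i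
    using pairing_integrable[OF field_integrable(2) b \<eta>, of i j i] pairing_integrable[OF field_integrable(3) b \<eta>, of j]
    by (cases "i = j") (simp_all add: pairing_def S_def distrib_right)
  then show ?thesis by (simp add: sum.distrib)
qed

text \<open>The gradient part of the divergence-free test field drops out of the time term by
  incompressibility of \<open>u\<close>. In the quadratic term the pressure equation turns it into
  \<open>q\<close> paired with the \<open>j\<close>-th derivative of the Laplacian of
  \<open>b\<close>, exactly the pressure part of the flux.\<close>

lemma momentum_laplacian:
  assumes b: "smooth_periodic b" and \<eta>: "time_test T \<eta>"
  shows "momentum j (laplacian b) \<eta> = 0"
proof -
  note L = smooth_periodic_laplacian[OF b]
  note D = smooth_periodic_dd
  note d = time_test_dd[OF \<eta>]
  define B where "B m = (\<lambda>x. (if m = j then laplacian b x else 0) - pd m (pd j b) x)" for m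
  have I: "smooth_periodic (\<lambda>x. if m = j then laplacian b x else 0)" for m
    using L by (cases "m = j") (auto intro: smooth_periodic_const)
  have B: "smooth_periodic (B m)" for m
    unfolding B_def by (intro smooth_periodic_diff I D b)
  have pdBx: "pd i (B m) x = (if m = j then pd i (laplacian b) x else 0) - pd i (pd m (pd j b)) x" for i m x
  proof -
    have "pd i (B m) x = pd i (\<lambda>x. if m = j then laplacian b x else 0) x - pd i (pd m (pd j b)) x"
      unfolding B_def by (intro dd_diff smooth_periodic_C I D b)
    then show ?thesis by (cases "m = j") (auto simp: frechet_derivative_const)
  qed
  have pdB: "pd i (B m) = (\<lambda>x. (if m = j then pd i (laplacian b) x else 0) - pd i (pd m (pd j b)) x)" for i m
    by (rule ext) (rule pdBx)
  have div: "(\<Sum>m\<in>UNIV. pd m (B m) x) = 0" for x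
  proof -
    have "(\<Sum>m\<in>UNIV. pd m (B m) x) = pd j (laplacian b) x - laplacian (pd j b) x"
      by (simp add: pdBx sum_subtractf laplacian_def[of "pd j b"])
    also have "pd j (laplacian b) x = laplacian (pd j b) x" by (rule fun_cong[OF pd_laplacian[OF b]])
    finally show ?thesis by (simp only: diff_self)
  qed
  have I2: "smooth_periodic (\<lambda>x. if m = j then pd i (laplacian b) x else 0)" for m i
    using D[OF L] by (cases "m = j") (auto intro: smooth_periodic_const)
  have p0: "pairing f (\<lambda>x. if m = j then g x else 0) \<theta> = (if m = j then pairing f g \<theta> else 0)" for f g \<theta> m
    by (simp add: pairing_def)
  have one: "(\<Sum>m\<in>UNIV. pairing (\<lambda>z. u z $ m) (B m) (dd 1 \<eta>)) = pairing (\<lambda>z. u z $ j) (laplacian b) (dd 1 \<eta>)"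
  proof -
    have "(\<Sum>m\<in>UNIV. pairing (\<lambda>z. u z $ m) (B m) (dd 1 \<eta>))
      = (\<Sum>m\<in>UNIV. (if m = j then pairing (\<lambda>z. u z $ m) (laplacian b) (dd 1 \<eta>) else 0)
         - pairing (\<lambda>z. u z $ m) (pd m (pd j b)) (dd 1 \<eta>))"
      unfolding B_def by (intro sum.cong refl) (simp add: pairing_diff[OF field_integrable(1) I D[OF D[OF b]] d] p0)
    then show ?thesis using weak_divergence_free[OF D[OF b] d] by (simp add: sum_subtractf)
  qed
  have two: "(\<Sum>m\<in>UNIV. \<Sum>i\<in>UNIV. pairing (\<lambda>z. u z $ i * u z $ m) (pd i (B m)) \<eta>)
    = (\<Sum>i\<in>UNIV. pairing (\<lambda>z. u z $ i * u z $ j) (pd i (laplacian b)) \<eta>) + pairing q (laplacian (pd j b)) \<eta>"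
  proof -
    have "(\<Sum>m\<in>UNIV. \<Sum>i\<in>UNIV. pairing (\<lambda>z. u z $ i * u z $ m) (pd i (B m)) \<eta>)
      = (\<Sum>m\<in>UNIV. \<Sum>i\<in>UNIV. (if m = j then pairing (\<lambda>z. u z $ i * u z $ m) (pd i (laplacian b)) \<eta> else 0)
         - pairing (\<lambda>z. u z $ i * u z $ m) (pd i (pd m (pd j b))) \<eta>)"
      unfolding pdB by (intro sum.cong refl) (simp add: pairing_diff[OF field_integrable(2) I2 D[OF D[OF D[OF b]]] \<eta>] p0)
    also have "\<dots> = (\<Sum>m\<in>UNIV. \<Sum>i\<in>UNIV. (if m = j then pairing (\<lambda>z. u z $ i * u z $ m) (pd i (laplacian b)) \<eta> else 0))
       - (\<Sum>m\<in>UNIV. \<Sum>i\<in>UNIV. pairing (\<lambda>z. u z $ i * u z $ m) (pd i (pd m (pd j b))) \<eta>)"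
      by (simp add: sum_subtractf)
    also have "(\<Sum>m\<in>UNIV. \<Sum>i\<in>UNIV. pairing (\<lambda>z. u z $ i * u z $ m) (pd i (pd m (pd j b))) \<eta>)
       = (\<Sum>i\<in>UNIV. \<Sum>m\<in>UNIV. pairing (\<lambda>z. u z $ i * u z $ m) (pd i (pd m (pd j b))) \<eta>)"
      by (rule sum.swap)
    also have "\<dots> = - pairing q (laplacian (pd j b)) \<eta>" by (rule weak_pressure[OF D[OF b] \<eta>])
    also have "(\<Sum>m\<in>UNIV. \<Sum>i\<in>UNIV. (if m = j then pairing (\<lambda>z. u z $ i * u z $ m) (pd i (laplacian b)) \<eta> else 0))
       = (\<Sum>m\<in>UNIV. if m = j then (\<Sum>i\<in>UNIV. pairing (\<lambda>z. u z $ i * u z $ m) (pd i (laplacian b)) \<eta>) else 0)"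
      by (intro sum.cong refl) auto
    finally show ?thesis by simp
  qed
  have "momentum j (laplacian b) \<eta> = pairing (\<lambda>z. u z $ j) (laplacian b) (dd 1 \<eta>)
    + ((\<Sum>i\<in>UNIV. pairing (\<lambda>z. u z $ i * u z $ j) (pd i (laplacian b)) \<eta>) + pairing q (pd j (laplacian b)) \<eta>)"
    unfolding momentum_def by (subst pairing_S[OF D[OF L] \<eta>]) simp
  then show ?thesis
    using weak_momentum_divergence_free[OF B div \<eta>] unfolding one two pd_laplacian[OF b] by simp
qed

text \<open>The constant field \<open>e_j\<close> is divergence free and has no gradient. This fixes
  the mean that harmonicity leaves open.\<close>

lemma momentum_const:
  assumes \<eta>: "time_test T \<eta>"
  shows "pairing (\<lambda>z. u z $ j) (\<lambda>_. 1) (dd 1 \<eta>) = 0"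
proof -
  define B :: "'d \<Rightarrow> real^'d \<Rightarrow> real" where "B m = (\<lambda>_. if m = j then 1 else 0)" for m
  have B: "smooth_periodic (B m)" for m unfolding B_def by (rule smooth_periodic_const)
  have pdB: "pd i (B m) = (\<lambda>_. 0)" "pd i (B m) x = 0" for i m x
    unfolding B_def by (simp_all add: frechet_derivative_const)
  have "(\<Sum>m\<in>UNIV. pairing (\<lambda>z. u z $ m) (B m) (dd 1 \<eta>)) = (\<Sum>m\<in>UNIV. if m = j then pairing (\<lambda>z. u z $ m) (\<lambda>_. 1) (dd 1 \<eta>) else 0)"
    by (intro sum.cong refl) (simp add: B_def pairing_def)
  moreover have "pairing f (\<lambda>_. 0) \<eta> = 0" for f by (simp add: pairing_def)
  ultimately show ?thesis
    using weak_momentum_divergence_free[of B, OF B _ \<eta>] by (simp add: pdB)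
qed


definition time_average :: "((real^'d) \<times> real \<Rightarrow> real) \<Rightarrow> (real \<Rightarrow> real) \<Rightarrow> real^'d \<Rightarrow> real" where
  "time_average f \<theta> y = (LINT t|time_measure T. f (y, t) * \<theta> t)"

definition cv :: "(real^'d \<Rightarrow> real) \<Rightarrow> ((real^'d) \<times> real \<Rightarrow> real) \<Rightarrow> (real^'d) \<times> real \<Rightarrow> real" where
  "cv K f z = conv K (\<lambda>y. f (y, snd z)) (fst z)"

lemma time_average_integrable:
  assumes f: "integrable (cyl_measure T) f" and \<theta>: "time_test T \<theta>"
  shows "integrable cell_measure (time_average f \<theta>)"
  using cyl_integral_fst(2)[OF pairing_integrable[OF f smooth_periodic_const[of 1] \<theta>]]
  by (simp add: time_average_def[abs_def])

text \<open>Fubini in both orders. Integrating time first gives a convolution, which can be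
  differentiated in \<open>z\<close>; integrating space first gives, for fixed \<open>z\<close>, a
  function of time tested with \<open>\<theta>\<close>.\<close>

lemma pairing_reflect:
  assumes f: "integrable (cyl_measure T) f" and K: "smooth_periodic K" and \<theta>: "time_test T \<theta>"
  shows "pairing f (\<lambda>y. K (z - y)) \<theta> = conv K (time_average f \<theta>) z"
    and "pairing f (\<lambda>y. K (z - y)) \<theta> = (LINT t|time_measure T. cv K f (z, t) * \<theta> t)"
    and "integrable (time_measure T) (\<lambda>t. cv K f (z, t) * \<theta> t)"
proof -
  note i = pairing_integrable[OF f smooth_periodic_reflect(1)[OF K, of z] \<theta>]
  show "pairing f (\<lambda>y. K (z - y)) \<theta> = conv K (time_average f \<theta>) z"
    unfolding pairing_def cyl_integral_fst(1)[OF i] conv_def time_average_def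
    by (intro Bochner_Integration.integral_cong refl)
      (simp add: integral_mult_right_zero[symmetric] ac_simps del: integral_mult_right_zero integral_mult_left_zero)
  have eq: "(LINT y|cell_measure. f (y, t) * (K (z - y) * \<theta> t)) = cv K f (z, t) * \<theta> t" for t
  proof -
    have "(LINT y|cell_measure. f (y, t) * (K (z - y) * \<theta> t)) = (LINT y|cell_measure. (K (z - y) * f (y, t)) * \<theta> t)"
      by (intro Bochner_Integration.integral_cong refl) (simp add: ac_simps)
    then show ?thesis by (simp add: cv_def conv_def)
  qed
  show "pairing f (\<lambda>y. K (z - y)) \<theta> = (LINT t|time_measure T. cv K f (z, t) * \<theta> t)"
    unfolding pairing_def cyl_integral_snd(1)[OF i] by (simp add: eq)
  show "integrable (time_measure T) (\<lambda>t. cv K f (z, t) * \<theta> t)"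
    using cyl_integral_snd(2)[OF i] by (simp add: eq)
qed

lemma pairing_one: 
  assumes "integrable (cyl_measure T) f" "time_test T \<theta>"
  shows "pairing f (\<lambda>_. 1) \<theta> = (LINT y|cell_measure. time_average f \<theta> y)"
  using cyl_integral_fst(1)[OF pairing_integrable[OF assms(1) smooth_periodic_const[of 1] assms(2)]]
  by (simp add: pairing_def time_average_def)

text \<open>As a function of \<open>z\<close>, the momentum functional applied to \<open>K (z - \<cdot>)\<close> is harmonic and
  periodic, hence constant, and its mean vanishes by testing with constant fields.\<close>
lemma momentum_reflect_zero:
  assumes K: "smooth_periodic K" and \<eta>: "time_test T \<eta>"
  shows "momentum j (\<lambda>y. K (z - y)) \<eta> = 0"
proof -
  note D = smooth_periodic_dd
  note d = time_test_dd[OF \<eta>]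
  define c where "c = time_average (\<lambda>z. u z $ j) (dd 1 \<eta>)"
  define e where "e i = time_average (S i j) \<eta>" for i
  have c: "integrable cell_measure c" unfolding c_def by (rule time_average_integrable[OF field_integrable(1) d])
  have e: "integrable cell_measure (e i)" for i
    unfolding e_def by (rule time_average_integrable[OF field_integrable(4) \<eta>])
  \<comment> \<open>The flux enters with a minus sign because the derivative of
    \<open>K (z - y)\<close> in \<open>y\<close> is minus that of \<open>K\<close>.\<close>
  define h where "h K z = conv K c z - (\<Sum>i\<in>UNIV. conv (pd i K) (e i) z)" for K z
  have mom: "momentum j (\<lambda>y. K (z - y)) \<eta> = h K z" if K: "smooth_periodic K" for K z
  proof -
    have pdr: "pd i (\<lambda>y. K (z - y)) = (\<lambda>y. - pd i K (z - y))" for i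
      by (rule ext) (rule smooth_periodic_reflect(2)[OF K])
    have "pairing f (\<lambda>y. - pd i K (z - y)) \<theta> = - pairing f (\<lambda>y. pd i K (z - y)) \<theta>" for f i \<theta>
      by (simp add: pairing_def)
    then show ?thesis
      unfolding momentum_def h_def pdr c_def e_def
      by (simp add: pairing_reflect(1)[OF field_integrable(1) K d] pairing_reflect(1)[OF field_integrable(4) D[OF K] \<eta>] sum_negf)
  qed
  have C1: "C1_periodic (h K) (\<lambda>m. h (pd m K))" if K: "smooth_periodic K" for K
  proof -
    have "C1_periodic (\<lambda>z. conv K c z - (\<Sum>i\<in>UNIV. conv (pd i K) (e i) z))
      (\<lambda>m z. conv (pd m K) c z - (\<Sum>i\<in>UNIV. conv (pd m (pd i K)) (e i) z))"
      by (intro C1_periodic_diff C1_periodic_sum C1_periodic_conv K D c e) simp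
    moreover have "pd m (pd i K) = pd i (pd m K)" for m i by (rule pd_commute[OF K])
    ultimately show ?thesis unfolding h_def[abs_def] by simp
  qed
  \<comment> \<open>Differentiating in \<open>z\<close> differentiates the kernel, so the Laplacian
    of \<open>h K\<close> is the momentum functional at a reflected Laplacian, where
    \<open>momentum_laplacian\<close> applies.\<close>
  have harmonic: "(\<Sum>m\<in>UNIV. h (pd m (pd m K)) z) = 0" for z
  proof -
    note K2 = D[OF D[OF K]]
    have "(\<Sum>m\<in>UNIV. h (pd m (pd m K)) z)
      = (\<Sum>m\<in>UNIV. conv (pd m (pd m K)) c z) - (\<Sum>i\<in>UNIV. \<Sum>m\<in>UNIV. conv (pd i (pd m (pd m K))) (e i) z)"
      unfolding h_def sum_subtractf by (subst sum.swap) simp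
    moreover have "(\<Sum>m\<in>UNIV. conv (pd m (pd m K)) c z) = conv (laplacian K) c z"
      unfolding laplacian_def[abs_def] by (rule conv_sum[OF K2 c, symmetric])
    moreover have "(\<Sum>m\<in>UNIV. conv (pd i (pd m (pd m K))) (e i) z) = conv (pd i (laplacian K)) (e i) z" for i
    proof -
      have "pd i (laplacian K) = (\<lambda>x. \<Sum>m\<in>UNIV. pd i (pd m (pd m K)) x)"
        unfolding laplacian_def[abs_def] by (rule ext, rule dd_sum) (intro smooth_periodic_C K2)
      moreover have "conv (\<lambda>x. \<Sum>m\<in>UNIV. pd i (pd m (pd m K)) x) (e i) z = (\<Sum>m\<in>UNIV. conv (pd i (pd m (pd m K))) (e i) z)"
        by (rule conv_sum[OF D[OF K2] e])
      ultimately show ?thesis by simp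
    qed
    moreover have "conv (laplacian K) c z - (\<Sum>i\<in>UNIV. conv (pd i (laplacian K)) (e i) z) = 0"
    proof -
      have "(\<lambda>y. laplacian K (z - y)) = laplacian (\<lambda>y. K (z - y))"
      proof
        fix y
        have "pd m (pd m (\<lambda>y. K (z - y))) y = pd m (pd m K) (z - y)" for m
        proof -
          have "pd m (\<lambda>y. K (z - y)) = (\<lambda>y. - pd m K (z - y))"
            by (rule ext) (rule smooth_periodic_reflect(2)[OF K])
          moreover have "pd m (\<lambda>y. - pd m K (z - y)) y = - (- pd m (pd m K) (z - y))"
            using dd_linear_comp[OF bounded_linear_minus[OF bounded_linear_ident] smooth_periodic_C[OF smooth_periodic_reflect(1)[OF D[OF K, of "axis m 1"], of z]], where v="axis m 1" and x=y]
              smooth_periodic_reflect(2)[OF D[OF K, of "axis m 1"], where v="axis m 1" and x=z and y=y] by simp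
          ultimately show ?thesis by simp
        qed
        then show "laplacian K (z - y) = laplacian (\<lambda>y. K (z - y)) y" by (simp add: laplacian_def)
      qed
      then show ?thesis
        using mom[OF smooth_periodic_laplacian[OF K], of z]
          momentum_laplacian[OF smooth_periodic_reflect(1)[OF K] \<eta>, of j z]
        by (simp add: h_def)
    qed
    ultimately show ?thesis by simp
  qed
  \<comment> \<open>By parts, the integral of the squared gradient is minus that of the function
    times its Laplacian, hence 0; a continuous function with vanishing square integral is 0.\<close>
  have zero: "h (pd m K) z = 0" for m z
  proof -
    have i1: "integrable cell_measure (\<lambda>z. h (pd m K) z * h (pd m K) z)" for m
      using C1_periodicD[OF C1[OF D[OF K]]]
      by (intro cell_integrable_periodic continuous_on_mult) (auto simp: lattice_periodic_def)
    have i2: "integrable cell_measure (\<lambda>z. h K z * h (pd m (pd m K)) z)" for m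
      using C1_periodicD[OF C1[OF D[OF D[OF K]]]] C1_periodicD[OF C1[OF K]]
      by (intro cell_integrable_periodic continuous_on_mult) (auto simp: lattice_periodic_def)
    have "(\<Sum>m\<in>UNIV. LINT z|cell_measure. h (pd m K) z * h (pd m K) z)
      = - (\<Sum>m\<in>UNIV. LINT z|cell_measure. h K z * h (pd m (pd m K)) z)"
      using integral_by_parts[OF C1[OF K] C1[OF D[OF K]]] by (simp add: sum_negf)
    also have "(\<Sum>m\<in>UNIV. LINT z|cell_measure. h K z * h (pd m (pd m K)) z)
      = (LINT z|cell_measure. h K z * (\<Sum>m\<in>UNIV. h (pd m (pd m K)) z))"
      using i2 by (simp add: sum_distrib_left)
    finally have "(\<Sum>m\<in>UNIV. LINT z|cell_measure. h (pd m K) z * h (pd m K) z) = 0"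
      by (simp add: harmonic)
    then have "(LINT z|cell_measure. h (pd m K) z * h (pd m K) z) = 0"
      by (subst (asm) sum_nonneg_eq_0_iff) auto
    then show ?thesis
      by (rule cell_integral_square_zero[OF C1_periodicD(2)[OF C1[OF D[OF K]]] C1_periodicD(1)[OF C1[OF D[OF K]]]])
  qed
  have const: "h K z = h K 0" for z by (rule C1_periodic_zero_gradient[OF C1[OF K] zero])
  \<comment> \<open>The cell has measure 1, so the constant equals its mean. Kernels that are
    derivatives have mean zero, and the mean of \<open>c\<close> vanishes by
    \<open>momentum_const\<close>.\<close>
  have "h K 0 = (LINT z|(cell_measure :: (real^'d) measure). h K 0)" by simp
  also have "\<dots> = (LINT z|cell_measure. h K z)"
    by (intro Bochner_Integration.integral_cong refl) (rule const[symmetric])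
  also have "\<dots> = (LINT z|cell_measure. conv K c z) - (\<Sum>i\<in>UNIV. LINT z|cell_measure. conv (pd i K) (e i) z)"
  proof -
    have "integrable cell_measure (conv K c)" "integrable cell_measure (conv (pd i K) (e i))" for i
      using C1_periodicD[OF C1_periodic_conv[OF K c]] C1_periodicD[OF C1_periodic_conv[OF D[OF K] e]]
      by (auto intro!: cell_integrable_periodic)
    then show ?thesis unfolding h_def by simp
  qed
  also have "\<dots> = (LINT x|cell_measure. K x) * (LINT y|cell_measure. c y)"
    using integral_partial_derivative_0[OF C1_periodic_smooth[OF K]]
    by (simp add: integral_conv[OF K c] integral_conv[OF D[OF K] e])
  also have "(LINT y|cell_measure. c y) = 0"
    using pairing_one[OF field_integrable(1) d, of j] momentum_const[OF \<eta>, of j] by (simp add: c_def)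
  finally show ?thesis using const[of z] mom[OF K, of z] by simp
qed

text \<open>The vanishing momentum functional, read with the space integral taken first. It holds at
  every point \<open>z\<close>, so the one-dimensional product rule can be used there.\<close>

lemma weak_time_derivative:
  assumes K: "smooth_periodic K"
  shows "weak_derivative T (\<lambda>t. cv K (\<lambda>z. u z $ j) (z, t)) (\<lambda>t. - (\<Sum>i\<in>UNIV. cv (pd i K) (S i j) (z, t)))"
proof -
  note D = smooth_periodic_dd
  have int: "integrable (time_measure T) (\<lambda>t. cv K f (z, t))"
    if f: "integrable (cyl_measure T) f" and K: "smooth_periodic K" for f K
  proof -
    obtain B where B: "0 \<le> B" "\<And>x. \<bar>K x\<bar> \<le> B" by (rule smooth_periodic_bounded[OF K]) (rule that)
    have [measurable]: "K \<in> borel_measurable borel" by (rule smooth_periodic_measurable[OF K])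
    have "integrable (cyl_measure T) (\<lambda>w. K (z - fst w) * f w)"
      by (rule integrable_bounded_mult[OF f, where B=B]) (use B in \<open>auto simp: cyl_measurable_iff\<close>)
    from cyl_integral_snd(2)[OF this] show ?thesis by (simp add: cv_def conv_def)
  qed
  show ?thesis
    unfolding weak_derivative_def
  proof (intro conjI allI impI)
    fix \<eta> assume \<eta>: "time_test T \<eta>"
    note d = time_test_dd[OF \<eta>]
    have pdr: "pd i (\<lambda>y. K (z - y)) = (\<lambda>y. - pd i K (z - y))" for i
      by (rule ext) (rule smooth_periodic_reflect(2)[OF K])
    have neg: "pairing f (\<lambda>y. - pd i K (z - y)) \<theta> = - pairing f (\<lambda>y. pd i K (z - y)) \<theta>" for f i \<theta>
      by (simp add: pairing_def)
    have "pairing (\<lambda>z. u z $ j) (\<lambda>y. K (z - y)) (dd 1 \<eta>) = (\<Sum>i\<in>UNIV. pairing (S i j) (\<lambda>y. pd i K (z - y)) \<eta>)"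
      using momentum_reflect_zero[OF K \<eta>, of j z] unfolding momentum_def pdr neg by (simp add: sum_negf)
    then have "(LINT t|time_measure T. cv K (\<lambda>z. u z $ j) (z, t) * dd 1 \<eta> t)
      = (\<Sum>i\<in>UNIV. LINT t|time_measure T. cv (pd i K) (S i j) (z, t) * \<eta> t)"
      by (simp add: pairing_reflect(2)[OF field_integrable(1) K d] pairing_reflect(2)[OF field_integrable(4) D[OF K] \<eta>])
    also have "\<dots> = (LINT t|time_measure T. (\<Sum>i\<in>UNIV. cv (pd i K) (S i j) (z, t)) * \<eta> t)"
      using pairing_reflect(3)[OF field_integrable(4) D[OF K] \<eta>] by (simp add: sum_distrib_right)
    finally show "(LINT t|time_measure T. cv K (\<lambda>z. u z $ j) (z, t) * dd 1 \<eta> t)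
      = - (LINT t|time_measure T. - (\<Sum>i\<in>UNIV. cv (pd i K) (S i j) (z, t)) * \<eta> t)" by simp
  qed (auto intro!: int K D field_integrable)
qed

end

section \<open>Test functions and divergence-free slices\<close>

lemma C_infinity_pd_time:
  fixes f :: "(real^'d) \<times> real \<Rightarrow> 'b::real_normed_vector"
  assumes "C_infinity f"
  shows "pd_time f = dd (0, 1) f"
proof (rule ext, clarify)
  fix x t
  have "((\<lambda>s. f ((x, 0) + s *\<^sub>R (0, 1))) has_vector_derivative dd (0, 1) f ((x, 0) + t *\<^sub>R (0, 1))) (at t)"
    by (rule C_infinity_line_derivative[OF assms])
  then show "pd_time f (x, t) = dd (0, 1) f (x, t)" by (intro pd_time_eqI) simp
qed

lemma C_infinity_pd_space:
  fixes f :: "(real^'d) \<times> real \<Rightarrow> 'b::real_normed_vector"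
  assumes "C_infinity f"
  shows "pd_space i f = dd (axis i 1, 0) f"
proof (rule ext, clarify)
  fix x t
  have "((\<lambda>s. f ((x, t) + s *\<^sub>R (axis i 1, 0))) has_vector_derivative dd (axis i 1, 0) f ((x, t) + 0 *\<^sub>R (axis i 1, 0))) (at 0)"
    by (rule C_infinity_line_derivative[OF assms])
  then show "pd_space i f (x, t) = dd (axis i 1, 0) f (x, t)" by (intro pd_space_eqI) simp
qed

lemma test_function_facts:
  fixes \<phi> :: "(real^'d) \<times> real \<Rightarrow> real"
  assumes \<phi>: "test_function T \<phi>"
  shows test_function_C: "C_infinity \<phi>"
    and test_function_periodic: "lattice_periodic (\<lambda>x. \<phi> (x, t))"
    and test_function_pd_time: "pd_time \<phi> z = dd (0, 1) \<phi> z"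
    and test_function_pd_space: "pd_space i \<phi> z = dd (axis i 1, 0) \<phi> z"
proof -
  show C: "C_infinity \<phi>" using \<phi> by (simp add: test_function_def)
  obtain a b where ab: "0 < a" "b < T" "\<forall>x t. t \<notin> {a..b} \<longrightarrow> \<phi> (x, t) = 0"
    using \<phi> by (auto simp: test_function_def)
  \<comment> \<open>Periodicity is postulated only for times in \<open>{0<..<T}\<close>; at all
    other times the test function is 0.\<close>
  show "lattice_periodic (\<lambda>x. \<phi> (x, t))"
  proof (cases "t \<in> {a..b}")
    case True
    then have "t \<in> {0<..<T}" using ab by auto
    then show ?thesis using \<phi> by (auto simp: test_function_def periodic_in_space_def lattice_periodic_def lattice_def)
  qed (use ab in \<open>simp add: lattice_periodic_def\<close>)
  show "pd_time \<phi> z = dd (0, 1) \<phi> z" by (simp add: C_infinity_pd_time[OF C])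
  show "pd_space i \<phi> z = dd (axis i 1, 0) \<phi> z" by (simp add: C_infinity_pd_space[OF C])
qed

lemma test_function_dd:
  fixes \<phi> :: "(real^'d) \<times> real \<Rightarrow> real"
  assumes \<phi>: "test_function T \<phi>"
  shows "test_function T (dd v \<phi>)"
proof -
  note C = test_function_C[OF \<phi>]
  obtain a b where ab: "0 < a" "b < T" "\<forall>x t. t \<notin> {a..b} \<longrightarrow> \<phi> (x, t) = 0"
    using \<phi> by (auto simp: test_function_def)
  have "dd v \<phi> (x, t) = 0" if t: "t \<notin> {a..b}" for x t
  proof -
    have o: "open (UNIV \<times> - {a..b} :: ((real^'d) \<times> real) set)" by (intro open_Times open_UNIV) (simp add: open_Compl)
    have d: "((\<lambda>_. 0 :: real) has_derivative (\<lambda>_. 0)) (at (x, t))" by simp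
    have "(\<phi> has_derivative (\<lambda>_. 0)) (at (x, t))"
      by (rule has_derivative_transform_within_open[OF d o]) (use t ab in auto)
    then show ?thesis by (simp add: has_derivative_imp_eq)
  qed
  moreover have "periodic_in_space T (dd v \<phi>)"
    unfolding periodic_in_space_def
  proof (intro allI ballI impI)
    fix x k :: "real^'d" and t assume k: "\<forall>i. k $ i \<in> \<int>"
    have "\<phi> (z + (k, 0)) = \<phi> z" for z
      using lattice_periodicD[OF test_function_periodic[OF \<phi>], of k "fst z" "snd z"] k
      by (cases z) (simp add: lattice_def)
    then have eq: "(\<lambda>z. \<phi> (z + (k, 0))) = \<phi>" by auto
    show "dd v \<phi> (x + k, t) = dd v \<phi> (x, t)"
      using dd_affine[OF C bounded_linear_ident, where v=v and x="(x, t)" and b="(k, 0)"] unfolding eq by simp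
  qed
  ultimately show ?thesis
    using C_infinity_dd[OF C] ab unfolding test_function_def by blast
qed

lemma test_function_bounded:
  fixes \<phi> :: "(real^'d) \<times> real \<Rightarrow> real"
  assumes \<phi>: "test_function T \<phi>"
  obtains B where "0 \<le> B" "\<And>z. \<bar>\<phi> z\<bar> \<le> B"
proof -
  obtain a b where ab: "0 < a" "b < T" "\<forall>x t. t \<notin> {a..b} \<longrightarrow> \<phi> (x, t) = 0"
    using \<phi> by (auto simp: test_function_def)
  have "compact (unit_cell \<times> {a..b} :: ((real^'d) \<times> real) set)"
    by (intro compact_Times) (simp_all add: unit_cell_def compact_cbox)
  then have "bounded (\<phi> ` (unit_cell \<times> {a..b}))"
    by (intro compact_imp_bounded compact_continuous_image C_infinity_continuous test_function_C[OF \<phi>])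
  then obtain B where B: "0 < B" "\<forall>x\<in>\<phi> ` (unit_cell \<times> {a..b}). norm x \<le> B" unfolding bounded_pos by blast
  have "\<bar>\<phi> z\<bar> \<le> B" for z
  proof (cases z)
    case (Pair x t)
    have "\<phi> (frac_vec x, t) = \<phi> (x, t)" by (rule lattice_periodic_frac[OF test_function_periodic[OF \<phi>]])
    moreover have "\<bar>\<phi> (frac_vec x, t)\<bar> \<le> B"
    proof (cases "t \<in> {a..b}")
      case True
      then show ?thesis using B(2) floor_vec_in_unit_cell[OF floor_frac_vec, of x] by auto
    qed (use ab B in auto)
    ultimately show ?thesis using Pair by simp
  qed
  with B(1) show ?thesis by (intro that[of B]) auto
qed

lemma test_function_measurable:
  fixes \<phi> :: "(real^'d) \<times> real \<Rightarrow> real"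
  assumes "test_function T \<phi>"
  shows "\<phi> \<in> borel_measurable (borel \<Otimes>\<^sub>M borel)"
  using C_infinity_measurable[OF test_function_C[OF assms]] by (simp only: borel_prod)

lemma test_function_continuous_section:
  fixes \<phi> :: "(real^'d) \<times> real \<Rightarrow> real"
  assumes "test_function T \<phi>"
  shows "continuous_on UNIV (\<lambda>x. \<phi> (x, t))"
  by (rule continuous_on_compose2[OF C_infinity_continuous[OF test_function_C[OF assms], of UNIV]])
    (auto intro!: continuous_intros)

lemma test_function_C1:
  fixes \<phi> :: "(real^'d) \<times> real \<Rightarrow> real"
  assumes \<phi>: "test_function T \<phi>"
  shows "C1_periodic (\<lambda>x. \<phi> (x, t)) (\<lambda>i x. pd_space i \<phi> (x, t))"
proof (rule C1_periodicI)
  have eq: "(\<lambda>x. pd_space i \<phi> (x, t)) = (\<lambda>x. dd (axis i 1, 0) \<phi> (x, t))" for i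
    by (simp add: test_function_pd_space[OF \<phi>])
  show "lattice_periodic (\<lambda>x. pd_space i \<phi> (x, t))" for i
    unfolding eq by (rule test_function_periodic[OF test_function_dd[OF \<phi>]])
  show "continuous_on UNIV (\<lambda>x. pd_space i \<phi> (x, t))" for i
    unfolding eq by (rule test_function_continuous_section[OF test_function_dd[OF \<phi>]])
  fix i x s
  show "((\<lambda>s. \<phi> (x + s *\<^sub>R axis i 1, t)) has_real_derivative pd_space i \<phi> (x + s *\<^sub>R axis i 1, t)) (at s)"
    using C_infinity_line_real[OF test_function_C[OF \<phi>], of "(x, t)" "(axis i 1, 0)" s]
    by (simp add: test_function_pd_space[OF \<phi>])
qed (use test_function_periodic[OF \<phi>] test_function_continuous_section[OF \<phi>] in auto)

lemma test_function_time_test: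
  fixes \<phi> :: "(real^'d) \<times> real \<Rightarrow> real"
  assumes \<phi>: "test_function T \<phi>"
  shows "time_test T (\<lambda>t. \<phi> (x, t))" and "dd 1 (\<lambda>t. \<phi> (x, t)) t = pd_time \<phi> (x, t)"
proof -
  have bl: "bounded_linear (\<lambda>t :: real. (0 :: real^'d, t))"
    by (intro bounded_linear_Pair bounded_linear_zero bounded_linear_ident)
  note A = C_infinity_affine[OF test_function_C[OF \<phi>] bl, of "(x, 0)"]
    dd_affine[OF test_function_C[OF \<phi>] bl, where b="(x, 0)" and v=1 and x=t]
  show "time_test T (\<lambda>t. \<phi> (x, t))"
    using A(1) \<phi> unfolding time_test_def test_function_def by auto
  show "dd 1 (\<lambda>t. \<phi> (x, t)) t = pd_time \<phi> (x, t)"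
    using A(2) by (simp add: test_function_pd_time[OF \<phi>])
qed

context euler_fields
begin

text \<open>The slice norm \<open>\<alpha>\<close> has an integrable cube, and Young's inequality with parameter \<open>\<alpha> t\<close> bounds the
  slice integrals of \<open>\<bar>u\<bar>\<close> and of \<open>\<bar>u\<bar>\<^sup>2 + \<bar>q\<bar>\<close> by multiples of \<open>\<alpha> t\<close> and \<open>(\<alpha> t)\<^sup>2\<close>.\<close>
definition \<alpha> :: "real \<Rightarrow> real" where
  "\<alpha> t = root 3 (1 + (LINT x|cell_measure. \<Gamma> (x, t)))"

lemma \<alpha>_cubed: "\<alpha> t ^ 3 = 1 + (LINT x|cell_measure. \<Gamma> (x, t))"
  unfolding \<alpha>_def by (rule real_root_pow_pos2) (auto intro!: add_nonneg_nonneg integral_nonneg_AE AE_I2 \<Gamma>_nonneg)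

lemma \<alpha>_ge_1: "1 \<le> \<alpha> t"
  unfolding \<alpha>_def by (subst real_root_ge_1_iff) (auto intro!: integral_nonneg_AE AE_I2 \<Gamma>_nonneg)

lemma \<alpha>_pos: "0 < \<alpha> t"
  using \<alpha>_ge_1[of t] by simp

lemma \<alpha>_integrable: "integrable (time_measure T) (\<lambda>t. \<alpha> t ^ 3)"
  unfolding \<alpha>_cubed using cyl_integral_snd(2)[OF \<Gamma>_integrable] by simp

lemma \<alpha>_integrable_cyl: "integrable (cyl_measure T) (\<lambda>z. \<alpha> (snd z) ^ 3)"
  using integrable_pair_snd[OF cell.finite_measure_axioms time.sigma_finite_measure_axioms \<alpha>_integrable]
  by (simp add: cyl_measure_def case_prod_beta')

lemma \<alpha>_power_le: "k \<le> 3 \<Longrightarrow> \<alpha> t ^ k \<le> \<alpha> t ^ 3"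
  using \<alpha>_ge_1 by (rule power_increasing[rotated])

lemma section_\<Gamma>_le: "(LINT x|cell_measure. \<Gamma> (x, t)) \<le> \<alpha> t ^ 3"
  by (simp add: \<alpha>_cubed)

lemma section_integral_bounds:
  shows "(LINT x|cell_measure. \<bar>u (x, t) $ i\<bar>) \<le> 2 * \<alpha> t"
    and "(LINT x|cell_measure. \<bar>u (x, t) $ i * u (x, t) $ j\<bar>) \<le> 2 * \<alpha> t ^ 2"
    and "(LINT x|cell_measure. \<bar>q (x, t)\<bar>) \<le> 2 * \<alpha> t ^ 2"
    and "(LINT x|cell_measure. \<bar>S i j (x, t)\<bar>) \<le> 4 * \<alpha> t ^ 2"
proof -
  note b = field_bounds[OF \<alpha>_ge_1[of t]]
  note si = section_integrable and sg = \<Gamma>_section_integrable[of t]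
  let ?W = "LINT x|cell_measure. \<Gamma> (x, t)"
  have W1: "?W / \<alpha> t ^ 2 \<le> \<alpha> t"
    using section_\<Gamma>_le[of t] \<alpha>_pos[of t] by (simp add: divide_le_eq power2_eq_square power3_eq_cube mult.assoc)
  have W2: "?W / \<alpha> t \<le> \<alpha> t ^ 2"
    using section_\<Gamma>_le[of t] \<alpha>_pos[of t] by (simp add: divide_le_eq power2_eq_square power3_eq_cube mult.assoc)
  have i1: "integrable cell_measure (\<lambda>x. \<alpha> t + \<Gamma> (x, t) / \<alpha> t ^ 2)" and i2: "integrable cell_measure (\<lambda>x. \<alpha> t ^ 2 + \<Gamma> (x, t) / \<alpha> t)"
    using sg by auto
  have e1: "(LINT x|cell_measure. \<alpha> t + \<Gamma> (x, t) / \<alpha> t ^ 2) \<le> 2 * \<alpha> t"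
    and e2: "(LINT x|cell_measure. \<alpha> t ^ 2 + \<Gamma> (x, t) / \<alpha> t) \<le> 2 * \<alpha> t ^ 2"
    using sg W1 W2 by simp_all
  have "(LINT x|cell_measure. \<bar>u (x, t) $ i\<bar>) \<le> (LINT x|cell_measure. \<alpha> t + \<Gamma> (x, t) / \<alpha> t ^ 2)"
    by (intro integral_mono integrable_abs si i1 b)
  with e1 show "(LINT x|cell_measure. \<bar>u (x, t) $ i\<bar>) \<le> 2 * \<alpha> t" by linarith
  have "(LINT x|cell_measure. \<bar>u (x, t) $ i * u (x, t) $ j\<bar>) \<le> (LINT x|cell_measure. \<alpha> t ^ 2 + \<Gamma> (x, t) / \<alpha> t)"
    by (intro integral_mono integrable_abs si i2 b)
  with e2 show "(LINT x|cell_measure. \<bar>u (x, t) $ i * u (x, t) $ j\<bar>) \<le> 2 * \<alpha> t ^ 2" by linarith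
  have "(LINT x|cell_measure. \<bar>q (x, t)\<bar>) \<le> (LINT x|cell_measure. \<alpha> t ^ 2 + \<Gamma> (x, t) / \<alpha> t)"
    by (intro integral_mono integrable_abs si i2 b)
  with e2 show "(LINT x|cell_measure. \<bar>q (x, t)\<bar>) \<le> 2 * \<alpha> t ^ 2" by linarith
  have "(LINT x|cell_measure. \<bar>S i j (x, t)\<bar>) \<le> (LINT x|cell_measure. 2 * (\<alpha> t ^ 2 + \<Gamma> (x, t) / \<alpha> t))"
    by (intro integral_mono integrable_abs si integrable_mult_right i2 b)
  also have "\<dots> = 2 * (LINT x|cell_measure. \<alpha> t ^ 2 + \<Gamma> (x, t) / \<alpha> t)" by (rule integral_mult_right_zero)
  finally show "(LINT x|cell_measure. \<bar>S i j (x, t)\<bar>) \<le> 4 * \<alpha> t ^ 2" using e2 by linarith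
qed

lemma cv_measurable [measurable]:
  assumes [measurable]: "K \<in> borel_measurable borel" "f \<in> borel_measurable (borel \<Otimes>\<^sub>M borel)"
  shows "cv K f \<in> borel_measurable (borel \<Otimes>\<^sub>M borel)"
  unfolding cv_def conv_def by measurable

lemma cv_C1:
  assumes "smooth_periodic K" "integrable cell_measure (\<lambda>x. f (x, t))"
  shows "C1_periodic (\<lambda>x. cv K f (x, t)) (\<lambda>i x. cv (pd i K) f (x, t))"
  using C1_periodic_conv[OF assms] by (simp add: cv_def)

lemma cv_bound_exists:
  assumes K: "smooth_periodic K" and f: "\<And>t. integrable cell_measure (\<lambda>x. f (x, t))"
    and m: "\<And>t. (LINT x|cell_measure. \<bar>f (x, t)\<bar>) \<le> c * \<alpha> t ^ k" and c: "0 \<le> c"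
  obtains C where "0 \<le> C" "\<And>x t. \<bar>cv K f (x, t)\<bar> \<le> C * \<alpha> t ^ k"
proof -
  obtain B where B: "0 \<le> B" "\<And>x. \<bar>K x\<bar> \<le> B" by (rule smooth_periodic_bounded[OF K]) (rule that)
  have "\<bar>cv K f (x, t)\<bar> \<le> (B * c) * \<alpha> t ^ k" for x t
  proof -
    have "\<bar>cv K f (x, t)\<bar> \<le> B * (LINT y|cell_measure. \<bar>f (y, t)\<bar>)"
      unfolding cv_def using conv_bound[OF K f B(2), of t x] by simp
    also have "\<dots> \<le> B * (c * \<alpha> t ^ k)" by (intro mult_left_mono m B)
    finally show ?thesis by (simp add: mult.assoc)
  qed
  with B c show ?thesis by (intro that[of "B * c"]) auto
qed

text \<open>The exceptional set of times may depend on \<open>z\<close> and \<open>K\<close>;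
  passing to one set for all of them is the point of \<open>AE_solenoidal\<close>.\<close>

lemma section_divergence_kernel:
  assumes K: "smooth_periodic K"
  shows "AE t in time_measure T. (\<Sum>i\<in>UNIV. cv (pd i K) (\<lambda>z. u z $ i) (z, t)) = 0"
proof (rule fundamental_lemma[OF mollifier])
  note D = smooth_periodic_dd
  have int: "integrable (time_measure T) (\<lambda>t. cv K (\<lambda>z. u z $ j) (z, t))" if "smooth_periodic K" for K j
    using weak_time_derivative[OF that] by (simp add: weak_derivative_def)
  show "integrable (time_measure T) (\<lambda>t. \<Sum>i\<in>UNIV. cv (pd i K) (\<lambda>z. u z $ i) (z, t))"
    by (intro Bochner_Integration.integrable_sum int D K)
  fix \<theta> assume \<theta>: "time_test T \<theta>"
  have pdr: "pd i (\<lambda>y. K (z - y)) = (\<lambda>y. - pd i K (z - y))" for i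
    by (rule ext) (rule smooth_periodic_reflect(2)[OF K])
  have neg: "pairing f (\<lambda>y. - pd i K (z - y)) \<theta> = - pairing f (\<lambda>y. pd i K (z - y)) \<theta>" for f i
    by (simp add: pairing_def)
  have "(LINT t|time_measure T. (\<Sum>i\<in>UNIV. cv (pd i K) (\<lambda>z. u z $ i) (z, t)) * \<theta> t)
     = (\<Sum>i\<in>UNIV. pairing (\<lambda>z. u z $ i) (\<lambda>y. pd i K (z - y)) \<theta>)"
    using pairing_reflect(3)[OF field_integrable(1) D[OF K] \<theta>]
    by (simp add: sum_distrib_right pairing_reflect(2)[OF field_integrable(1) D[OF K] \<theta>])
  also have "\<dots> = 0"
    using weak_divergence_free[OF smooth_periodic_reflect(1)[OF K, of z] \<theta>] unfolding pdr neg
    by (simp add: sum_negf)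
  finally show "(LINT t|time_measure T. (\<Sum>i\<in>UNIV. cv (pd i K) (\<lambda>z. u z $ i) (z, t)) * \<theta> t) = 0" .
qed

text \<open>Weak incompressibility of a single slice against all C^1 functions at once. The
  functions inserted later depend on \<open>t\<close> themselves, so one null set of times has to
  serve all of them.\<close>

definition solenoidal_at :: "real \<Rightarrow> bool" where
  "solenoidal_at t \<longleftrightarrow> (\<forall>\<xi> \<xi>'. C1_periodic \<xi> \<xi>' \<longrightarrow> (\<Sum>i\<in>UNIV. LINT x|cell_measure. u (x, t) $ i * \<xi>' i x) = 0)"

text \<open>Use countably many kernels and a countable dense set of points. Continuity of
  convolutions extends the identity to all points, integration by parts moves the derivative to
  \<open>\<xi>\<close>, and \<open>conv_approximation\<close> removes the kernel.\<close>

lemma AE_solenoidal: "AE t in time_measure T. solenoidal_at t"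
proof -
  define K where "K n = torus_kernel \<rho> (1 / real (Suc n))" for n
  have K: "smooth_periodic (K n)" for n unfolding K_def by (rule torus_kernel_smooth[OF mollifier]) simp
  note D = smooth_periodic_dd
  obtain X :: "(real^'d) set" where X: "countable X" "\<And>Y. open Y \<Longrightarrow> Y \<noteq> {} \<Longrightarrow> \<exists>x\<in>X. x \<in> Y"
    using countable_dense_exists by metis
  have "AE t in time_measure T. \<forall>z\<in>X. \<forall>n. (\<Sum>i\<in>UNIV. cv (pd i (K n)) (\<lambda>z. u z $ i) (z, t)) = 0"
    by (simp add: AE_ball_countable[OF X(1)] AE_all_countable section_divergence_kernel[OF K])
  then show ?thesis
  proof eventually_elim
    case (elim t)
    let ?u = "\<lambda>i x. u (x, t) $ i"
    have u: "integrable cell_measure (?u i)" for i by (rule section_integrable)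
    \<comment> \<open>A continuous function that is nonzero somewhere is nonzero on an open set, and
      that set meets \<open>X\<close>.\<close>
    have zero: "(\<Sum>i\<in>UNIV. conv (pd i (K n)) (?u i) z) = 0" for n z
    proof (rule ccontr)
      let ?g = "\<lambda>z. \<Sum>i\<in>UNIV. conv (pd i (K n)) (?u i) z"
      assume "?g z \<noteq> 0"
      moreover have "open {z. ?g z \<noteq> 0}"
      proof -
        have "continuous_on UNIV ?g" by (intro continuous_on_sum conv_continuous D K u)
        then have "open (?g -` (- {0}))" by (rule open_vimage[rotated]) auto
        moreover have "?g -` (- {0}) = {z. ?g z \<noteq> 0}" by auto
        ultimately show ?thesis by simp
      qed
      ultimately obtain x where "x \<in> X" "?g x \<noteq> 0" using X(2)[of "{z. ?g z \<noteq> 0}"] by blast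
      then show False using elim by (simp add: cv_def)
    qed
    show "solenoidal_at t"
      unfolding solenoidal_at_def
    proof (intro allI impI)
      fix \<xi> :: "real^'d \<Rightarrow> real" and \<xi>' assume \<xi>: "C1_periodic \<xi> \<xi>'"
      note E = C1_periodicD[OF \<xi>]
      have "(\<lambda>n. \<Sum>i\<in>UNIV. LINT x|cell_measure. conv (K n) (?u i) x * \<xi>' i x) \<longlonglongrightarrow> (\<Sum>i\<in>UNIV. LINT x|cell_measure. ?u i x * \<xi>' i x)"
        unfolding K_def by (intro tendsto_sum conv_approximation[OF mollifier u] E)
      moreover have "(\<Sum>i\<in>UNIV. LINT x|cell_measure. conv (K n) (?u i) x * \<xi>' i x) = 0" for n
      proof -
        have "(LINT x|cell_measure. conv (K n) (?u i) x * \<xi>' i x) = - (LINT x|cell_measure. conv (pd i (K n)) (?u i) x * \<xi> x)" for i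
          using integral_by_parts[OF C1_periodic_conv[OF K[of n] u[of i]] \<xi>, where i=i] by simp
        moreover have "integrable cell_measure (\<lambda>x. conv (pd i (K n)) (?u i) x * \<xi> x)" for i
          using C1_periodicD[OF C1_periodic_conv[OF K u]] E
          by (intro cell_integrable_periodic continuous_on_mult) (auto simp: lattice_periodic_def)
        ultimately have "(\<Sum>i\<in>UNIV. LINT x|cell_measure. conv (K n) (?u i) x * \<xi>' i x)
          = - (LINT x|cell_measure. (\<Sum>i\<in>UNIV. conv (pd i (K n)) (?u i) x) * \<xi> x)"
          by (simp add: sum_negf sum_distrib_right)
        then show ?thesis by (simp add: zero)
      qed
      ultimately show "(\<Sum>i\<in>UNIV. LINT x|cell_measure. ?u i x * \<xi>' i x) = 0"
        by (simp add: LIMSEQ_const_iff)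
    qed
  qed
qed

end

section \<open>The time derivative of the resolved energy\<close>

context euler_fields
begin

text \<open>A quantity is tame of order \<open>k\<close> if it is dominated by the \<open>k\<close>-th power of \<open>scale\<close>; thus \<open>u\<close> has order 1,
  \<open>q\<close> has order 2, and products up to order 3 are integrable in space-time.\<close>
definition scale :: "(real^'d) \<times> real \<Rightarrow> real" where
  "scale z = \<alpha> (snd z) + norm (u z) + sqrt \<bar>q z\<bar>"

lemma scale_ge_1: "1 \<le> scale z"
  unfolding scale_def using \<alpha>_ge_1[of "snd z"] by (simp add: add_increasing2)

definition tame :: "nat \<Rightarrow> ((real^'d) \<times> real \<Rightarrow> real) \<Rightarrow> bool" where
  "tame k f \<longleftrightarrow> f \<in> borel_measurable (borel \<Otimes>\<^sub>M borel) \<and> (\<exists>C\<ge>0. \<forall>z. \<bar>f z\<bar> \<le> C * scale z ^ k)"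

lemma tameI:
  assumes "f \<in> borel_measurable (borel \<Otimes>\<^sub>M borel)" "0 \<le> C" "\<And>z. \<bar>f z\<bar> \<le> C * scale z ^ k"
  shows "tame k f"
  using assms unfolding tame_def by blast

lemma tameE:
  assumes "tame k f"
  obtains C where "f \<in> borel_measurable (borel \<Otimes>\<^sub>M borel)" "0 \<le> C" "\<And>z. \<bar>f z\<bar> \<le> C * scale z ^ k"
  using assms unfolding tame_def by blast

lemma tame_measurable: "tame k f \<Longrightarrow> f \<in> borel_measurable (borel \<Otimes>\<^sub>M borel)"
  by (simp add: tame_def)

lemma tame_mono:
  assumes f: "tame k f" and kl: "k \<le> l"
  shows "tame l f"
proof -
  obtain C where C: "f \<in> borel_measurable (borel \<Otimes>\<^sub>M borel)" "0 \<le> C" "\<And>z. \<bar>f z\<bar> \<le> C * scale z ^ k"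
    by (rule tameE[OF f]) (rule that)
  have "\<bar>f z\<bar> \<le> C * scale z ^ l" for z
  proof -
    have "C * scale z ^ k \<le> C * scale z ^ l"
      using C(2) scale_ge_1 kl by (intro mult_left_mono power_increasing) auto
    with C(3)[of z] show ?thesis by linarith
  qed
  with C show ?thesis by (intro tameI)
qed

lemma tame_mult:
  assumes f: "tame k f" and g: "tame l g"
  shows "tame (k + l) (\<lambda>z. f z * g z)"
proof -
  obtain C where C: "f \<in> borel_measurable (borel \<Otimes>\<^sub>M borel)" "0 \<le> C" "\<And>z. \<bar>f z\<bar> \<le> C * scale z ^ k"
    by (rule tameE[OF f]) (rule that)
  obtain D where D: "g \<in> borel_measurable (borel \<Otimes>\<^sub>M borel)" "0 \<le> D" "\<And>z. \<bar>g z\<bar> \<le> D * scale z ^ l"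
    by (rule tameE[OF g]) (rule that)
  show ?thesis
  proof (rule tameI)
    show "(\<lambda>z. f z * g z) \<in> borel_measurable (borel \<Otimes>\<^sub>M borel)" using C(1) D(1) by measurable
    show "0 \<le> C * D" using C D by simp
    fix z
    have "0 \<le> scale z" using scale_ge_1[of z] by simp
    then have "\<bar>f z\<bar> * \<bar>g z\<bar> \<le> (C * scale z ^ k) * (D * scale z ^ l)"
      using C D by (intro mult_mono) auto
    then show "\<bar>f z * g z\<bar> \<le> C * D * scale z ^ (k + l)"
      by (simp add: abs_mult power_add ac_simps)
  qed
qed

lemma tame_add:
  assumes f: "tame k f" and g: "tame l g"
  shows "tame (max k l) (\<lambda>z. f z + g z)"
proof -
  obtain C where C: "f \<in> borel_measurable (borel \<Otimes>\<^sub>M borel)" "0 \<le> C" "\<And>z. \<bar>f z\<bar> \<le> C * scale z ^ (max k l)"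
    by (rule tameE[OF tame_mono[OF f max.cobounded1]]) (rule that)
  obtain D where D: "g \<in> borel_measurable (borel \<Otimes>\<^sub>M borel)" "0 \<le> D" "\<And>z. \<bar>g z\<bar> \<le> D * scale z ^ (max k l)"
    by (rule tameE[OF tame_mono[OF g max.cobounded2]]) (rule that)
  show ?thesis
  proof (rule tameI)
    show "(\<lambda>z. f z + g z) \<in> borel_measurable (borel \<Otimes>\<^sub>M borel)" using C(1) D(1) by measurable
    show "0 \<le> C + D" using C D by simp
    fix z
    show "\<bar>f z + g z\<bar> \<le> (C + D) * scale z ^ (max k l)"
      using abs_triangle_ineq[of "f z" "g z"] C(3)[of z] D(3)[of z] by (simp add: distrib_right)
  qed
qed

lemma tame_uminus: "tame k f \<Longrightarrow> tame k (\<lambda>z. - f z)"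
  unfolding tame_def by auto

lemma tame_diff: "tame k f \<Longrightarrow> tame l g \<Longrightarrow> tame (max k l) (\<lambda>z. f z - g z)"
  using tame_add[OF _ tame_uminus, of k f l g] by simp

lemma tame_const: "tame 0 (\<lambda>z. c)"
  by (rule tameI[where C="\<bar>c\<bar>"]) auto

lemma tame_sum: "(\<And>i. tame k (f i)) \<Longrightarrow> tame k (\<lambda>z. \<Sum>i\<in>I. f i z)"
proof (induction I rule: infinite_finite_induct)
  case (insert i I)
  then show ?case using tame_add[of k "f i" k "\<lambda>z. \<Sum>i\<in>I. f i z"] by simp
qed (auto intro: tame_mono[OF tame_const])

lemma tame_bounded:
  assumes "f \<in> borel_measurable (borel \<Otimes>\<^sub>M borel)" "0 \<le> C" "\<And>x t. \<bar>f (x, t)\<bar> \<le> C * \<alpha> t ^ k"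
  shows "tame k f"
proof (rule tameI[OF assms(1,2)])
  fix z
  have "\<alpha> (snd z) ^ k \<le> scale z ^ k"
    using \<alpha>_pos[of "snd z"] by (intro power_mono) (auto simp: scale_def)
  then have "C * \<alpha> (snd z) ^ k \<le> C * scale z ^ k" using assms(2) by (rule mult_left_mono)
  with assms(3)[of "fst z" "snd z"] show "\<bar>f z\<bar> \<le> C * scale z ^ k" by simp
qed

lemma tame_u: "tame 1 (\<lambda>z. u z $ i)"
proof (rule tameI[where C=1])
  fix z
  show "\<bar>u z $ i\<bar> \<le> 1 * scale z ^ 1"
    using u_le[of z i] \<alpha>_pos[of "snd z"] real_sqrt_ge_zero[OF abs_ge_zero[of "q z"]]
    unfolding scale_def mult_1 power_one_right by linarith
qed auto

lemma tame_q: "tame 2 q"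
proof (rule tameI[where C=1])
  fix z
  have "\<bar>q z\<bar> = sqrt \<bar>q z\<bar> ^ 2" by simp
  also have "\<dots> \<le> scale z ^ 2"
    using \<alpha>_pos[of "snd z"] by (intro power_mono) (auto simp: scale_def)
  finally show "\<bar>q z\<bar> \<le> 1 * scale z ^ 2" by simp
qed auto

lemma tame_S: "tame 2 (S i j)"
proof -
  have "tame (max (1 + 1) 2) (\<lambda>z. u z $ i * u z $ j + (if i = j then q z else 0))"
    using tame_q tame_mono[OF tame_const, of 2 0] by (intro tame_add tame_mult tame_u) (cases "i = j"; simp)
  moreover have "max (1 + 1) 2 = (2 :: nat)" by simp
  ultimately show ?thesis by (simp only: S_def[abs_def])
qed

lemma tame_integrable:
  assumes f: "tame k f" and k: "k \<le> 3"
  shows "integrable (cyl_measure T) f"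
proof -
  obtain C where C: "f \<in> borel_measurable (borel \<Otimes>\<^sub>M borel)" "0 \<le> C" "\<And>z. \<bar>f z\<bar> \<le> C * scale z ^ 3"
    by (rule tameE[OF tame_mono[OF f k]]) (rule that)
  show ?thesis
  proof (rule Bochner_Integration.integrable_bound)
    show "integrable (cyl_measure T) (\<lambda>z. C * (27 * (\<alpha> (snd z) ^ 3 + \<Gamma> z)))"
      by (intro integrable_mult_right Bochner_Integration.integrable_add \<alpha>_integrable_cyl \<Gamma>_integrable)
    show "f \<in> borel_measurable (cyl_measure T)" using C(1) by (simp add: cyl_measurable_iff)
    show "AE z in cyl_measure T. norm (f z) \<le> norm (C * (27 * (\<alpha> (snd z) ^ 3 + \<Gamma> z)))"
    proof (rule AE_I2)
      fix z
      define a b c where "a = \<alpha> (snd z)" and "b = norm (u z)" and "c = sqrt \<bar>q z\<bar>"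
      define m where "m = max a (max b c)"
      have pos: "0 \<le> a" "0 \<le> b" "0 \<le> c" using \<alpha>_pos[of "snd z"] by (auto simp: a_def b_def c_def)
      \<comment> \<open>The sum of three terms is at most three times their maximum; this is the
        origin of the constant 27.\<close>
      have "scale z ^ 3 \<le> (3 * m) ^ 3"
        using pos by (intro power_mono) (auto simp: scale_def m_def a_def b_def c_def)
      also have "\<dots> = 27 * m ^ 3" by (simp add: power3_eq_cube)
      also have "m ^ 3 \<le> a ^ 3 + b ^ 3 + c ^ 3" using pos by (auto simp: m_def max_def)
      finally have "scale z ^ 3 \<le> 27 * (\<alpha> (snd z) ^ 3 + \<Gamma> z)" by (simp add: \<Gamma>_def a_def b_def c_def)
      then have "C * scale z ^ 3 \<le> C * (27 * (\<alpha> (snd z) ^ 3 + \<Gamma> z))" using C(2) by (rule mult_left_mono)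
      with C(3)[of z] show "norm (f z) \<le> norm (C * (27 * (\<alpha> (snd z) ^ 3 + \<Gamma> z)))" by simp
    qed
  qed
qed

text \<open>Stronger than \<open>tame\<close>: controlled by the slice norm alone, uniformly in
  \<open>x\<close>, and continuous and periodic in \<open>x\<close>. Convolved fields and test
  functions are of this kind, and only such factors can absorb a mollifier.\<close>

definition subcritical :: "nat \<Rightarrow> ((real^'d) \<times> real \<Rightarrow> real) \<Rightarrow> bool" where
  "subcritical k F \<longleftrightarrow> F \<in> borel_measurable (borel \<Otimes>\<^sub>M borel) \<and> (\<exists>C\<ge>0. \<forall>x t. \<bar>F (x, t)\<bar> \<le> C * \<alpha> t ^ k) \<and>
     (\<forall>t. continuous_on UNIV (\<lambda>x. F (x, t)) \<and> lattice_periodic (\<lambda>x. F (x, t)))"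

lemma subcritical_tame: "subcritical k F \<Longrightarrow> tame k F"
  unfolding subcritical_def by (auto intro: tame_bounded)

lemma subcritical_mult:
  assumes f: "subcritical k f" and g: "subcritical l g"
  shows "subcritical (k + l) (\<lambda>z. f z * g z)"
proof -
  obtain C where C: "0 \<le> C" "\<And>x t. \<bar>f (x, t)\<bar> \<le> C * \<alpha> t ^ k" using f unfolding subcritical_def by blast
  obtain D where D: "0 \<le> D" "\<And>x t. \<bar>g (x, t)\<bar> \<le> D * \<alpha> t ^ l" using g unfolding subcritical_def by blast
  have "\<bar>f (x, t) * g (x, t)\<bar> \<le> (C * D) * \<alpha> t ^ (k + l)" for x t
  proof -
    have "\<bar>f (x, t)\<bar> * \<bar>g (x, t)\<bar> \<le> (C * \<alpha> t ^ k) * (D * \<alpha> t ^ l)"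
      using C D \<alpha>_pos[of t] by (intro mult_mono) auto
    then show ?thesis by (simp add: abs_mult power_add ac_simps)
  qed
  moreover have "0 \<le> C * D" using C D by simp
  ultimately show ?thesis
    using f g unfolding subcritical_def lattice_periodic_def
    by (auto intro!: borel_measurable_times continuous_on_mult)
qed

lemma subcritical_add:
  assumes f: "subcritical k f" and g: "subcritical k g"
  shows "subcritical k (\<lambda>z. f z + g z)"
proof -
  obtain C where C: "0 \<le> C" "\<And>x t. \<bar>f (x, t)\<bar> \<le> C * \<alpha> t ^ k" using f unfolding subcritical_def by blast
  obtain D where D: "0 \<le> D" "\<And>x t. \<bar>g (x, t)\<bar> \<le> D * \<alpha> t ^ k" using g unfolding subcritical_def by blast
  have "\<bar>f (x, t) + g (x, t)\<bar> \<le> (C + D) * \<alpha> t ^ k" for x t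
    using abs_triangle_ineq[of "f (x, t)" "g (x, t)"] C(2)[of x t] D(2)[of x t] by (simp add: distrib_right)
  moreover have "0 \<le> C + D" using C D by simp
  ultimately show ?thesis
    using f g unfolding subcritical_def lattice_periodic_def
    by (auto intro!: borel_measurable_add continuous_on_add)
qed

lemma subcritical_cmult: "subcritical k f \<Longrightarrow> subcritical k (\<lambda>z. c * f z)"
proof -
  assume f: "subcritical k f"
  obtain C where C: "0 \<le> C" "\<And>x t. \<bar>f (x, t)\<bar> \<le> C * \<alpha> t ^ k" using f unfolding subcritical_def by blast
  have "\<bar>c * f (x, t)\<bar> \<le> (\<bar>c\<bar> * C) * \<alpha> t ^ k" for x t
    using mult_left_mono[OF C(2)[of x t], of "\<bar>c\<bar>"] by (simp add: abs_mult mult.assoc)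
  moreover have "0 \<le> \<bar>c\<bar> * C" using C by simp
  ultimately show ?thesis
    using f unfolding subcritical_def lattice_periodic_def
    by (auto intro!: borel_measurable_times continuous_on_mult)
qed

lemma subcritical_sum: "(\<And>i. i \<in> I \<Longrightarrow> subcritical k (f i)) \<Longrightarrow> subcritical k (\<lambda>z. \<Sum>i\<in>I. f i z)"
proof (induction I rule: infinite_finite_induct)
  case (insert i I)
  then show ?case using subcritical_add[of k "f i" "\<lambda>z. \<Sum>i\<in>I. f i z"] by simp
qed (auto simp: subcritical_def lattice_periodic_def intro: exI[of _ 0])

lemma subcritical_cv:
  assumes K: "smooth_periodic K" and f: "\<And>t. integrable cell_measure (\<lambda>x. f (x, t))"
    and m: "\<And>t. (LINT x|cell_measure. \<bar>f (x, t)\<bar>) \<le> c * \<alpha> t ^ k" and c: "0 \<le> c"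
    and fm: "f \<in> borel_measurable (borel \<Otimes>\<^sub>M borel)"
  shows "subcritical k (cv K f)"
proof -
  obtain C where C: "0 \<le> C" "\<And>x t. \<bar>cv K f (x, t)\<bar> \<le> C * \<alpha> t ^ k" by (rule cv_bound_exists[OF K f m c]) (rule that)
  show ?thesis
    unfolding subcritical_def
    using cv_measurable[OF smooth_periodic_measurable[OF K] fm] C C1_periodicD(1,2)[OF cv_C1[OF K f]] by blast
qed

lemma subcritical_cv_u: "smooth_periodic K \<Longrightarrow> subcritical 1 (cv K (\<lambda>z. u z $ j))"
  using section_integral_bounds(1) by (intro subcritical_cv[where c=2] section_integrable) auto

lemma subcritical_cv_uu: "smooth_periodic K \<Longrightarrow> subcritical 2 (cv K (\<lambda>z. u z $ i * u z $ j))"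
  using section_integral_bounds(2) by (intro subcritical_cv[where c=2] section_integrable) auto

lemma subcritical_cv_q: "smooth_periodic K \<Longrightarrow> subcritical 2 (cv K q)"
  using section_integral_bounds(3) by (intro subcritical_cv[where c=2] section_integrable) auto

lemma subcritical_cv_S: "smooth_periodic K \<Longrightarrow> subcritical 2 (cv K (S i j))"
  using section_integral_bounds(4) by (intro subcritical_cv[where c=4] section_integrable) auto

lemma subcritical_test:
  assumes \<phi>: "test_function T \<phi>"
  shows "subcritical 0 \<phi>" "subcritical 0 (pd_time \<phi>)" "subcritical 0 (pd_space i \<phi>)"
proof -
  have A: "subcritical 0 \<phi>" if \<phi>: "test_function T \<phi>" for \<phi>
  proof -
    obtain B where "0 \<le> B" "\<And>z. \<bar>\<phi> z\<bar> \<le> B" by (rule test_function_bounded[OF \<phi>]) (rule that)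
    then show ?thesis
      unfolding subcritical_def
      using test_function_measurable[OF \<phi>] test_function_continuous_section[OF \<phi>] test_function_periodic[OF \<phi>]
      by auto
  qed
  have "pd_time \<phi> = dd (0, 1) \<phi>" "pd_space i \<phi> = dd (axis i 1, 0) \<phi>"
    using test_function_pd_time[OF \<phi>] test_function_pd_space[OF \<phi>] by blast+
  then show "subcritical 0 \<phi>" "subcritical 0 (pd_time \<phi>)" "subcritical 0 (pd_space i \<phi>)"
    using A[OF \<phi>] A[OF test_function_dd[OF \<phi>]] by simp_all
qed

text \<open>\<open>G K j\<close> is the weak time derivative of the \<open>j\<close>-th component of the velocity convolved with \<open>K\<close>.\<close>
definition G :: "(real^'d \<Rightarrow> real) \<Rightarrow> 'd \<Rightarrow> (real^'d) \<times> real \<Rightarrow> real" where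
  "G K j z = - (\<Sum>i\<in>UNIV. cv (pd i K) (S i j) z)"

lemma subcritical_G: "smooth_periodic K \<Longrightarrow> subcritical 2 (G K j)"
  using subcritical_cmult[OF subcritical_sum[of UNIV 2 "\<lambda>i. cv (pd i K) (S i j)"], of "-1"]
  by (simp add: G_def[abs_def] subcritical_cv_S smooth_periodic_dd)

section \<open>Product rules in space-time\<close>

text \<open>The one-dimensional product rule at each fixed \<open>x\<close>, integrated over
  \<open>x\<close>.\<close>

lemma time_identity_kernels:
  fixes j :: 'd
  assumes K: "smooth_periodic K" and K': "smooth_periodic K'" and \<phi>: "test_function T \<phi>"
  defines "v \<equiv> \<lambda>z. u z $ j"
  shows "(LINT z|cyl_measure T. cv K v z * (cv K' v z * pd_time \<phi> z))
     = - (LINT z|cyl_measure T. (G K j z * cv K' v z + cv K v z * G K' j z) * \<phi> z)"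
proof -
  note t = subcritical_tame
  note U = t[OF subcritical_cv_u[OF K, of j, folded v_def]] t[OF subcritical_cv_u[OF K', of j, folded v_def]]
  note GG = t[OF subcritical_G[OF K, of j]] t[OF subcritical_G[OF K', of j]]
  note P = subcritical_test[OF \<phi>, THEN t]
  have i1: "integrable (cyl_measure T) (\<lambda>z. cv K v z * (cv K' v z * pd_time \<phi> z))"
    by (rule tame_integrable, (rule tame_mult U P)+, simp)
  have i2: "integrable (cyl_measure T) (\<lambda>z. (G K j z * cv K' v z + cv K v z * G K' j z) * \<phi> z)"
    by (rule tame_integrable, (rule tame_mult tame_add U P GG)+, simp)
  have "(LINT t|time_measure T. cv K v (x, t) * (cv K' v (x, t) * pd_time \<phi> (x, t)))
     = - (LINT t|time_measure T. (G K j (x, t) * cv K' v (x, t) + cv K v (x, t) * G K' j (x, t)) * \<phi> (x, t))" for x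
    using weak_derivative_product[OF mollifier T_pos weak_time_derivative[OF K, of j x, folded v_def]
      weak_time_derivative[OF K', of j x, folded v_def] test_function_time_test(1)[OF \<phi>, of x]]
    unfolding test_function_time_test(2)[OF \<phi>] G_def by (simp only: mult.assoc)
  then show ?thesis
    unfolding cyl_integral_fst(1)[OF i1] cyl_integral_fst(1)[OF i2] by simp
qed

text \<open>On each slice this is \<open>conv_approximation\<close>. The majorant in time comes from
  the pairing bound independent of \<open>n\<close>; the condition \<open>k + l \<le> 3\<close> is
  what the integrability of \<open>\<alpha> t ^ 3\<close> permits.\<close>

lemma cv_approximation:
  assumes fm: "f \<in> borel_measurable (borel \<Otimes>\<^sub>M borel)" and f: "\<And>t. integrable cell_measure (\<lambda>x. f (x, t))"
    and m: "\<And>t. (LINT x|cell_measure. \<bar>f (x, t)\<bar>) \<le> c * \<alpha> t ^ k" and c: "0 \<le> c"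
    and F: "subcritical l F" and kl: "k + l \<le> 3"
  shows "(\<lambda>n. LINT t|time_measure T. LINT x|cell_measure. cv (torus_kernel \<rho> (1 / real (Suc n))) f (x, t) * F (x, t))
    \<longlonglongrightarrow> (LINT t|time_measure T. LINT x|cell_measure. f (x, t) * F (x, t))"
proof -
  obtain C where C: "0 \<le> C" "\<And>x t. \<bar>F (x, t)\<bar> \<le> C * \<alpha> t ^ l" using F unfolding subcritical_def by blast
  have Fc: "continuous_on UNIV (\<lambda>x. F (x, t))" "lattice_periodic (\<lambda>x. F (x, t))" for t
    using F unfolding subcritical_def by blast+
  have [measurable]: "F \<in> borel_measurable (borel \<Otimes>\<^sub>M borel)" "f \<in> borel_measurable (borel \<Otimes>\<^sub>M borel)"
    using F fm unfolding subcritical_def by blast+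
  define K where "K n = torus_kernel \<rho> (1 / real (Suc n))" for n
  have [measurable]: "K n \<in> borel_measurable borel" for n
    unfolding K_def by (intro smooth_periodic_measurable torus_kernel_smooth[OF mollifier]) simp
  have "(\<lambda>n. LINT t|time_measure T. LINT x|cell_measure. cv (K n) f (x, t) * F (x, t))
    \<longlonglongrightarrow> (LINT t|time_measure T. LINT x|cell_measure. f (x, t) * F (x, t))"
  proof (rule integral_dominated_convergence[where w="\<lambda>t. C * c * \<alpha> t ^ 3"])
    show "integrable (time_measure T) (\<lambda>t. C * c * \<alpha> t ^ 3)" using \<alpha>_integrable by simp
    show "AE t in time_measure T. (\<lambda>n. LINT x|cell_measure. cv (K n) f (x, t) * F (x, t))
       \<longlonglongrightarrow> (LINT x|cell_measure. f (x, t) * F (x, t))"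
      unfolding K_def cv_def fst_conv snd_conv by (intro AE_I2) (rule conv_approximation[OF mollifier f Fc])
    show "AE t in time_measure T. norm (LINT x|cell_measure. cv (K n) f (x, t) * F (x, t)) \<le> C * c * \<alpha> t ^ 3" for n
    proof (rule AE_I2)
      fix t
      have "\<bar>LINT x|cell_measure. cv (K n) f (x, t) * F (x, t)\<bar> \<le> (C * \<alpha> t ^ l) * (LINT x|cell_measure. \<bar>f (x, t)\<bar>)"
        using conv_pairing_bound[OF mollifier _ f Fc C(2), of "1 / real (Suc n)" t] unfolding K_def cv_def by simp
      also have "\<dots> \<le> (C * \<alpha> t ^ l) * (c * \<alpha> t ^ k)"
        using C(1) \<alpha>_pos[of t] by (intro mult_left_mono m) auto
      also have "\<dots> = C * c * \<alpha> t ^ (k + l)" by (simp add: power_add)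
      also have "\<dots> \<le> C * c * \<alpha> t ^ 3" using C(1) c by (intro mult_left_mono \<alpha>_power_le kl) auto
      finally show "norm (LINT x|cell_measure. cv (K n) f (x, t) * F (x, t)) \<le> C * c * \<alpha> t ^ 3" by simp
    qed
  qed measurable
  then show ?thesis by (simp add: K_def)
qed

text \<open>Take \<open>KK n\<close> as one of the two kernels and let \<open>n\<close> tend to
  infinity. In \<open>G (KK n) j\<close> the derivative falls on the kernel that concentrates, so it
  is first moved by parts onto \<open>U z * \<phi> z\<close>; each remaining term then pairs a
  mollified rough field with a subcritical factor.\<close>

lemma time_identity_mixed:
  fixes j :: 'd
  assumes K: "smooth_periodic K" and \<phi>: "test_function T \<phi>"
  defines "U \<equiv> cv K (\<lambda>z. u z $ j)"
  shows "(LINT z|cyl_measure T. u z $ j * (U z * pd_time \<phi> z))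
    = - (LINT z|cyl_measure T. (\<Sum>i\<in>UNIV. S i j z * (cv (pd i K) (\<lambda>z. u z $ j) z * \<phi> z + pd_space i \<phi> z * U z)))
      - (LINT z|cyl_measure T. u z $ j * (G K j z * \<phi> z))"
proof -
  define v where "v = (\<lambda>z. u z $ j)"
  define KK where "KK n = torus_kernel \<rho> (1 / real (Suc n))" for n
  have KK: "smooth_periodic (KK n)" for n unfolding KK_def by (rule torus_kernel_smooth[OF mollifier]) simp
  note D = smooth_periodic_dd
  note t = subcritical_tame
  \<comment> \<open>The \<open>i\<close>-th derivative of \<open>U z * \<phi> z\<close>, recorded in
    \<open>H1\<close>.\<close>
  define H where "H i z = cv (pd i K) v z * \<phi> z + pd_space i \<phi> z * U z" for i z
  have sU: "subcritical 1 U" unfolding U_def by (rule subcritical_cv_u[OF K])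
  have sDU: "subcritical 1 (cv (pd i K) v)" for i unfolding v_def by (rule subcritical_cv_u[OF D[OF K]])
  have sG: "subcritical 2 (G K j)" by (rule subcritical_G[OF K])
  note P = subcritical_test[OF \<phi>]
  have sH: "subcritical 1 (H i)" for i
  proof -
    have "subcritical (1 + 0) (\<lambda>z. cv (pd i K) v z * \<phi> z)" "subcritical (0 + 1) (\<lambda>z. pd_space i \<phi> z * U z)"
      by (rule subcritical_mult[OF sDU P(1)], rule subcritical_mult[OF P(3) sU])
    then show ?thesis unfolding H_def[abs_def] by (intro subcritical_add) simp_all
  qed
  have sUt: "subcritical 1 (\<lambda>z. U z * pd_time \<phi> z)" using subcritical_mult[OF sU P(2)] by simp
  have sUp: "subcritical 1 (\<lambda>z. U z * \<phi> z)" using subcritical_mult[OF sU P(1)] by simp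
  have sGp: "subcritical 2 (\<lambda>z. G K j z * \<phi> z)" using subcritical_mult[OF sG P(1)] by simp
  have H1: "C1_periodic (\<lambda>x. U (x, t) * \<phi> (x, t)) (\<lambda>i x. H i (x, t))" for t
    using C1_periodic_mult[OF cv_C1[OF K section_integrable(1)[where t=t and i=j]] test_function_C1[OF \<phi>, where t=t]]
    by (simp add: H_def U_def v_def)
  have tv: "tame 1 (cv (KK n) v)" for n unfolding v_def by (rule t[OF subcritical_cv_u[OF KK]])
  have tS: "tame 2 (cv (KK n) (S i j))" "tame 2 (cv (pd i (KK n)) (S i j))" for n i
    by (rule t[OF subcritical_cv_S[OF KK]], rule t[OF subcritical_cv_S[OF D[OF KK]]])
  have tG: "tame 2 (G (KK n) j)" for n by (rule t[OF subcritical_G[OF KK]])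
  let ?I = "\<lambda>f. LINT t|time_measure T. LINT x|cell_measure. f (x, t) :: real"
  have I: "(LINT z|cyl_measure T. f z) = ?I f" if "tame k f" "k \<le> 3" for f k
    by (rule cyl_integral_snd(1)[OF tame_integrable[OF that]])
  have step: "?I (\<lambda>z. cv (KK n) v z * (U z * pd_time \<phi> z))
      = - (\<Sum>i\<in>UNIV. ?I (\<lambda>z. cv (KK n) (S i j) z * H i z)) - ?I (\<lambda>z. cv (KK n) v z * (G K j z * \<phi> z))" for n
  proof -
    have t1: "tame (2 + 1) (\<lambda>z. G (KK n) j z * (U z * \<phi> z))" by (rule tame_mult[OF tG t[OF sUp]])
    have t2: "tame (1 + 2) (\<lambda>z. cv (KK n) v z * (G K j z * \<phi> z))" by (rule tame_mult[OF tv t[OF sGp]])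
    have t3: "tame (1 + 1) (\<lambda>z. cv (KK n) v z * (U z * pd_time \<phi> z))" by (rule tame_mult[OF tv t[OF sUt]])
    have t4: "tame (2 + 1) (\<lambda>z. cv (pd i (KK n)) (S i j) z * (U z * \<phi> z))" for i by (rule tame_mult[OF tS(2) t[OF sUp]])
    have t5: "tame (2 + 1) (\<lambda>z. cv (KK n) (S i j) z * H i z)" for i by (rule tame_mult[OF tS(1) t[OF sH]])
    have "(LINT z|cyl_measure T. cv (KK n) v z * (U z * pd_time \<phi> z))
      = - (LINT z|cyl_measure T. G (KK n) j z * (U z * \<phi> z) + cv (KK n) v z * (G K j z * \<phi> z))"
      using time_identity_kernels[OF KK K \<phi>, of n j] by (simp add: v_def U_def distrib_right mult.assoc)
    also have "\<dots> = - (LINT z|cyl_measure T. G (KK n) j z * (U z * \<phi> z)) - (LINT z|cyl_measure T. cv (KK n) v z * (G K j z * \<phi> z))"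
      using tame_integrable[OF t1] tame_integrable[OF t2] by simp
    also have "(LINT z|cyl_measure T. G (KK n) j z * (U z * \<phi> z))
      = - (\<Sum>i\<in>UNIV. LINT z|cyl_measure T. cv (pd i (KK n)) (S i j) z * (U z * \<phi> z))"
      unfolding G_def using tame_integrable[OF t4] by (simp add: sum_distrib_right)
    also have "(\<Sum>i\<in>UNIV. LINT z|cyl_measure T. cv (pd i (KK n)) (S i j) z * (U z * \<phi> z))
      = - (\<Sum>i\<in>UNIV. LINT z|cyl_measure T. cv (KK n) (S i j) z * H i z)"
      unfolding sum_negf[symmetric]
    proof (rule sum.cong, rule refl)
      fix i
      have "(LINT x|cell_measure. cv (pd i (KK n)) (S i j) (x, t) * (U (x, t) * \<phi> (x, t)))
         = - (LINT x|cell_measure. cv (KK n) (S i j) (x, t) * H i (x, t))" for t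
        by (rule integral_by_parts[OF cv_C1[OF KK section_integrable(4)] H1])
      then show "(LINT z|cyl_measure T. cv (pd i (KK n)) (S i j) z * (U z * \<phi> z)) = - (LINT z|cyl_measure T. cv (KK n) (S i j) z * H i z)"
        using I[OF t4[of i]] I[OF t5[of i]] by simp
    qed
    finally show ?thesis
      using I[OF t2] I[OF t3] I[OF t5] by simp
  qed
  \<comment> \<open>The orders are 1 + 1 here and 2 + 1 and 1 + 2 on the other side, so all three
    limits are within reach of \<open>cv_approximation\<close>.\<close>
  have "(\<lambda>n. ?I (\<lambda>z. cv (KK n) v z * (U z * pd_time \<phi> z))) \<longlonglongrightarrow> ?I (\<lambda>z. v z * (U z * pd_time \<phi> z))"
    unfolding KK_def v_def
    using section_integral_bounds(1) by (intro cv_approximation[where c=2 and k=1, OF _ _ _ _ sUt] section_integrable) auto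
  moreover have "(\<lambda>n. - (\<Sum>i\<in>UNIV. ?I (\<lambda>z. cv (KK n) (S i j) z * H i z)) - ?I (\<lambda>z. cv (KK n) v z * (G K j z * \<phi> z)))
     \<longlonglongrightarrow> - (\<Sum>i\<in>UNIV. ?I (\<lambda>z. S i j z * H i z)) - ?I (\<lambda>z. v z * (G K j z * \<phi> z))"
    unfolding KK_def v_def
    using section_integral_bounds(1,4)
    by (intro tendsto_diff tendsto_minus tendsto_sum cv_approximation[where c=4 and k=2, OF _ _ _ _ sH]
        cv_approximation[where c=2 and k=1, OF _ _ _ _ sGp] section_integrable) auto
  ultimately have lim: "?I (\<lambda>z. v z * (U z * pd_time \<phi> z))
     = - (\<Sum>i\<in>UNIV. ?I (\<lambda>z. S i j z * H i z)) - ?I (\<lambda>z. v z * (G K j z * \<phi> z))"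
    unfolding step by (rule LIMSEQ_unique)
  have tv': "tame 1 v" unfolding v_def by (rule tame_u)
  have t1: "tame (1 + 1) (\<lambda>z. v z * (U z * pd_time \<phi> z))" by (rule tame_mult[OF tv' t[OF sUt]])
  have t2: "tame (2 + 1) (\<lambda>z. S i j z * H i z)" for i by (rule tame_mult[OF tame_S t[OF sH]])
  have t3: "tame (1 + 2) (\<lambda>z. v z * (G K j z * \<phi> z))" by (rule tame_mult[OF tv' t[OF sGp]])
  have "(LINT z|cyl_measure T. (\<Sum>i\<in>UNIV. S i j z * H i z)) = (\<Sum>i\<in>UNIV. LINT z|cyl_measure T. S i j z * H i z)"
    using tame_integrable[OF t2] by simp
  then show ?thesis
    using lim I[OF t1] I[OF t2] I[OF t3] by (simp add: H_def v_def)
qed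

end

section \<open>The energy identity\<close>

text \<open>Algebra at a single point. In the application \<open>U\<close>, \<open>DU\<close> are
  the mollified velocity and its gradient, \<open>M\<close> the differentiated mollified products,
  \<open>r\<close>, \<open>Dr\<close> the mollified pressure and its gradient, \<open>f\<close>,
  \<open>p\<close> the test function and its gradient, and \<open>B\<close> is half of |U|^2. The
  right side then reads u \<bullet> \<nabla>((r - B) f) - U \<bullet> \<nabla>(r f), which has
  integral 0 on a solenoidal slice.\<close>

lemma energy_identity_pointwise:
  fixes u U w Dr p G :: "'d::finite \<Rightarrow> real" and DU M S :: "'d \<Rightarrow> 'd \<Rightarrow> real" and q r f A B :: real
  assumes w: "\<And>j. w j = u j - U j" and S: "\<And>i j. S i j = u i * u j + (if i = j then q else 0)"
    and G: "\<And>j. G j = - (\<Sum>i\<in>UNIV. M i j) - Dr j" and div: "(\<Sum>i\<in>UNIV. DU i i) = 0"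
    and A: "A = (\<Sum>j\<in>UNIV. u j * U j)"
  shows "- (\<Sum>j\<in>UNIV. \<Sum>i\<in>UNIV. S i j * (DU i j * f + p i * U j)) - (\<Sum>j\<in>UNIV. w j * (G j * f))
      + (\<Sum>i\<in>UNIV. ((A - B) * u i + r * u i + q * U i - r * U i) * p i)
      + ((\<Sum>j\<in>UNIV. w j * (\<Sum>i\<in>UNIV. DU i i * U j + DU i j * U i - M i j))
         + (\<Sum>i\<in>UNIV. \<Sum>j\<in>UNIV. w i * w j * DU i j)) * f
    = (\<Sum>i\<in>UNIV. u i * ((Dr i - (\<Sum>j\<in>UNIV. DU i j * U j)) * f + p i * (r - B)))
      - (\<Sum>i\<in>UNIV. U i * (Dr i * f + p i * r))"
proof -
  define Q1 where "Q1 = (\<Sum>j\<in>UNIV. \<Sum>i\<in>UNIV. u i * u j * DU i j)"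
  define Q2 where "Q2 = (\<Sum>j\<in>UNIV. \<Sum>i\<in>UNIV. w j * M i j)"
  define Q3 where "Q3 = (\<Sum>j\<in>UNIV. \<Sum>i\<in>UNIV. w j * (DU i j * U i))"
  define Q4 where "Q4 = (\<Sum>j\<in>UNIV. \<Sum>i\<in>UNIV. w i * w j * DU i j)"
  define Q5 where "Q5 = (\<Sum>j\<in>UNIV. \<Sum>i\<in>UNIV. u i * (DU i j * U j))"
  define up where "up = (\<Sum>i\<in>UNIV. u i * p i)"
  define Up where "Up = (\<Sum>i\<in>UNIV. U i * p i)"
  define uD where "uD = (\<Sum>i\<in>UNIV. u i * Dr i)"
  define UD where "UD = (\<Sum>i\<in>UNIV. U i * Dr i)"
  have h1: "(\<Sum>j\<in>UNIV. \<Sum>i\<in>UNIV. S i j * (DU i j * f + p i * U j)) = f * Q1 + A * up + q * Up"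
  proof -
    have "(\<Sum>j\<in>UNIV. \<Sum>i\<in>UNIV. S i j * (DU i j * f + p i * U j))
      = (\<Sum>j\<in>UNIV. \<Sum>i\<in>UNIV. f * (u i * u j * DU i j) + (u j * U j) * (u i * p i)
          + (if i = j then q * f * DU j j + q * (U j * p j) else 0))"
      by (intro sum.cong refl) (auto simp: S algebra_simps)
    also have "\<dots> = (\<Sum>j\<in>UNIV. \<Sum>i\<in>UNIV. f * (u i * u j * DU i j)) + (\<Sum>j\<in>UNIV. \<Sum>i\<in>UNIV. (u j * U j) * (u i * p i))
        + (\<Sum>j\<in>UNIV. q * f * DU j j + q * (U j * p j))"
      by (simp add: sum.distrib)
    also have "(\<Sum>j\<in>UNIV. \<Sum>i\<in>UNIV. f * (u i * u j * DU i j)) = f * Q1"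
      by (simp add: Q1_def sum_distrib_left)
    also have "(\<Sum>j\<in>UNIV. \<Sum>i\<in>UNIV. (u j * U j) * (u i * p i)) = A * up"
      unfolding A up_def by (rule sum_product[symmetric])
    also have "(\<Sum>j\<in>UNIV. q * f * DU j j + q * (U j * p j)) = q * f * (\<Sum>i\<in>UNIV. DU i i) + q * Up"
      by (simp add: sum.distrib Up_def sum_distrib_left)
    finally show ?thesis by (simp add: div)
  qed
  have wD: "(\<Sum>j\<in>UNIV. w j * Dr j) = uD - UD"
    by (simp add: w left_diff_distrib sum_subtractf uD_def UD_def)
  have h2: "(\<Sum>j\<in>UNIV. w j * (G j * f)) = - f * Q2 - f * (uD - UD)"
  proof -
    have "(\<Sum>j\<in>UNIV. w j * (G j * f)) = (\<Sum>j\<in>UNIV. - (f * (\<Sum>i\<in>UNIV. w j * M i j)) - f * (w j * Dr j))"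
      by (intro sum.cong refl) (simp add: G algebra_simps sum_distrib_left)
    then show ?thesis by (simp add: sum_subtractf sum_negf sum_distrib_left[symmetric] Q2_def wD)
  qed
  have h3: "(\<Sum>j\<in>UNIV. w j * (\<Sum>i\<in>UNIV. DU i i * U j + DU i j * U i - M i j)) = Q3 - Q2"
  proof -
    have "(\<Sum>j\<in>UNIV. w j * (\<Sum>i\<in>UNIV. DU i i * U j + DU i j * U i - M i j))
      = (\<Sum>j\<in>UNIV. w j * ((\<Sum>i\<in>UNIV. DU i i) * U j) + (\<Sum>i\<in>UNIV. w j * (DU i j * U i)) - (\<Sum>i\<in>UNIV. w j * M i j))"
      by (intro sum.cong refl) (simp add: sum.distrib sum_subtractf sum_distrib_left sum_distrib_right algebra_simps)
    then show ?thesis by (simp add: div sum.distrib sum_subtractf Q3_def Q2_def)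
  qed
  have h4: "(\<Sum>i\<in>UNIV. \<Sum>j\<in>UNIV. w i * w j * DU i j) = Q4"
    unfolding Q4_def by (rule sum.swap)
  \<comment> \<open>Since \<open>U i + w i = u i\<close> and \<open>w j - u j = - U j\<close>, the
    three terms containing \<open>DU\<close> collapse to a single one, linear in
    \<open>u\<close>.\<close>
  have h5: "Q3 + Q4 - Q1 = - Q5"
  proof -
    have "Q3 + Q4 - Q1 = (\<Sum>j\<in>UNIV. \<Sum>i\<in>UNIV. w j * (DU i j * U i) + w i * w j * DU i j - u i * u j * DU i j)"
      by (simp add: Q3_def Q4_def Q1_def sum.distrib sum_subtractf)
    also have "\<dots> = (\<Sum>j\<in>UNIV. \<Sum>i\<in>UNIV. - (u i * (DU i j * U j)))"
      by (intro sum.cong refl) (simp add: w algebra_simps)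
    finally show ?thesis by (simp add: Q5_def sum_negf)
  qed
  have h6: "(\<Sum>i\<in>UNIV. ((A - B) * u i + r * u i + q * U i - r * U i) * p i) = (A - B + r) * up + (q - r) * Up"
  proof -
    have "(\<Sum>i\<in>UNIV. ((A - B) * u i + r * u i + q * U i - r * U i) * p i)
      = (\<Sum>i\<in>UNIV. (A - B + r) * (u i * p i) + (q - r) * (U i * p i))"
      by (intro sum.cong refl) (simp add: algebra_simps)
    then show ?thesis by (simp add: sum.distrib sum_distrib_left[symmetric] up_def Up_def)
  qed
  have h7: "(\<Sum>i\<in>UNIV. u i * ((Dr i - (\<Sum>j\<in>UNIV. DU i j * U j)) * f + p i * (r - B))) = f * uD - f * Q5 + (r - B) * up"
  proof -
    have "(\<Sum>i\<in>UNIV. u i * ((Dr i - (\<Sum>j\<in>UNIV. DU i j * U j)) * f + p i * (r - B)))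
      = (\<Sum>i\<in>UNIV. f * (u i * Dr i) - f * (\<Sum>j\<in>UNIV. u i * (DU i j * U j)) + (r - B) * (u i * p i))"
      by (intro sum.cong refl) (simp add: algebra_simps sum_distrib_left)
    also have "\<dots> = f * uD - f * (\<Sum>i\<in>UNIV. \<Sum>j\<in>UNIV. u i * (DU i j * U j)) + (r - B) * up"
      by (simp add: sum.distrib sum_subtractf sum_distrib_left[symmetric] uD_def up_def)
    also have "(\<Sum>i\<in>UNIV. \<Sum>j\<in>UNIV. u i * (DU i j * U j)) = Q5" unfolding Q5_def by (rule sum.swap)
    finally show ?thesis .
  qed
  have h8: "(\<Sum>i\<in>UNIV. U i * (Dr i * f + p i * r)) = f * UD + r * Up"
  proof -
    have "(\<Sum>i\<in>UNIV. U i * (Dr i * f + p i * r)) = (\<Sum>i\<in>UNIV. f * (U i * Dr i) + r * (U i * p i))"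
      by (intro sum.cong refl) (simp add: algebra_simps)
    then show ?thesis by (simp add: sum.distrib sum_distrib_left[symmetric] UD_def Up_def)
  qed
  have Q1: "Q1 = Q3 + Q4 + Q5" using h5 by simp
  show ?thesis unfolding h1 h2 h3 h4 h6 h7 h8 Q1 by (simp add: algebra_simps)
qed

context euler_fields
begin

lemma cv_S:
  assumes K: "smooth_periodic K"
  shows "cv K (S i j) z = cv K (\<lambda>z. u z $ i * u z $ j) z + (if i = j then cv K q z else 0)"
  using conv_integrable[OF K section_integrable(2)] conv_integrable[OF K section_integrable(3)]
  by (cases "i = j") (simp_all add: cv_def conv_def S_def distrib_left)

lemma G_eq:
  assumes K: "smooth_periodic K"
  shows "G K j z = - (\<Sum>i\<in>UNIV. cv (pd i K) (\<lambda>z. u z $ i * u z $ j) z) - cv (pd j K) q z"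
  unfolding G_def by (simp add: cv_S[OF smooth_periodic_dd[OF K]] sum.distrib)

text \<open>Here \<open>e\<close> is |u|^2/2 - E, and the coefficient of the space derivative is the
  flux (|u|^2/2 + q) u - E U - Q with E and Q the mollified energy and flux. So this is the
  difference of the two energy balances, with \<open>c\<close> the components of
  \<open>C_moll\<close>.\<close>

lemma spatial_identity:
  assumes K: "smooth_periodic K" and \<phi>: "test_function T \<phi>"
  defines "U \<equiv> \<lambda>j. cv K (\<lambda>z. u z $ j)" and "DU \<equiv> \<lambda>i j. cv (pd i K) (\<lambda>z. u z $ j)"
    and "M \<equiv> \<lambda>i j. cv (pd i K) (\<lambda>z. u z $ i * u z $ j)" and "r \<equiv> cv K q"
  defines "w \<equiv> \<lambda>j z. u z $ j - U j z"
    and "e \<equiv> \<lambda>z. (\<Sum>j\<in>UNIV. u z $ j * U j z) - (\<Sum>j\<in>UNIV. U j z * U j z) / 2"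
  defines "c \<equiv> \<lambda>z. (\<Sum>j\<in>UNIV. w j z * (\<Sum>i\<in>UNIV. DU i i z * U j z + DU i j z * U i z - M i j z))
       + (\<Sum>i\<in>UNIV. \<Sum>j\<in>UNIV. w i z * w j z * DU i j z)"
  shows "(LINT z|cyl_measure T. e z * pd_time \<phi> z
      + (\<Sum>i\<in>UNIV. (e z * u z $ i + r z * u z $ i + q z * U i z - r z * U i z) * pd_space i \<phi> z)
      + c z * \<phi> z) = 0"
proof -
  note D = smooth_periodic_dd
  note t = subcritical_tame
  have sU: "subcritical 1 (U j)" for j unfolding U_def by (rule subcritical_cv_u[OF K])
  have tU: "tame 1 (U j)" for j by (rule t[OF sU])
  have tDU: "tame 1 (DU i j)" for i j unfolding DU_def by (rule t[OF subcritical_cv_u[OF D[OF K]]])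
  have tM: "tame 2 (M i j)" for i j unfolding M_def by (rule t[OF subcritical_cv_uu[OF D[OF K]]])
  have tr: "tame 2 r" unfolding r_def by (rule t[OF subcritical_cv_q[OF K]])
  have tG: "tame 2 (G K j)" for j by (rule t[OF subcritical_G[OF K]])
  note tP = subcritical_test[OF \<phi>, THEN t]
  have tw: "tame (max 1 1) (w j)" for j unfolding w_def by (rule tame_diff[OF tame_u tU])
  \<comment> \<open>What the time derivative of \<open>e\<close> becomes once the product rules have
    been applied; \<open>time\<close> below shows that both have the same integral.\<close>
  define d where "d z = - (\<Sum>j\<in>UNIV. \<Sum>i\<in>UNIV. S i j z * (DU i j z * \<phi> z + pd_space i \<phi> z * U j z))
      - (\<Sum>j\<in>UNIV. w j z * (G K j z * \<phi> z))" for z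
  define g where "g z = (\<Sum>i\<in>UNIV. (e z * u z $ i + r z * u z $ i + q z * U i z - r z * U i z) * pd_space i \<phi> z) + c z * \<phi> z" for z
  have half: "(\<Sum>j\<in>UNIV. U j z * U j z) / 2 = (1 / 2) * (\<Sum>j\<in>UNIV. U j z * U j z)" for z by simp
  have te: "tame (max (1 + 1) (0 + (1 + 1))) e" unfolding e_def half
    by (intro tame_diff tame_sum tame_mult tame_u tU tame_const)
  have tc: "tame 3 c" unfolding c_def
    by (rule tame_mono, (rule tame_mult tame_add tame_diff tame_sum tU tDU tM tw)+, simp)
  have ig: "integrable (cyl_measure T) g" unfolding g_def
    by (rule tame_integrable, (rule tame_mult tame_add tame_diff tame_sum tame_u tame_q tU tr tP te tc)+, simp)
  have i1: "integrable (cyl_measure T) (\<lambda>z. \<Sum>i\<in>UNIV. S i j z * (DU i j z * \<phi> z + pd_space i \<phi> z * U j z))" for j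
    by (rule tame_integrable, (rule tame_mult tame_add tame_diff tame_sum tame_S tU tDU tP)+, simp)
  have i2: "integrable (cyl_measure T) (\<lambda>z. u z $ j * (G K j z * \<phi> z))" for j
    by (rule tame_integrable, (rule tame_mult tame_u tG tP)+, simp)
  have i3: "integrable (cyl_measure T) (\<lambda>z. U j z * (G K j z * \<phi> z))" for j
    by (rule tame_integrable, (rule tame_mult tU tG tP)+, simp)
  have i4: "integrable (cyl_measure T) (\<lambda>z. u z $ j * (U j z * pd_time \<phi> z))" for j
    by (rule tame_integrable, (rule tame_mult tame_u tU tP)+, simp)
  have i5: "integrable (cyl_measure T) (\<lambda>z. U j z * (U j z * pd_time \<phi> z))" for j
    by (rule tame_integrable, (rule tame_mult tU tP)+, simp)
  have i6: "integrable (cyl_measure T) (\<lambda>z. e z * pd_time \<phi> z)"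
    by (rule tame_integrable, (rule tame_mult te tP)+, simp)
  have id: "integrable (cyl_measure T) d"
  proof -
    have "integrable (cyl_measure T) (\<lambda>z. w j z * (G K j z * \<phi> z))" for j
      by (rule tame_integrable, (rule tame_mult tw tG tP)+, simp)
    then show ?thesis using i1 unfolding d_def[abs_def] by auto
  qed
  have time: "(LINT z|cyl_measure T. e z * pd_time \<phi> z) = (LINT z|cyl_measure T. d z)"
  proof -
    \<comment> \<open>With two equal kernels both terms of the product rule coincide; the resulting
      2 cancels the 1/2 in \<open>e\<close>.\<close>
    have UU: "(LINT z|cyl_measure T. U j z * (U j z * pd_time \<phi> z)) = - 2 * (LINT z|cyl_measure T. U j z * (G K j z * \<phi> z))" for j
    proof -
      have "(LINT z|cyl_measure T. U j z * (U j z * pd_time \<phi> z)) = - (LINT z|cyl_measure T. 2 * (U j z * (G K j z * \<phi> z)))"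
        using time_identity_kernels[OF K K \<phi>, of j] by (simp add: U_def algebra_simps)
      then show ?thesis by simp
    qed
    have "(LINT z|cyl_measure T. e z * pd_time \<phi> z)
      = (LINT z|cyl_measure T. (\<Sum>j\<in>UNIV. u z $ j * (U j z * pd_time \<phi> z) - (1/2) * (U j z * (U j z * pd_time \<phi> z))))"
      by (intro Bochner_Integration.integral_cong refl)
        (simp add: e_def sum_subtractf sum_distrib_left sum_distrib_right left_diff_distrib sum_divide_distrib mult.assoc)
    also have "\<dots> = (\<Sum>j\<in>UNIV. (LINT z|cyl_measure T. u z $ j * (U j z * pd_time \<phi> z)) - (1/2) * (LINT z|cyl_measure T. U j z * (U j z * pd_time \<phi> z)))"
      using i4 i5 by simp
    also have "\<dots> = (\<Sum>j\<in>UNIV. - (LINT z|cyl_measure T. (\<Sum>i\<in>UNIV. S i j z * (DU i j z * \<phi> z + pd_space i \<phi> z * U j z)))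
      - (LINT z|cyl_measure T. u z $ j * (G K j z * \<phi> z)) + (LINT z|cyl_measure T. U j z * (G K j z * \<phi> z)))"
      unfolding UU using time_identity_mixed[OF K \<phi>] by (simp add: U_def DU_def)
    also have "\<dots> = (\<Sum>j\<in>UNIV. LINT z|cyl_measure T. - (\<Sum>i\<in>UNIV. S i j z * (DU i j z * \<phi> z + pd_space i \<phi> z * U j z))
      - u z $ j * (G K j z * \<phi> z) + U j z * (G K j z * \<phi> z))"
      using i1 i2 i3 by simp
    also have "\<dots> = (LINT z|cyl_measure T. (\<Sum>j\<in>UNIV. - (\<Sum>i\<in>UNIV. S i j z * (DU i j z * \<phi> z + pd_space i \<phi> z * U j z))
      - u z $ j * (G K j z * \<phi> z) + U j z * (G K j z * \<phi> z)))"
      using i1 i2 i3 by (intro Bochner_Integration.integral_sum[symmetric]) auto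
    also have "\<dots> = (LINT z|cyl_measure T. d z)"
      by (intro Bochner_Integration.integral_cong refl)
        (simp add: d_def w_def sum_subtractf sum.distrib sum_negf left_diff_distrib)
    finally show ?thesis .
  qed
  \<comment> \<open>From here on time is frozen, and only incompressibility of the slice, of
    \<open>u\<close> and hence of \<open>U\<close>, is used.\<close>
  have zero: "(LINT x|cell_measure. d (x, t) + g (x, t)) = 0" if sol: "solenoidal_at t" for t
  proof -
    have C1K: "C1_periodic (\<lambda>x. cv K f (x, t)) (\<lambda>i x. cv (pd i K) f (x, t))" if "integrable cell_measure (\<lambda>x. f (x, t))" for f
      by (rule cv_C1[OF K that])
    have CU: "C1_periodic (\<lambda>x. U j (x, t)) (\<lambda>i x. DU i j (x, t))" for j
      unfolding U_def DU_def by (rule C1K[OF section_integrable(1)])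
    have Cr: "C1_periodic (\<lambda>x. r (x, t)) (\<lambda>i x. cv (pd i K) q (x, t))"
      unfolding r_def by (rule C1K[OF section_integrable(3)])
    note C\<phi> = test_function_C1[OF \<phi>, of t]
    define B where "B x = (\<Sum>j\<in>UNIV. U j (x, t) * U j (x, t)) / 2" for x
    have CB: "C1_periodic B (\<lambda>i x. \<Sum>j\<in>UNIV. DU i j (x, t) * U j (x, t))"
    proof -
      have "C1_periodic (\<lambda>x. (1/2) * (\<Sum>j\<in>UNIV. U j (x, t) * U j (x, t)))
        (\<lambda>i x. 0 * (\<Sum>j\<in>UNIV. U j (x, t) * U j (x, t)) + (\<Sum>j\<in>UNIV. DU i j (x, t) * U j (x, t) + DU i j (x, t) * U j (x, t)) * (1/2))"
        by (intro C1_periodic_mult C1_periodic_const C1_periodic_sum CU) simp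
      moreover have "0 * (\<Sum>j\<in>UNIV. U j (x, t) * U j (x, t)) + (\<Sum>j\<in>UNIV. DU i j (x, t) * U j (x, t) + DU i j (x, t) * U j (x, t)) * (1/2)
          = (\<Sum>j\<in>UNIV. DU i j (x, t) * U j (x, t))" for i x
        unfolding sum.distrib by simp
      moreover have "(\<lambda>x. (1/2) * (\<Sum>j\<in>UNIV. U j (x, t) * U j (x, t))) = B" by (simp add: B_def[abs_def])
      ultimately show ?thesis by (simp only:)
    qed
    \<comment> \<open>The gradient of \<open>(r - B) * \<phi>\<close>, to be paired with
      \<open>u\<close> through \<open>solenoidal_at\<close>.\<close>
    define X' where "X' i x = (cv (pd i K) q (x, t) - (\<Sum>j\<in>UNIV. DU i j (x, t) * U j (x, t))) * \<phi> (x, t)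
      + pd_space i \<phi> (x, t) * (r (x, t) - B x)" for i x
    have CX: "C1_periodic (\<lambda>x. (r (x, t) - B x) * \<phi> (x, t)) X'"
      unfolding X'_def[abs_def] by (intro C1_periodic_mult C1_periodic_diff Cr CB C\<phi>)
    \<comment> \<open>The gradient of \<open>r * \<phi>\<close>, paired with the smooth field
      \<open>U\<close> by ordinary integration by parts.\<close>
    define Y' where "Y' i x = cv (pd i K) q (x, t) * \<phi> (x, t) + pd_space i \<phi> (x, t) * r (x, t)" for i x
    have CY: "C1_periodic (\<lambda>x. r (x, t) * \<phi> (x, t)) Y'"
      unfolding Y'_def[abs_def] by (intro C1_periodic_mult Cr C\<phi>)
    \<comment> \<open>Testing the slice with the reflected kernel centred at \<open>x\<close> yields
      the divergence of \<open>U\<close> at each point, not merely almost everywhere.\<close>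
    have div: "(\<Sum>i\<in>UNIV. DU i i (x, t)) = 0" for x
    proof -
      have "(\<Sum>i\<in>UNIV. LINT y|cell_measure. u (y, t) $ i * pd i (\<lambda>y. K (x - y)) y) = 0"
        using sol C1_periodic_smooth[OF smooth_periodic_reflect(1)[OF K, of x]] unfolding solenoidal_at_def by blast
      then show ?thesis
        by (simp add: smooth_periodic_reflect(2)[OF K] DU_def cv_def conv_def mult.commute sum_negf)
    qed
    have pt: "d (x, t) + g (x, t) = (\<Sum>i\<in>UNIV. u (x, t) $ i * X' i x) - (\<Sum>i\<in>UNIV. U i (x, t) * Y' i x)" for x
    proof -
      have "- (\<Sum>j\<in>UNIV. \<Sum>i\<in>UNIV. S i j (x, t) * (DU i j (x, t) * \<phi> (x, t) + pd_space i \<phi> (x, t) * U j (x, t)))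
          - (\<Sum>j\<in>UNIV. w j (x, t) * (G K j (x, t) * \<phi> (x, t)))
        + (\<Sum>i\<in>UNIV. (((\<Sum>j\<in>UNIV. u (x, t) $ j * U j (x, t)) - B x) * u (x, t) $ i + r (x, t) * u (x, t) $ i
             + q (x, t) * U i (x, t) - r (x, t) * U i (x, t)) * pd_space i \<phi> (x, t))
        + ((\<Sum>j\<in>UNIV. w j (x, t) * (\<Sum>i\<in>UNIV. DU i i (x, t) * U j (x, t) + DU i j (x, t) * U i (x, t) - M i j (x, t)))
           + (\<Sum>i\<in>UNIV. \<Sum>j\<in>UNIV. w i (x, t) * w j (x, t) * DU i j (x, t))) * \<phi> (x, t)
        = (\<Sum>i\<in>UNIV. u (x, t) $ i * X' i x) - (\<Sum>i\<in>UNIV. U i (x, t) * Y' i x)"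
        unfolding X'_def Y'_def
        by (rule energy_identity_pointwise[where w="\<lambda>j. w j (x, t)" and u="\<lambda>j. u (x, t) $ j" and U="\<lambda>j. U j (x, t)"
              and Dr="\<lambda>i. cv (pd i K) q (x, t)" and p="\<lambda>i. pd_space i \<phi> (x, t)" and G="\<lambda>j. G K j (x, t)"
              and DU="\<lambda>i j. DU i j (x, t)" and M="\<lambda>i j. M i j (x, t)" and S="\<lambda>i j. S i j (x, t)"
              and q="q (x, t)" and r="r (x, t)" and f="\<phi> (x, t)" and B="B x"])
          (simp_all add: w_def S_def G_eq[OF K] M_def div)
      then show ?thesis by (simp add: d_def g_def c_def e_def B_def)
    qed
    have iu: "integrable cell_measure (\<lambda>x. u (x, t) $ i * X' i x)" for i
    proof -
      obtain b where "0 \<le> b" "\<And>x. \<bar>X' i x\<bar> \<le> b"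
        by (rule periodic_continuous_bounded[OF C1_periodicD(4)[OF CX] C1_periodicD(3)[OF CX]]) (rule that)
      then have "integrable cell_measure (\<lambda>x. X' i x * u (x, t) $ i)"
        using borel_measurable_continuous_onI[OF C1_periodicD(4)[OF CX]]
        by (intro integrable_bounded_mult[OF section_integrable(1)]) auto
      then show ?thesis by (simp add: mult.commute)
    qed
    have iU: "integrable cell_measure (\<lambda>x. U i (x, t) * Y' i x)" "integrable cell_measure (\<lambda>x. DU i i (x, t) * (r (x, t) * \<phi> (x, t)))" for i
      using C1_periodicD[OF CU] C1_periodicD[OF CY]
      by (auto intro!: cell_integrable_periodic continuous_on_mult simp: lattice_periodic_def)
    have "(LINT x|cell_measure. d (x, t) + g (x, t))
      = (\<Sum>i\<in>UNIV. LINT x|cell_measure. u (x, t) $ i * X' i x) - (\<Sum>i\<in>UNIV. LINT x|cell_measure. U i (x, t) * Y' i x)"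
      unfolding pt using iu iU by simp
    also have "(\<Sum>i\<in>UNIV. LINT x|cell_measure. u (x, t) $ i * X' i x) = 0"
      using sol CX unfolding solenoidal_at_def by blast
    also have "(\<Sum>i\<in>UNIV. LINT x|cell_measure. U i (x, t) * Y' i x)
      = - (\<Sum>i\<in>UNIV. LINT x|cell_measure. DU i i (x, t) * (r (x, t) * \<phi> (x, t)))"
      by (simp add: integral_by_parts[OF CU CY] sum_negf)
    also have "(\<Sum>i\<in>UNIV. LINT x|cell_measure. DU i i (x, t) * (r (x, t) * \<phi> (x, t)))
      = (LINT x|cell_measure. (\<Sum>i\<in>UNIV. DU i i (x, t)) * (r (x, t) * \<phi> (x, t)))"
      using iU(2) by (simp add: sum_distrib_right)
    finally show ?thesis by (simp add: div)
  qed
  have "(LINT z|cyl_measure T. d z + g z) = (LINT t|time_measure T. LINT x|cell_measure. d (x, t) + g (x, t))"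
    by (rule cyl_integral_snd(1)) (use id ig in simp)
  also have "\<dots> = (LINT t|time_measure T. 0)"
  proof (rule integral_cong_AE)
    show "(\<lambda>t. LINT x|cell_measure. d (x, t) + g (x, t)) \<in> borel_measurable (time_measure T)"
      using cyl_integral_snd(2)[of T "\<lambda>z. d z + g z"] id ig by auto
    show "AE t in time_measure T. (LINT x|cell_measure. d (x, t) + g (x, t)) = 0"
      using AE_solenoidal by eventually_elim (rule zero)
  qed simp
  finally have "(LINT z|cyl_measure T. d z) + (LINT z|cyl_measure T. g z) = 0" using id ig by simp
  then have "(LINT z|cyl_measure T. e z * pd_time \<phi> z) + (LINT z|cyl_measure T. g z) = 0" by (simp add: time)
  then have "(LINT z|cyl_measure T. e z * pd_time \<phi> z + g z) = 0" using i6 ig by simp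
  then show ?thesis by (simp add: g_def add.assoc)
qed

end

section \<open>Mollified fields as torus convolutions, and the balance for admissible fields\<close>

lemma bounded_linear_axis: "bounded_linear (axis i :: 'b::euclidean_space \<Rightarrow> 'b^'d)"
  unfolding linear_conv_bounded_linear[symmetric]
proof (rule linearI)
  fix x y :: 'b and c :: real
  show "(axis i (x + y) :: 'b^'d) = axis i x + axis i y" "(axis i (c *\<^sub>R x) :: 'b^'d) = c *\<^sub>R axis i x"
    by (simp_all add: axis_def vec_eq_iff)
qed

lemma vec_eq_sum_axis: "(\<Sum>i\<in>UNIV. axis i (v $ i)) = (v :: 'b::euclidean_space^'d)"
proof (rule vec_eq_iff[THEN iffD2], rule allI)
  fix k
  have "(\<Sum>i\<in>UNIV. axis i (v $ i)) $ k = (\<Sum>i\<in>UNIV. if i = k then v $ i else 0)"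
    unfolding sum_component by (intro sum.cong refl) (simp add: axis_def)
  then show "(\<Sum>i\<in>UNIV. axis i (v $ i)) $ k = v $ k" by simp
qed

lemma integrable_vec:
  fixes f :: "'a \<Rightarrow> 'b::euclidean_space^'d"
  assumes "\<And>i. integrable M (\<lambda>x. f x $ i)"
  shows "integrable M f"
proof -
  have "integrable M (\<lambda>x. \<Sum>i\<in>UNIV. axis i (f x $ i))"
    by (intro Bochner_Integration.integrable_sum integrable_bounded_linear[OF bounded_linear_axis] assms)
  then show ?thesis by (simp only: vec_eq_sum_axis)
qed

lemma integral_vec_component:
  fixes f :: "'a \<Rightarrow> 'b::euclidean_space^'d"
  assumes "\<And>i. integrable M (\<lambda>x. f x $ i)"
  shows "(LINT x|M. f x) $ i = (LINT x|M. f x $ i)"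
  using integral_bounded_linear[OF bounded_linear_vec_nth[of i] integrable_vec[OF assms]] by simp

lemma has_vector_derivative_vec:
  fixes f :: "real \<Rightarrow> 'b::euclidean_space^'d"
  assumes "\<And>i. ((\<lambda>s. f s $ i) has_vector_derivative D $ i) F"
  shows "(f has_vector_derivative D) F"
proof -
  have "((\<lambda>s. \<Sum>i\<in>UNIV. axis i (f s $ i)) has_vector_derivative (\<Sum>i\<in>UNIV. axis i (D $ i))) F"
    by (intro has_vector_derivative_sum bounded_linear.has_vector_derivative[OF bounded_linear_axis] assms)
  then show ?thesis by (simp only: vec_eq_sum_axis)
qed

lemma tensor_nth: "tensor a b $ i $ j = a $ i * b $ j"
  by (simp add: tensor_def)

lemma mollify_eq_torus_integral:
  fixes f :: "(real^'d) \<times> real \<Rightarrow> 'b::euclidean_space"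
  assumes \<rho>: "friedrichs_mollifier \<rho>" and l: "0 < l"
    and [measurable]: "f \<in> borel_measurable (borel \<Otimes>\<^sub>M borel)" and per: "lattice_periodic (\<lambda>x. f (x, t))"
  shows "mollify \<rho> l f (x, t) = (LINT y|cell_measure. torus_kernel \<rho> l (x - y) *\<^sub>R f (y, t))"
proof -
  have [measurable]: "scaled \<rho> l \<in> borel_measurable borel" by (rule scaled_measurable[OF \<rho>])
  have "mollify \<rho> l f (x, t) = (LINT y|lebesgue. scaled \<rho> l y *\<^sub>R f (x - y, t))"
    by (simp add: mollify_def scaled_def)
  also have "\<dots> = (LINT y|lborel. scaled \<rho> l y *\<^sub>R f (x - y, t))"
    by (rule integral_completion) measurable
  also have "\<dots> = (LINT y|cell_measure. torus_kernel \<rho> l (x - y) *\<^sub>R f (y, t))"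
    by (rule mollification_eq_torus_integral[OF \<rho> l _ per]) measurable
  finally show ?thesis .
qed

lemma regular_dist_eq:
  assumes f: "f \<in> borel_measurable (borel \<Otimes>\<^sub>M borel)" and \<phi>: "\<phi> \<in> borel_measurable (borel \<Otimes>\<^sub>M borel)"
  shows "regular_dist T f \<phi> = (LINT z|cyl_measure T. f z * \<phi> z)"
proof -
  have "(\<lambda>z. f z * \<phi> z) \<in> borel_measurable (borel \<Otimes>\<^sub>M borel)" using f \<phi> by measurable
  then have "(\<lambda>z. f z * \<phi> z) \<in> borel_measurable borel" by (simp only: borel_prod)
  from cyl_integral_eq[OF this] show ?thesis by (simp add: regular_dist_def)
qed

context euler_fields
begin

context
  fixes l :: real
  assumes l: "0 < l"
begin

abbreviation "K \<equiv> torus_kernel \<rho> l"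
abbreviation "U j \<equiv> cv K (\<lambda>z. u z $ j)"
abbreviation "DU i j \<equiv> cv (pd i K) (\<lambda>z. u z $ j)"
abbreviation "w j z \<equiv> u z $ j - U j z"

lemma K_smooth: "smooth_periodic K"
  by (rule torus_kernel_smooth[OF mollifier l])

lemma u_periodic: "lattice_periodic (\<lambda>x. u (x, t))" and q_periodic: "lattice_periodic (\<lambda>x. q (x, t))"
  using admissible by (auto simp: admissible_def)

lemma mollify_u: "mollify \<rho> l u z $ j = U j z"
proof (cases z)
  case (Pair x t)
  have "(LINT y|cell_measure. K (x - y) *\<^sub>R u (y, t)) $ j = (LINT y|cell_measure. (K (x - y) *\<^sub>R u (y, t)) $ j)"
    by (rule integral_vec_component) (simp add: conv_integrable[OF K_smooth section_integrable(1)])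
  then show ?thesis
    using mollify_eq_torus_integral[OF mollifier l u_measurable u_periodic, where x=x and t=t]
    by (simp add: Pair cv_def conv_def)
qed

lemma mollify_q: "mollify \<rho> l q z = cv K q z"
  using mollify_eq_torus_integral[OF mollifier l q_measurable q_periodic, where x="fst z" and t="snd z"]
  by (simp add: cv_def conv_def)

lemma tensor_measurable [measurable]: "(\<lambda>z. tensor (u z) (u z)) \<in> borel_measurable (borel \<Otimes>\<^sub>M borel)"
proof -
  have "continuous_on UNIV (\<lambda>v :: real^'d. tensor v v)"
    unfolding tensor_def by (intro continuous_intros)
  then show ?thesis by (intro measurable_compose[OF u_measurable] borel_measurable_continuous_onI)
qed

lemma mollify_tensor: "mollify \<rho> l (\<lambda>z. tensor (u z) (u z)) z $ i $ j = cv K (\<lambda>z. u z $ i * u z $ j) z"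
proof (cases z)
  case (Pair x t)
  have int: "integrable cell_measure (\<lambda>y. (K (x - y) *\<^sub>R tensor (u (y, t)) (u (y, t))) $ i $ j)" for i j
    using conv_integrable[OF K_smooth section_integrable(2)] by (simp add: tensor_def)
  have "(LINT y|cell_measure. K (x - y) *\<^sub>R tensor (u (y, t)) (u (y, t))) $ i $ j
    = (LINT y|cell_measure. (K (x - y) *\<^sub>R tensor (u (y, t)) (u (y, t))) $ i) $ j"
    by (simp only: integral_vec_component[OF integrable_vec[OF int]])
  also have "\<dots> = (LINT y|cell_measure. (K (x - y) *\<^sub>R tensor (u (y, t)) (u (y, t))) $ i $ j)"
    by (rule integral_vec_component) (rule int)
  finally have "(LINT y|cell_measure. K (x - y) *\<^sub>R tensor (u (y, t)) (u (y, t))) $ i $ j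
    = (LINT y|cell_measure. K (x - y) * (u (y, t) $ i * u (y, t) $ j))" by (simp add: tensor_def)
  moreover have "lattice_periodic (\<lambda>x. tensor (u (x, t)) (u (x, t)))"
    using u_periodic by (simp add: lattice_periodic_def)
  ultimately show ?thesis
    using mollify_eq_torus_integral[OF mollifier l tensor_measurable, where x=x and t=t]
    by (simp add: Pair cv_def conv_def)
qed

lemma E_moll_eq: "E_moll \<rho> l u z = (1 / 2) * (\<Sum>j\<in>UNIV. w j z * w j z)"
  by (simp add: E_moll_def power2_norm_eq_inner inner_vec_def mollify_u)

lemma Q_moll_eq: "Q_moll \<rho> l u q z $ i = ((1 / 2) * (\<Sum>j\<in>UNIV. w j z * w j z) + (q z - cv K q z)) * w i z"
  by (simp add: Q_moll_def power2_norm_eq_inner inner_vec_def mollify_u mollify_q)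

lemma cv_line_derivative:
  assumes "\<And>t. integrable cell_measure (\<lambda>x. f (x, t))"
  shows "((\<lambda>s. cv K f (x + s *\<^sub>R axis i 1, t)) has_real_derivative cv (pd i K) f (x, t)) (at 0)"
  using C1_periodicD(5)[OF cv_C1[OF K_smooth assms], where s=0 and x=x and i=i] by simp

text \<open>As every slice of an admissible field is integrable, the classical derivative exists at
  each point and falls on the kernel.\<close>

lemma gradient_mollify: "gradient (mollify \<rho> l u) z $ i $ j = DU i j z"
proof (cases z)
  case (Pair x t)
  have "pd_space i (mollify \<rho> l u) (x, t) = (\<chi> j. DU i j (x, t))"
  proof (rule pd_space_eqI, rule has_vector_derivative_vec)
    fix j
    show "((\<lambda>s. mollify \<rho> l u (x + s *\<^sub>R axis i 1, t) $ j) has_vector_derivative (\<chi> j. DU i j (x, t)) $ j) (at 0)"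
      using cv_line_derivative[OF section_integrable(1)]
      by (simp add: mollify_u has_real_derivative_iff_has_vector_derivative)
  qed
  then show ?thesis by (simp add: gradient_def Pair)
qed

lemma R_moll_nth: "R_moll \<rho> l u z $ i $ j = U i z * U j z - cv K (\<lambda>z. u z $ i * u z $ j) z"
  by (simp only: R_moll_def vector_minus_component tensor_nth mollify_u mollify_tensor)

lemma divergence_R_moll:
  "divergence (R_moll \<rho> l u) z $ j
     = (\<Sum>i\<in>UNIV. DU i i z * U j z + DU i j z * U i z - cv (pd i K) (\<lambda>z. u z $ i * u z $ j) z)"
proof (cases z)
  case (Pair x t)
  have "pd_space k (R_moll \<rho> l u) (x, t)
     = (\<chi> i j. DU k i (x, t) * U j (x, t) + DU k j (x, t) * U i (x, t) - cv (pd k K) (\<lambda>z. u z $ i * u z $ j) (x, t))" for k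
  proof (rule pd_space_eqI, rule has_vector_derivative_vec, rule has_vector_derivative_vec)
    fix i j
    have "((\<lambda>s. U i (x + s *\<^sub>R axis k 1, t) * U j (x + s *\<^sub>R axis k 1, t) - cv K (\<lambda>z. u z $ i * u z $ j) (x + s *\<^sub>R axis k 1, t))
      has_real_derivative DU k i (x, t) * U j (x + 0 *\<^sub>R axis k 1, t) + DU k j (x, t) * U i (x + 0 *\<^sub>R axis k 1, t)
        - cv (pd k K) (\<lambda>z. u z $ i * u z $ j) (x, t)) (at 0)"
      by (intro DERIV_diff DERIV_mult cv_line_derivative section_integrable)
    then show "((\<lambda>s. R_moll \<rho> l u (x + s *\<^sub>R axis k 1, t) $ i $ j) has_vector_derivative
      (\<chi> i j. DU k i (x, t) * U j (x, t) + DU k j (x, t) * U i (x, t) - cv (pd k K) (\<lambda>z. u z $ i * u z $ j) (x, t)) $ i $ j) (at 0)"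
      by (simp add: R_moll_nth has_real_derivative_iff_has_vector_derivative)
  qed
  then show ?thesis by (simp add: divergence_def Pair)
qed

lemma C_moll_eq:
  "C_moll \<rho> l u z = (\<Sum>j\<in>UNIV. w j z * (\<Sum>i\<in>UNIV. DU i i z * U j z + DU i j z * U i z - cv (pd i K) (\<lambda>z. u z $ i * u z $ j) z))
     + (\<Sum>i\<in>UNIV. \<Sum>j\<in>UNIV. w i z * w j z * DU i j z)"
  by (simp add: C_moll_def inner_vec_def tensor_def mollify_u gradient_mollify divergence_R_moll)

lemma tame_terms:
  shows tame_energy: "tame 2 (\<lambda>z. (norm (u z))\<^sup>2 / 2)"
    and tame_flux: "tame 3 (\<lambda>z. (((norm (u z))\<^sup>2 / 2 + q z) *\<^sub>R u z) $ i)"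
    and tame_E: "tame 2 (E_moll \<rho> l u)"
    and tame_EU: "tame 3 (\<lambda>z. (E_moll \<rho> l u z *\<^sub>R mollify \<rho> l u z) $ i)"
    and tame_Q: "tame 3 (\<lambda>z. Q_moll \<rho> l u q z $ i)"
    and tame_C: "tame 3 (C_moll \<rho> l u)"
proof -
  note D = smooth_periodic_dd
  note t = subcritical_tame
  have tU: "tame 1 (U j)" for j by (rule t[OF subcritical_cv_u[OF K_smooth]])
  have tDU: "tame 1 (DU i j)" for i j by (rule t[OF subcritical_cv_u[OF D[OF K_smooth]]])
  have tM: "tame 2 (cv (pd i K) (\<lambda>z. u z $ i * u z $ j))" for i j by (rule t[OF subcritical_cv_uu[OF D[OF K_smooth]]])
  have tr: "tame 2 (cv K q)" by (rule t[OF subcritical_cv_q[OF K_smooth]])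
  have e: "(norm (u z))\<^sup>2 / 2 = (1 / 2) * (\<Sum>j\<in>UNIV. u z $ j * u z $ j)" for z
    by (simp add: power2_norm_eq_inner inner_vec_def)
  show "tame 2 (\<lambda>z. (norm (u z))\<^sup>2 / 2)" unfolding e
    by (rule tame_mono, (rule tame_mult tame_sum tame_u tame_const)+, simp)
  show "tame 3 (\<lambda>z. (((norm (u z))\<^sup>2 / 2 + q z) *\<^sub>R u z) $ i)" unfolding e vector_scaleR_component real_scaleR_def
    by (rule tame_mono, (rule tame_q tame_u tame_const tame_mult tame_add tame_sum)+, simp)
  have E: "E_moll \<rho> l u = (\<lambda>z. (1 / 2) * (\<Sum>j\<in>UNIV. w j z * w j z))" by (rule ext) (rule E_moll_eq)
  show "tame 2 (E_moll \<rho> l u)" unfolding E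
    by (rule tame_mono, (rule tU tame_u tame_const tame_mult tame_diff tame_sum)+, simp)
  show "tame 3 (\<lambda>z. (E_moll \<rho> l u z *\<^sub>R mollify \<rho> l u z) $ i)"
    unfolding E vector_scaleR_component real_scaleR_def mollify_u
    by (rule tame_mono, (rule tU tame_u tame_const tame_mult tame_diff tame_sum)+, simp)
  show "tame 3 (\<lambda>z. Q_moll \<rho> l u q z $ i)" unfolding Q_moll_eq
    by (rule tame_mono, (rule tU tr tame_u tame_q tame_const tame_mult tame_diff tame_add tame_sum)+, simp)
  have C: "C_moll \<rho> l u = (\<lambda>z. (\<Sum>j\<in>UNIV. w j z * (\<Sum>i\<in>UNIV. DU i i z * U j z + DU i j z * U i z - cv (pd i K) (\<lambda>z. u z $ i * u z $ j) z))
     + (\<Sum>i\<in>UNIV. \<Sum>j\<in>UNIV. w i z * w j z * DU i j z))" by (rule ext) (rule C_moll_eq)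
  show "tame 3 (C_moll \<rho> l u)" unfolding C
    by (rule tame_mono, (rule tU tDU tM tame_u tame_mult tame_diff tame_add tame_sum)+, simp)
qed

text \<open>All terms are finite integrals, since none exceeds order 3. Collected on one side they
  form the single integral of \<open>spatial_identity\<close>.\<close>

lemma energy_balance:
  assumes \<phi>: "test_function T \<phi>"
  shows "- duchon_robert T u q \<phi> =
      dist_time (regular_dist T (E_moll \<rho> l u)) \<phi>
      + dist_div T (\<lambda>z. E_moll \<rho> l u z *\<^sub>R mollify \<rho> l u z) \<phi>
      + dist_div T (Q_moll \<rho> l u q) \<phi>
      + regular_dist T (C_moll \<rho> l u) \<phi>"
proof -
  note tP = subcritical_test[OF \<phi>, THEN subcritical_tame]
  note m = tame_measurable
  have R: "regular_dist T f \<psi> = (LINT z|cyl_measure T. f z * \<psi> z)" "integrable (cyl_measure T) (\<lambda>z. f z * \<psi> z)"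
    if "tame k f" "k \<le> 3" "tame 0 \<psi>" for f \<psi> k
  proof -
    show "regular_dist T f \<psi> = (LINT z|cyl_measure T. f z * \<psi> z)" by (rule regular_dist_eq[OF m[OF that(1)] m[OF that(3)]])
    show "integrable (cyl_measure T) (\<lambda>z. f z * \<psi> z)"
      by (rule tame_integrable[OF tame_mult[OF that(1,3)]]) (use that in simp)
  qed
  let ?n = "\<lambda>z. (norm (u z))\<^sup>2 / 2"
  let ?F = "\<lambda>i z. (((norm (u z))\<^sup>2 / 2 + q z) *\<^sub>R u z) $ i"
  let ?EU = "\<lambda>i z. (E_moll \<rho> l u z *\<^sub>R mollify \<rho> l u z) $ i"
  let ?Q = "\<lambda>i z. Q_moll \<rho> l u q z $ i"
  have R1: "regular_dist T ?n (pd_time \<phi>) = (LINT z|cyl_measure T. ?n z * pd_time \<phi> z)"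
    "integrable (cyl_measure T) (\<lambda>z. ?n z * pd_time \<phi> z)"
    by (rule R[OF tame_energy _ tP(2)], simp)+
  have R2: "regular_dist T (?F i) (pd_space i \<phi>) = (LINT z|cyl_measure T. ?F i z * pd_space i \<phi> z)"
    "integrable (cyl_measure T) (\<lambda>z. ?F i z * pd_space i \<phi> z)" for i
    by (rule R[OF tame_flux _ tP(3)], simp)+
  have R3: "regular_dist T (E_moll \<rho> l u) (pd_time \<phi>) = (LINT z|cyl_measure T. E_moll \<rho> l u z * pd_time \<phi> z)"
    "integrable (cyl_measure T) (\<lambda>z. E_moll \<rho> l u z * pd_time \<phi> z)"
    by (rule R[OF tame_E _ tP(2)], simp)+
  have R4: "regular_dist T (?EU i) (pd_space i \<phi>) = (LINT z|cyl_measure T. ?EU i z * pd_space i \<phi> z)"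
    "integrable (cyl_measure T) (\<lambda>z. ?EU i z * pd_space i \<phi> z)" for i
    by (rule R[OF tame_EU _ tP(3)], simp)+
  have R5: "regular_dist T (?Q i) (pd_space i \<phi>) = (LINT z|cyl_measure T. ?Q i z * pd_space i \<phi> z)"
    "integrable (cyl_measure T) (\<lambda>z. ?Q i z * pd_space i \<phi> z)" for i
    by (rule R[OF tame_Q _ tP(3)], simp)+
  have R6: "regular_dist T (C_moll \<rho> l u) \<phi> = (LINT z|cyl_measure T. C_moll \<rho> l u z * \<phi> z)"
    "integrable (cyl_measure T) (\<lambda>z. C_moll \<rho> l u z * \<phi> z)"
    by (rule R[OF tame_C _ tP(1)], simp)+
  define e where "e z = (\<Sum>j\<in>UNIV. u z $ j * U j z) - (\<Sum>j\<in>UNIV. U j z * U j z) / 2" for z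
  have e: "?n z - E_moll \<rho> l u z = e z" for z
  proof -
    have "(\<Sum>j\<in>UNIV. w j z * w j z) = (\<Sum>j\<in>UNIV. u z $ j * u z $ j) - 2 * (\<Sum>j\<in>UNIV. u z $ j * U j z) + (\<Sum>j\<in>UNIV. U j z * U j z)"
      by (simp add: algebra_simps sum.distrib sum_subtractf sum_distrib_left)
    then show ?thesis
      by (simp add: E_moll_eq e_def power2_norm_eq_inner inner_vec_def diff_divide_distrib add_divide_distrib)
  qed
  \<comment> \<open>With |u|^2/2 - E = e, the q u terms cancel between the full flux and
    \<open>Q_moll\<close>; what remains mixes \<open>u\<close> and \<open>U\<close> with
    \<open>q\<close> and the mollified pressure.\<close>
  have pt: "(?n z - E_moll \<rho> l u z) * pd_time \<phi> z + (\<Sum>i\<in>UNIV. (?F i z - ?EU i z - ?Q i z) * pd_space i \<phi> z) + C_moll \<rho> l u z * \<phi> z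
    = e z * pd_time \<phi> z
      + (\<Sum>i\<in>UNIV. (e z * u z $ i + cv K q z * u z $ i + q z * U i z - cv K q z * U i z) * pd_space i \<phi> z)
      + C_moll \<rho> l u z * \<phi> z" for z
  proof -
    have "?F i z - ?EU i z - ?Q i z = e z * u z $ i + cv K q z * u z $ i + q z * U i z - cv K q z * U i z" for i
      unfolding Q_moll_eq vector_scaleR_component real_scaleR_def mollify_u E_moll_eq[symmetric] e[symmetric]
      by (simp add: algebra_simps)
    then show ?thesis by (simp only: e)
  qed
  have "(LINT z|cyl_measure T. (?n z - E_moll \<rho> l u z) * pd_time \<phi> z
      + (\<Sum>i\<in>UNIV. (?F i z - ?EU i z - ?Q i z) * pd_space i \<phi> z) + C_moll \<rho> l u z * \<phi> z) = 0"
    unfolding pt using spatial_identity[OF K_smooth \<phi>] by (simp only: C_moll_eq e_def)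
  moreover have "(LINT z|cyl_measure T. (?n z - E_moll \<rho> l u z) * pd_time \<phi> z
      + (\<Sum>i\<in>UNIV. (?F i z - ?EU i z - ?Q i z) * pd_space i \<phi> z) + C_moll \<rho> l u z * \<phi> z)
    = (LINT z|cyl_measure T. ?n z * pd_time \<phi> z) - (LINT z|cyl_measure T. E_moll \<rho> l u z * pd_time \<phi> z)
      + (\<Sum>i\<in>UNIV. (LINT z|cyl_measure T. ?F i z * pd_space i \<phi> z) - (LINT z|cyl_measure T. ?EU i z * pd_space i \<phi> z)
          - (LINT z|cyl_measure T. ?Q i z * pd_space i \<phi> z))
      + (LINT z|cyl_measure T. C_moll \<rho> l u z * \<phi> z)"
    unfolding left_diff_distrib using R1(2) R2(2) R3(2) R4(2) R5(2) R6(2)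
    by (simp del: vector_scaleR_component)
  ultimately show ?thesis
    unfolding duchon_robert_def dist_time_def dist_div_def dist_space_def R1(1) R2(1) R3(1) R4(1) R5(1) R6(1)
    by (simp add: sum_subtractf sum_negf)
qed

end

end

section \<open>Reduction to Borel representatives\<close>

text \<open>Completeness of Lebesgue measure makes \<open>f\<close> measurable from
  almost-everywhere equality alone. This transfers integrals of the given fields to Borel
  representatives.\<close>

lemma lebesgue_integral_AE_borel:
  fixes f g :: "'a::euclidean_space \<Rightarrow> 'b::euclidean_space"
  assumes g: "g \<in> borel_measurable lborel" and eq: "AE x in lborel. f x = g x"
  shows "f \<in> borel_measurable lebesgue" and "(LINT x|lebesgue. f x) = (LINT x|lborel. g x)"
    and "integrable lebesgue f \<longleftrightarrow> integrable lborel g"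
proof -
  have eq': "AE x in lebesgue. f x = g x" using eq by (rule AE_completion)
  have gl: "g \<in> borel_measurable lebesgue" using g by (rule measurable_completion)
  show f: "f \<in> borel_measurable lebesgue"
  proof (rule measurableI)
    fix A :: "'b set" assume A: "A \<in> sets borel"
    have "AE x in lebesgue. x \<in> g -` A \<inter> space lebesgue \<longleftrightarrow> x \<in> f -` A \<inter> space lebesgue"
      using eq' by eventually_elim auto
    then show "f -` A \<inter> space lebesgue \<in> sets lebesgue"
      by (rule completion.in_sets_AE) (use measurable_sets[OF gl A] in auto)
  qed auto
  show "(LINT x|lebesgue. f x) = (LINT x|lborel. g x)"
    using integral_cong_AE[OF f gl eq'] integral_completion[OF g] by simp
  show "integrable lebesgue f \<longleftrightarrow> integrable lborel g"
    using integrable_cong_AE[OF f gl eq'] integrable_completion[OF g] by simp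
qed

lemma AE_null_superset:
  assumes P: "AE x in M. P x" and space: "space M = UNIV"
  obtains N where "N \<in> null_sets M" "{x. \<not> P x} \<subseteq> N"
proof -
  obtain N where N: "\<And>x. x \<in> space M - N \<Longrightarrow> P x" "N \<in> null_sets M" by (rule AE_E3[OF P]) (rule that)
  then have "{x. \<not> P x} \<subseteq> N" using space by blast
  with N(2) show ?thesis by (rule that)
qed

lemma AE_cyl_measure: "(AE z in cyl_measure T. P z) \<longleftrightarrow> (AE z in lborel. z \<in> cylinder T \<longrightarrow> P z)"
  unfolding cyl_measure_eq by (subst AE_density) (auto simp: indicator_def)

lemma AE_cyl_snd:
  assumes "AE t in time_measure T. P t"
  shows "AE z in cyl_measure T :: ((real^'d) \<times> real) measure. P (snd z)"
proof -
  obtain N where N: "N \<in> null_sets (time_measure T)" "{t. \<not> P t} \<subseteq> N"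
    by (rule AE_null_superset[OF assms space_time_measure]) (rule that)
  have "emeasure (cyl_measure T :: ((real^'d) \<times> real) measure) (UNIV \<times> N)
     = emeasure (cell_measure :: (real^'d) measure) UNIV * emeasure (time_measure T) N"
    unfolding cyl_measure_def using N by (intro time.emeasure_pair_measure_Times) auto
  then have "UNIV \<times> N \<in> null_sets (cyl_measure T :: ((real^'d) \<times> real) measure)"
    using N(1) unfolding null_sets_def by (auto simp: cyl_measure_def)
  then show ?thesis by (rule AE_I') (use N(2) in auto)
qed

lemma AE_cyl_fst:
  assumes "AE x in cell_measure. P x"
  shows "AE z in cyl_measure T :: ((real^'d) \<times> real) measure. P (fst z)"
proof -
  obtain N where N: "N \<in> null_sets (cell_measure :: (real^'d) measure)" "{x. \<not> P x} \<subseteq> N"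
    by (rule AE_null_superset[OF assms space_cell_measure]) (rule that)
  have "emeasure (cyl_measure T :: ((real^'d) \<times> real) measure) (N \<times> UNIV)
     = emeasure (cell_measure :: (real^'d) measure) N * emeasure (time_measure T) UNIV"
    unfolding cyl_measure_def using N by (intro time.emeasure_pair_measure_Times) auto
  then have "N \<times> UNIV \<in> null_sets (cyl_measure T :: ((real^'d) \<times> real) measure)"
    using N(1) unfolding null_sets_def by (auto simp: cyl_measure_def)
  then show ?thesis by (rule AE_I') (use N(2) in auto)
qed

lemma regular_dist_cong_AE:
  assumes eq: "AE z in cyl_measure T. f z = g z"
    and g: "g \<in> borel_measurable (borel \<Otimes>\<^sub>M borel)" and \<phi>: "\<phi> \<in> borel_measurable (borel \<Otimes>\<^sub>M borel)"
  shows "regular_dist T f \<phi> = regular_dist T g \<phi>"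
proof -
  have "(\<lambda>z. g z * \<phi> z) \<in> borel_measurable (borel \<Otimes>\<^sub>M borel)" using g \<phi> by measurable
  then have [measurable]: "(\<lambda>z. g z * \<phi> z) \<in> borel_measurable borel" by (simp only: borel_prod)
  have m: "(\<lambda>z. indicator (cylinder T) z *\<^sub>R (g z * \<phi> z)) \<in> borel_measurable lborel" by measurable
  have "AE z in lborel. indicator (cylinder T) z *\<^sub>R (f z * \<phi> z) = indicator (cylinder T) z *\<^sub>R (g z * \<phi> z)"
    using eq unfolding AE_cyl_measure by eventually_elim (auto simp: indicator_def)
  from lebesgue_integral_AE_borel(2)[OF m this] lebesgue_integral_AE_borel(2)[OF m, of "\<lambda>z. indicator (cylinder T) z *\<^sub>R (g z * \<phi> z)"]
  show ?thesis by (simp add: regular_dist_def set_lebesgue_integral_def)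
qed

lemma AE_lborel_translate:
  fixes P :: "'a::euclidean_space \<Rightarrow> bool"
  assumes "AE x in lborel. P x"
  shows "AE x in lborel. P (a + x)"
proof -
  obtain N where N: "N \<in> null_sets lborel" "{x. \<not> P x} \<subseteq> N"
    by (rule AE_null_superset[OF assms], simp) (rule that)
  have [measurable]: "N \<in> sets borel" using N(1) by (auto simp: null_sets_def)
  have "AE x in distr lborel borel ((+) a). x \<notin> N"
    unfolding lborel_distr_plus using N(1) by (rule AE_not_in)
  then have "AE x in lborel. a + x \<notin> N" by (subst (asm) AE_distr_iff) auto
  then show ?thesis by eventually_elim (use N(2) in auto)
qed

lemma countable_lattice: "countable (lattice :: (real^'d) set)"
proof -
  have "lattice = (\<Union>n. {k \<in> lattice. norm (k :: real^'d) \<le> real n})"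
    using real_arch_simple by auto
  moreover have "countable (\<Union>n. {k \<in> lattice. norm (k :: real^'d) \<le> real n})"
    by (intro countable_UN countableI_type countable_finite finite_lattice_ball)
  ultimately show ?thesis by (rule ssubst)
qed

text \<open>The slice-wise form of the conclusion is the one that identifies the mollified fields, at every point
  of almost every time slice.\<close>
lemma admissible_representative:
  fixes u :: "(real^'d) \<times> real \<Rightarrow> real^'d" and q :: "(real^'d) \<times> real \<Rightarrow> real"
  assumes u: "Lp_torus 3 T u" and q: "Lp_torus (3/2) T q"
  obtains v p where "admissible T v p"
    "AE t in time_measure T. AE x in lborel. u (x, t) = v (x, t) \<and> q (x, t) = p (x, t)"
    "AE z in cyl_measure T. u z = v z \<and> q z = p z"
proof -
  let ?ind = "\<lambda>z. indicator (cylinder T) z :: real"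
  have um: "(\<lambda>z. ?ind z *\<^sub>R u z) \<in> borel_measurable lebesgue" and qm: "(\<lambda>z. ?ind z *\<^sub>R q z) \<in> borel_measurable lebesgue"
    using u q by (simp_all add: Lp_torus_def set_borel_measurable_def)
  have umc: "(\<lambda>z. (?ind z *\<^sub>R u z) $ i) \<in> borel_measurable lebesgue" for i
    by (rule measurable_compose[OF um])
      (intro borel_measurable_continuous_onI continuous_on_component continuous_on_id)
  have "\<forall>i. \<exists>g. g \<in> borel_measurable lborel \<and> (AE z in lborel. (?ind z *\<^sub>R u z) $ i = g z)"
    using completion_ex_borel_measurable_real[OF umc] by (intro allI) (simp only: Bex_def)
  then obtain gu where "\<forall>i. gu i \<in> borel_measurable lborel \<and> (AE z in lborel. (?ind z *\<^sub>R u z) $ i = gu i z)"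
    by (rule choice[THEN exE])
  then have gu: "gu i \<in> borel_measurable lborel" "AE z in lborel. (?ind z *\<^sub>R u z) $ i = gu i z" for i
    by simp_all
  obtain gq where gq: "gq \<in> borel_measurable lborel" "AE z in lborel. ?ind z *\<^sub>R q z = gq z"
    using completion_ex_borel_measurable_real[OF qm] by blast
  have [measurable]: "gu i \<in> borel_measurable (borel \<Otimes>\<^sub>M borel)" "gq \<in> borel_measurable (borel \<Otimes>\<^sub>M borel)" for i
    using gu(1) gq(1) by (simp_all add: borel_prod)
  have "AE z in lborel. \<forall>i. (?ind z *\<^sub>R u z) $ i = gu i z" using gu(2) by (simp add: AE_all_countable)
  with gq(2) have AEg: "AE z in lborel. z \<in> cylinder T \<longrightarrow> u z = (\<chi> i. gu i z) \<and> q z = gq z"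
    by eventually_elim (auto simp: vec_eq_iff)
  obtain N where N: "N \<in> null_sets lborel" "{z. \<not> (z \<in> cylinder T \<longrightarrow> u z = (\<chi> i. gu i z) \<and> q z = gq z)} \<subseteq> N"
    by (rule AE_null_superset[OF AEg], simp) (rule that)
  have NB: "N \<in> sets borel" using N(1) by (auto simp: null_sets_def)
  then have [measurable]: "N \<in> sets (borel \<Otimes>\<^sub>M borel)" by (simp only: borel_prod)
  have good: "u z = (\<chi> i. gu i z) \<and> q z = gq z" if "z \<in> cylinder T" "z \<notin> N" for z using N(2) that by blast
  \<comment> \<open>Reading a Borel version through \<open>frac_vec\<close> makes it periodic at
    every point; outside the time interval the value 0 makes the conditions on slices
    trivial.\<close>
  define ut where "ut z = (if snd z \<in> {0<..<T} then (\<chi> i. gu i (frac_vec (fst z), snd z)) else 0)" for z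
  define qt where "qt z = (if snd z \<in> {0<..<T} then gq (frac_vec (fst z), snd z) else 0)" for z
  have gum: "(\<lambda>z. \<chi> i. gu i (frac_vec (fst z), snd z)) \<in> borel_measurable (borel \<Otimes>\<^sub>M borel)"
    by (rule measurable_cart) simp
  have [measurable]: "ut \<in> borel_measurable (borel \<Otimes>\<^sub>M borel)" "qt \<in> borel_measurable (borel \<Otimes>\<^sub>M borel)"
    unfolding ut_def qt_def using gum by measurable
  have ut_eq: "u (x, t) = ut (x, t) \<and> q (x, t) = qt (x, t)" if t: "t \<in> {0<..<T}" and n: "(frac_vec x, t) \<notin> N" for x t
  proof -
    have "(frac_vec x, t) \<in> cylinder T"
      using t floor_vec_in_unit_cell[OF floor_frac_vec, of x] by (simp add: cylinder_def)
    from good[OF this n] have "u (frac_vec x, t) = ut (x, t)" "q (frac_vec x, t) = qt (x, t)"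
      using t by (simp_all add: ut_def qt_def)
    moreover have "lattice_periodic (\<lambda>x. u (x, t))" "lattice_periodic (\<lambda>x. q (x, t))"
      using u q t by (auto simp: Lp_torus_def periodic_in_space_def lattice_periodic_def lattice_def)
    ultimately show ?thesis using lattice_periodic_frac[of "\<lambda>x. u (x, t)" x] lattice_periodic_frac[of "\<lambda>x. q (x, t)" x] by simp
  qed
  have "AE z in lborel. z \<notin> N" using N(1) by (rule AE_not_in)
  then have "AE z in lborel \<Otimes>\<^sub>M lborel. z \<notin> N" by (simp only: lborel_prod)
  then have "AE x in lborel. AE t in lborel. (x, t) \<notin> N" by (rule lborel_pair.AE_pair)
  \<comment> \<open>A null set of space-time has null slices at almost every time;
    \<open>AE_pair\<close> yields the other order of variables, hence the exchange.\<close>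
  then have N0: "AE t in lborel. AE x in lborel. (x, t) \<notin> N"
  proof (subst (asm) lborel_pair.AE_commute)
    have "{z \<in> space (lborel \<Otimes>\<^sub>M lborel). (fst z, snd z) \<notin> N} = space (borel \<Otimes>\<^sub>M borel) - N"
      by (auto simp: space_pair_measure)
    moreover have "space (borel \<Otimes>\<^sub>M borel) - N \<in> sets (borel \<Otimes>\<^sub>M borel)" by measurable
    ultimately show "{z \<in> space (lborel \<Otimes>\<^sub>M lborel). (fst z, snd z) \<notin> N} \<in> sets (lborel \<Otimes>\<^sub>M lborel)"
      by (simp cong: sets_pair_measure_cong)
  qed
  have eq_t: "AE t in time_measure T. AE x in lborel. u (x, t) = ut (x, t) \<and> q (x, t) = qt (x, t)"
    unfolding AE_time_measure using N0
  proof eventually_elim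
    case (elim t)
    show ?case
    proof
      assume t: "t \<in> {0<..<T}"
      \<comment> \<open>The slice of \<open>N\<close> and all its lattice translates form a
        countable union of null sets, so almost every \<open>x\<close> has its representative in the
        cell outside \<open>N\<close>.\<close>
      have "AE x in lborel. \<forall>n\<in>lattice. (n + x, t) \<notin> N"
        using AE_lborel_translate[OF elim] by (simp add: AE_ball_countable[OF countable_lattice])
      then show "AE x in lborel. u (x, t) = ut (x, t) \<and> q (x, t) = qt (x, t)"
      proof eventually_elim
        case (elim x)
        have "frac_vec x = - floor_vec x + x" by (simp add: frac_vec_def)
        then have "(frac_vec x, t) \<notin> N" using elim lattice_uminus[OF floor_vec_lattice[of x]] by metis
        then show ?case by (rule ut_eq[OF t])
      qed
    qed
  qed
  have half: "AE x in cell_measure :: (real^'d) measure. floor_vec x = 0"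
    unfolding cell_measure_def using AE_unit_cell_iff
    by (subst AE_density) (auto elim!: eventually_mono simp: indicator_def)
  have inT: "AE t in time_measure T. t \<in> {0<..<T}" by (simp add: AE_time_measure)
  have notN: "AE z in cyl_measure T. z \<notin> N"
    unfolding AE_cyl_measure using AE_not_in[OF N(1)] by eventually_elim simp
  have eq_z: "AE z in cyl_measure T. u z = ut z \<and> q z = qt z"
    using notN AE_cyl_fst[OF half] AE_cyl_snd[OF inT]
  proof eventually_elim
    case (elim z)
    then show ?case using ut_eq[of "snd z" "fst z"] frac_vec_id[of "fst z"] by simp
  qed
  have int_u: "integrable (cyl_measure T) (\<lambda>z. norm (ut z) ^ 3)"
    and int_q: "integrable (cyl_measure T) (\<lambda>z. sqrt \<bar>qt z\<bar> ^ 3)"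
  proof -
    have tr: "integrable (cyl_measure T) h" if h: "h \<in> borel_measurable (borel \<Otimes>\<^sub>M borel)"
      and fh: "AE z in cyl_measure T. f z = h z" and f: "set_integrable lebesgue (cylinder T) f"
      for f h :: "(real^'d) \<times> real \<Rightarrow> real"
    proof -
      have [measurable]: "h \<in> borel_measurable borel" using h by (simp only: borel_prod)
      have m: "(\<lambda>z. ?ind z *\<^sub>R h z) \<in> borel_measurable lborel" by measurable
      have "AE z in lborel. ?ind z *\<^sub>R f z = ?ind z *\<^sub>R h z"
        using fh unfolding AE_cyl_measure by eventually_elim (auto simp: indicator_def)
      from lebesgue_integral_AE_borel(3)[OF m this] f have "integrable lborel (\<lambda>z. ?ind z *\<^sub>R h z)"
        by (simp add: set_integrable_def)
      then have "integrable (density lborel (\<lambda>z. ennreal (?ind z))) h"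
        by (subst integrable_density) auto
      then show ?thesis by (simp add: cyl_measure_eq ennreal_indicator)
    qed
    show "integrable (cyl_measure T) (\<lambda>z. norm (ut z) ^ 3)"
    proof (rule tr)
      show "set_integrable lebesgue (cylinder T) (\<lambda>z. norm (u z) powr 3)" using u by (simp add: Lp_torus_def)
      show "AE z in cyl_measure T. norm (u z) powr 3 = norm (ut z) ^ 3"
        using eq_z by eventually_elim (simp add: powr_numeral)
    qed measurable
    show "integrable (cyl_measure T) (\<lambda>z. sqrt \<bar>qt z\<bar> ^ 3)"
    proof (rule tr)
      show "set_integrable lebesgue (cylinder T) (\<lambda>z. norm (q z) powr (3/2))" using q by (simp add: Lp_torus_def)
      have pw: "a powr (3/2) = sqrt a ^ 3" if "0 \<le> a" for a :: real
      proof -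
        have "sqrt a ^ 3 = (a powr (1/2)) powr 3" using that by (simp add: powr_half_sqrt powr_numeral)
        then show ?thesis by (simp add: powr_powr)
      qed
      show "AE z in cyl_measure T. norm (q z) powr (3/2) = sqrt \<bar>qt z\<bar> ^ 3"
        using eq_z by eventually_elim (simp add: pw)
    qed measurable
  qed
  \<comment> \<open>An extended-valued slice integral, hence meaningful at each time. Slices where
    it is infinite occur only for a null set of times and are replaced by 0, so that every slice
    becomes integrable.\<close>
  define W where "W t = (\<integral>\<^sup>+ x. ennreal (norm (ut (x, t)) ^ 3 + sqrt \<bar>qt (x, t)\<bar> ^ 3) \<partial>cell_measure)" for t
  have [measurable]: "W \<in> borel_measurable borel" unfolding W_def by measurable
  have AEW: "AE t in time_measure T. W t < \<infinity>"
  proof -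
    have "(\<integral>\<^sup>+ t. W t \<partial>time_measure T) = (\<integral>\<^sup>+ z. ennreal (norm (ut z) ^ 3 + sqrt \<bar>qt z\<bar> ^ 3) \<partial>cyl_measure T)"
      unfolding W_def cyl_measure_def by (rule cell_time.nn_integral_snd) (simp add: cyl_measure_def[symmetric] cyl_measurable_iff)
    also have "\<dots> < \<infinity>"
    proof -
      have "integrable (cyl_measure T) (\<lambda>z. norm (ut z) ^ 3 + sqrt \<bar>qt z\<bar> ^ 3)" using int_u int_q by simp
      then show ?thesis by (simp add: integrable_iff_bounded)
    qed
    finally have "AE t in time_measure T. W t \<noteq> \<infinity>"
      by (intro nn_integral_PInf_AE) (auto simp: time_measurable_iff)
    then show ?thesis by eventually_elim (simp add: less_top)
  qed
  define v where "v z = (if W (snd z) < \<infinity> then ut z else 0)" for z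
  define p where "p z = (if W (snd z) < \<infinity> then qt z else 0)" for z
  have [measurable]: "v \<in> borel_measurable (borel \<Otimes>\<^sub>M borel)" "p \<in> borel_measurable (borel \<Otimes>\<^sub>M borel)"
    unfolding v_def p_def by measurable
  have slice: "integrable cell_measure (\<lambda>x. norm (v (x, t)) ^ 3)" "integrable cell_measure (\<lambda>x. sqrt \<bar>p (x, t)\<bar> ^ 3)" for t
  proof -
    have "integrable cell_measure (\<lambda>x. norm (v (x, t)) ^ 3) \<and> integrable cell_measure (\<lambda>x. sqrt \<bar>p (x, t)\<bar> ^ 3)"
    proof (cases "W t < \<infinity>")
      case True
      have i: "integrable cell_measure (\<lambda>x. norm (ut (x, t)) ^ 3 + sqrt \<bar>qt (x, t)\<bar> ^ 3)"
        using True by (intro integrableI_bounded) (auto simp: W_def)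
      have "integrable cell_measure (\<lambda>x. norm (ut (x, t)) ^ 3)"
        by (rule Bochner_Integration.integrable_bound[OF i]) auto
      moreover have "integrable cell_measure (\<lambda>x. sqrt \<bar>qt (x, t)\<bar> ^ 3)"
        by (rule Bochner_Integration.integrable_bound[OF i]) auto
      ultimately show ?thesis using True by (simp add: v_def p_def)
    qed (simp add: v_def p_def)
    then show "integrable cell_measure (\<lambda>x. norm (v (x, t)) ^ 3)" "integrable cell_measure (\<lambda>x. sqrt \<bar>p (x, t)\<bar> ^ 3)" by auto
  qed
  have cyl: "integrable (cyl_measure T) (\<lambda>z. norm (v z) ^ 3)" "integrable (cyl_measure T) (\<lambda>z. sqrt \<bar>p z\<bar> ^ 3)"
    by (rule Bochner_Integration.integrable_bound[OF int_u] Bochner_Integration.integrable_bound[OF int_q];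
        auto simp: v_def p_def cyl_measurable_iff)+
  have per: "lattice_periodic (\<lambda>x. v (x, t))" "lattice_periodic (\<lambda>x. p (x, t))" for t
    by (auto simp: lattice_periodic_def v_def p_def ut_def qt_def)
  show ?thesis
  proof (rule that)
    show "admissible T v p" using slice cyl per by (simp add: admissible_def)
    show "AE t in time_measure T. AE x in lborel. u (x, t) = v (x, t) \<and> q (x, t) = p (x, t)"
      using eq_t AEW by eventually_elim (simp add: v_def p_def)
    show "AE z in cyl_measure T. u z = v z \<and> q z = p z"
      using eq_z AE_cyl_snd[OF AEW] by eventually_elim (simp add: v_def p_def)
  qed
qed

lemma test_function_pd:
  fixes \<phi> :: "(real^'d) \<times> real \<Rightarrow> real"
  assumes "test_function T \<phi>"
  shows "test_function T (pd_time \<phi>)" "test_function T (pd_space i \<phi>)"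
  using test_function_dd[OF assms] C_infinity_pd_time[OF test_function_C[OF assms]]
    C_infinity_pd_space[OF test_function_C[OF assms]]
  by simp_all

lemma AE_lborel_reflect:
  fixes P :: "'a::euclidean_space \<Rightarrow> bool"
  assumes "AE x in lborel. P x"
  shows "AE x in lborel. P (a - x)"
proof -
  obtain N where N: "N \<in> null_sets lborel" "{x. \<not> P x} \<subseteq> N"
    by (rule AE_null_superset[OF assms], simp) (rule that)
  have [measurable]: "N \<in> sets borel" using N(1) by (auto simp: null_sets_def)
  have eq: "lborel = distr lborel borel (\<lambda>x :: 'a. a + (-1) *\<^sub>R x)"
    using lborel_affine[of "-1" a] by (simp add: density_1)
  have "AE x in distr lborel borel (\<lambda>x :: 'a. a + (-1) *\<^sub>R x). x \<notin> N"
    unfolding eq[symmetric] using N(1) by (rule AE_not_in)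
  then have "AE x in lborel. a + (-1) *\<^sub>R x \<notin> N" by (subst (asm) AE_distr_iff) auto
  then show ?thesis by eventually_elim (use N(2) in auto)
qed

text \<open>An integral ignores null sets, so equality almost everywhere on a slice becomes equality
  of the mollifications at every point \<open>x\<close>.\<close>

lemma mollify_cong_AE:
  fixes f g :: "(real^'d) \<times> real \<Rightarrow> 'b::euclidean_space"
  assumes \<rho>: "friedrichs_mollifier \<rho>" and [measurable]: "g \<in> borel_measurable (borel \<Otimes>\<^sub>M borel)"
    and eq: "AE x in lborel. f (x, t) = g (x, t)"
  shows "mollify \<rho> l f (x, t) = mollify \<rho> l g (x, t)"
proof -
  have [measurable]: "\<rho> \<in> borel_measurable borel" by (rule mollifier_measurable[OF \<rho>])
  let ?c = "\<lambda>y. \<rho> ((1 / l) *\<^sub>R y) / l ^ CARD('d)"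
  have m: "(\<lambda>y. ?c y *\<^sub>R g (x - y, t)) \<in> borel_measurable lborel" by measurable
  have "AE y in lborel. ?c y *\<^sub>R f (x - y, t) = ?c y *\<^sub>R g (x - y, t)"
    using AE_lborel_reflect[OF eq, of x] by eventually_elim simp
  from lebesgue_integral_AE_borel(2)[OF m this] show ?thesis
    using lebesgue_integral_AE_borel(2)[OF m AE_I2, of "\<lambda>y. ?c y *\<^sub>R g (x - y, t)"] by (simp add: mollify_def)
qed

theorem proposition1p3:
  fixes u :: "(real^'d) \<times> real \<Rightarrow> real^'d"
    and q :: "(real^'d) \<times> real \<Rightarrow> real"
    and \<rho> :: "real^'d \<Rightarrow> real"
    and T :: real
  assumes "0 < T"
    and "friedrichs_mollifier \<rho>"
    and "Lp_torus 3 T u"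
    and "weak_euler_solution T u"
    and "euler_pressure T u q"
  shows "\<forall>l>0. \<forall>\<phi>. test_function T \<phi> \<longrightarrow>
    - duchon_robert T u q \<phi> =
      dist_time (regular_dist T (E_moll \<rho> l u)) \<phi>
      + dist_div T (\<lambda>z. E_moll \<rho> l u z *\<^sub>R mollify \<rho> l u z) \<phi>
      + dist_div T (Q_moll \<rho> l u q) \<phi>
      + regular_dist T (C_moll \<rho> l u) \<phi>"
proof (intro allI impI)
  fix l :: real and \<phi> :: "(real^'d) \<times> real \<Rightarrow> real"
  assume l: "l > 0" and \<phi>: "test_function T \<phi>"
  have q: "Lp_torus (3/2) T q" using assms(5) by (simp add: euler_pressure_def)
  obtain v p where adm: "admissible T v p"
    and slices: "AE t in time_measure T. AE x in lborel. u (x, t) = v (x, t) \<and> q (x, t) = p (x, t)"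
    and eq: "AE z in cyl_measure T. u z = v z \<and> q z = p z"
    by (rule admissible_representative[OF assms(3) q]) (rule that)
  have [measurable]: "v \<in> borel_measurable (borel \<Otimes>\<^sub>M borel)" "p \<in> borel_measurable (borel \<Otimes>\<^sub>M borel)"
    using adm by (auto simp: admissible_def)
  have vc [measurable]: "(\<lambda>z. v z $ i) \<in> borel_measurable (borel \<Otimes>\<^sub>M borel)" for i
    by (rule measurable_compose[of v _ borel])
      (auto intro!: borel_measurable_continuous_onI continuous_on_component)
  note tm = test_function_measurable
  note pdm = tm[OF test_function_pd(1)] tm[OF test_function_pd(2)]
  \<comment> \<open>The weak formulation sees the fields only up to null sets of space-time.\<close>
  have euler_v: "weak_euler_solution T v"
    unfolding weak_euler_solution_def
  proof (intro conjI allI impI)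
    fix \<psi> :: "(real^'d) \<times> real \<Rightarrow> real" assume \<psi>: "test_function T \<psi>"
    have "regular_dist T (\<lambda>z. u z $ i) (pd_space i \<psi>) = regular_dist T (\<lambda>z. v z $ i) (pd_space i \<psi>)" for i
    proof (rule regular_dist_cong_AE)
      show "AE z in cyl_measure T. u z $ i = v z $ i" using eq by eventually_elim simp
    qed (use vc pdm[OF \<psi>] in auto)
    then have "dist_div T v \<psi> = dist_div T u \<psi>" by (simp add: dist_div_def dist_space_def)
    then show "dist_div T v \<psi> = 0" using assms(4) \<psi> by (simp add: weak_euler_solution_def)
  next
    fix \<psi> :: "(real^'d) \<times> real \<Rightarrow> real^'d"
    assume \<psi>: "test_function T \<psi> \<and> (\<forall>z. divergence \<psi> z = 0)"
    then have C: "C_infinity \<psi>" by (simp add: test_function_def)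
    let ?I = "\<lambda>u z. u z \<bullet> pd_time \<psi> z + tensor (u z) (u z) \<bullet> gradient \<psi> z"
    have I: "?I u z = (\<Sum>j\<in>UNIV. u z $ j * pd_time \<psi> z $ j) + (\<Sum>i\<in>UNIV. \<Sum>j\<in>UNIV. (u z $ i * u z $ j) * pd_space i \<psi> z $ j)" for u z
      by (simp add: inner_vec_def tensor_def gradient_def)
    have pm: "(\<lambda>z. dd w \<psi> z $ j) \<in> borel_measurable (borel \<Otimes>\<^sub>M borel)" for w j
    proof -
      have "(\<lambda>z. dd w \<psi> z $ j) \<in> borel_measurable borel"
        by (intro borel_measurable_continuous_onI continuous_on_component C_infinity_continuous C_infinity_dd C)
      then show ?thesis by (simp only: borel_prod)
    qed
    have [measurable]: "(\<lambda>z. pd_time \<psi> z $ j) \<in> borel_measurable (borel \<Otimes>\<^sub>M borel)"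
      "(\<lambda>z. pd_space i \<psi> z $ j) \<in> borel_measurable (borel \<Otimes>\<^sub>M borel)" for i j
      unfolding C_infinity_pd_time[OF C] C_infinity_pd_space[OF C] by (rule pm)+
    have Im: "?I v \<in> borel_measurable (borel \<Otimes>\<^sub>M borel)" unfolding I by measurable
    \<comment> \<open>Pairing with the constant 1 writes the integral as a
      \<open>regular_dist\<close>, so that the congruence rule applies; it asks only for
      measurability of the second argument.\<close>
    have "regular_dist T (?I u) (\<lambda>_. 1) = regular_dist T (?I v) (\<lambda>_. 1)"
    proof (rule regular_dist_cong_AE[OF _ Im])
      show "AE z in cyl_measure T. ?I u z = ?I v z" using eq by eventually_elim simp
    qed simp
    then show "(LINT z:cylinder T|lebesgue. ?I v z) = 0"
      using assms(4) \<psi> by (simp add: regular_dist_def weak_euler_solution_def)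
  qed
  have pressure_v: "- (\<Sum>i\<in>UNIV. dist_space i (dist_space i (regular_dist T p)) \<psi>) =
        (\<Sum>i\<in>UNIV. \<Sum>j\<in>UNIV. dist_space i (dist_space j (regular_dist T (\<lambda>z. tensor (v z) (v z) $ i $ j))) \<psi>)"
    if \<psi>: "test_function T \<psi>" for \<psi>
  proof -
    note \<psi>2 = pdm(2)[OF test_function_pd(2)[OF \<psi>]]
    have eq1: "regular_dist T q (pd_space i (pd_space i \<psi>)) = regular_dist T p (pd_space i (pd_space i \<psi>))" for i
    proof (rule regular_dist_cong_AE)
      show "AE z in cyl_measure T. q z = p z" using eq by eventually_elim simp
    qed (use \<psi>2 in auto)
    have eq2: "regular_dist T (\<lambda>z. tensor (u z) (u z) $ i $ j) (pd_space j (pd_space i \<psi>))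
      = regular_dist T (\<lambda>z. tensor (v z) (v z) $ i $ j) (pd_space j (pd_space i \<psi>))" for i j
    proof (rule regular_dist_cong_AE)
      show "AE z in cyl_measure T. tensor (u z) (u z) $ i $ j = tensor (v z) (v z) $ i $ j" using eq by eventually_elim simp
      show "(\<lambda>z. tensor (v z) (v z) $ i $ j) \<in> borel_measurable (borel \<Otimes>\<^sub>M borel)" unfolding tensor_nth by measurable
    qed (use \<psi>2 in auto)
    have "- (\<Sum>i\<in>UNIV. dist_space i (dist_space i (regular_dist T q)) \<psi>) =
        (\<Sum>i\<in>UNIV. \<Sum>j\<in>UNIV. dist_space i (dist_space j (regular_dist T (\<lambda>z. tensor (u z) (u z) $ i $ j))) \<psi>)"
      using assms(5) \<psi> by (simp add: euler_pressure_def)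
    then show ?thesis unfolding dist_space_def eq1 eq2 .
  qed
  interpret euler_fields T \<rho> v p
    by unfold_locales (use assms(1,2) adm euler_v pressure_v in auto)
  \<comment> \<open>The derivatives in \<open>C_moll\<close> look along whole lines at fixed time,
    so the mollified fields must agree at all \<open>x\<close> of the slice.\<close>
  have slice: "AE t in time_measure T. \<forall>x. mollify \<rho> l u (x, t) = mollify \<rho> l v (x, t) \<and> mollify \<rho> l q (x, t) = mollify \<rho> l p (x, t)
      \<and> R_moll \<rho> l u (x, t) = R_moll \<rho> l v (x, t)"
    using slices
  proof eventually_elim
    case (elim t)
    have e: "AE x in lborel. u (x, t) = v (x, t)" "AE x in lborel. q (x, t) = p (x, t)"
      "AE x in lborel. tensor (u (x, t)) (u (x, t)) = tensor (v (x, t)) (v (x, t))"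
      using elim by (eventually_elim, simp)+
    have "mollify \<rho> l u (x, t) = mollify \<rho> l v (x, t)" "mollify \<rho> l q (x, t) = mollify \<rho> l p (x, t)"
      "mollify \<rho> l (\<lambda>z. tensor (u z) (u z)) (x, t) = mollify \<rho> l (\<lambda>z. tensor (v z) (v z)) (x, t)" for x
      by (rule mollify_cong_AE[OF assms(2)]; use e tensor_measurable[OF l] in simp)+
    then show ?case by (simp add: R_moll_def)
  qed
  have all: "AE z in cyl_measure T. u z = v z \<and> q z = p z \<and> mollify \<rho> l u z = mollify \<rho> l v z \<and> mollify \<rho> l q z = mollify \<rho> l p z
      \<and> divergence (R_moll \<rho> l u) z = divergence (R_moll \<rho> l v) z \<and> gradient (mollify \<rho> l u) z = gradient (mollify \<rho> l v) z"
    using eq AE_cyl_snd[OF slice]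
  proof eventually_elim
    case (elim z)
    obtain x t where z: "z = (x, t)" by (cases z)
    show ?case using elim by (simp add: z divergence_def gradient_def pd_space_def)
  qed
  have AEs: "AE z in cyl_measure T. E_moll \<rho> l u z = E_moll \<rho> l v z"
    "AE z in cyl_measure T. C_moll \<rho> l u z = C_moll \<rho> l v z"
    "AE z in cyl_measure T. (E_moll \<rho> l u z *\<^sub>R mollify \<rho> l u z) $ i = (E_moll \<rho> l v z *\<^sub>R mollify \<rho> l v z) $ i"
    "AE z in cyl_measure T. Q_moll \<rho> l u q z $ i = Q_moll \<rho> l v p z $ i"
    "AE z in cyl_measure T. (norm (u z))\<^sup>2 / 2 = (norm (v z))\<^sup>2 / 2"
    "AE z in cyl_measure T. (((norm (u z))\<^sup>2 / 2 + q z) *\<^sub>R u z) $ i = (((norm (v z))\<^sup>2 / 2 + p z) *\<^sub>R v z) $ i" for i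
    using all by (eventually_elim, simp add: E_moll_def Q_moll_def C_moll_def)+
  note mt = tame_measurable
  have dists:
    "regular_dist T (E_moll \<rho> l u) (pd_time \<phi>) = regular_dist T (E_moll \<rho> l v) (pd_time \<phi>)"
    "regular_dist T (C_moll \<rho> l u) \<phi> = regular_dist T (C_moll \<rho> l v) \<phi>"
    "regular_dist T (\<lambda>z. (E_moll \<rho> l u z *\<^sub>R mollify \<rho> l u z) $ i) (pd_space i \<phi>)
      = regular_dist T (\<lambda>z. (E_moll \<rho> l v z *\<^sub>R mollify \<rho> l v z) $ i) (pd_space i \<phi>)"
    "regular_dist T (\<lambda>z. Q_moll \<rho> l u q z $ i) (pd_space i \<phi>) = regular_dist T (\<lambda>z. Q_moll \<rho> l v p z $ i) (pd_space i \<phi>)"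
    "regular_dist T (\<lambda>z. (norm (u z))\<^sup>2 / 2) (pd_time \<phi>) = regular_dist T (\<lambda>z. (norm (v z))\<^sup>2 / 2) (pd_time \<phi>)"
    "regular_dist T (\<lambda>z. (((norm (u z))\<^sup>2 / 2 + q z) *\<^sub>R u z) $ i) (pd_space i \<phi>)
      = regular_dist T (\<lambda>z. (((norm (v z))\<^sup>2 / 2 + p z) *\<^sub>R v z) $ i) (pd_space i \<phi>)" for i
    by (rule regular_dist_cong_AE[OF AEs(1) mt[OF tame_E[OF l]] pdm(1)[OF \<phi>]]
        regular_dist_cong_AE[OF AEs(2) mt[OF tame_C[OF l]] tm[OF \<phi>]]
        regular_dist_cong_AE[OF AEs(3) mt[OF tame_EU[OF l]] pdm(2)[OF \<phi>]]
        regular_dist_cong_AE[OF AEs(4) mt[OF tame_Q[OF l]] pdm(2)[OF \<phi>]]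
        regular_dist_cong_AE[OF AEs(5) mt[OF tame_energy[OF l]] pdm(1)[OF \<phi>]]
        regular_dist_cong_AE[OF AEs(6) mt[OF tame_flux[OF l]] pdm(2)[OF \<phi>]])+
  show "- duchon_robert T u q \<phi> =
      dist_time (regular_dist T (E_moll \<rho> l u)) \<phi>
      + dist_div T (\<lambda>z. E_moll \<rho> l u z *\<^sub>R mollify \<rho> l u z) \<phi>
      + dist_div T (Q_moll \<rho> l u q) \<phi>
      + regular_dist T (C_moll \<rho> l u) \<phi>"
    using energy_balance[OF l \<phi>]
    unfolding duchon_robert_def dist_time_def dist_div_def dist_space_def dists .
qed

end
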